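(* There is a functor $\mathcal{AR}_{(-)}:\mathbf{cTh}\to 2\mathbf{Law}$ (the algebraic realization functor) from controlled theories to Lawvere $2$-theories, given on objects by $\mathcal{AR}_\Omega:=L_{\mathcal O^\Omega}$, and sending a map of controlled theories $\Phi=(I,h,H):\Omega\to\Omega'$ to the unique map of Lawvere $2$-theories $\mathcal{AR}_\Phi:\mathcal{AR}_\Omega\to\mathcal{AR}_{\Omega'}$ that is compatible, through the pushout structure maps, with $D(\mathbf{Fr}(I)):D(\mathbf{Fr}(\mathcal G))\to D(\mathbf{Fr}(\mathcal G'))$ and with the map $L^{\mathbf{Cat}}_{Q_\Omega}\to L^{\mathbf{Cat}}_{Q_{\Omega'}}$ induced by $\kappa(\Phi):Q_\Omega\to Q_{\Omega'}$.
   Context: A pro is a strict monoidal category whose monoid of objects is $(\mathbf N,+,0)$; maps of pros are strict monoidal functors sending $1$ to $1$. $\mathcal F$ is the opposite of the skeleton of finite sets. A Lawvere theory is a category with a bijective-on-objects finite-product-preserving functor from $\mathcal F$; each is a pro via its products. $\mathbf{Fr}(\mathcal G)$ is the free Lawvere theory on a reduced signature $\mathcal G:\mathbf N\to\mathbf{Set}$. A controlled theory $\Omega=\langle \mathcal G: P\xrightarrow{i}\mathbf{Fr}(\mathcal G)\xrightarrow{\mathbf{st}}L\rangle$ consists of a reduced signature $\mathcal G$, a pro $P$, a Lawvere theory $L$, a full map of Lawvere theories $\mathbf{st}$ and a faithful map of pros $i$. A morphism $(I,h,H):\Omega\to\Omega'$ consists of a map of reduced signatures $I:\mathcal G\to\mathcal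 G'$, a map of pros $h:P\to P'$ and a map of Lawvere theories $H:L\to L'$ with $i'\circ h=\mathbf{Fr}(I)\circ i$ and $\mathbf{st}'\circ\mathbf{Fr}(I)=H\circ\mathbf{st}$. $\mathbf{cTh}$ is the category of controlled theories. For $f\in P(n,k)$, $[f]=\{g\in P(n,k):\mathbf{st}(i(g))=\mathbf{st}(i(f))\}$, and $\overline\Omega$ is the pro with $\overline\Omega(n,k)=\{[f]\}$. A Lawvere $2$-theory is a $2$-category with a bijective-on-objects $2$-functor from $\mathcal F$ (with discrete hom-categories) preserving ($\mathbf{Cat}$-enriched) finite products; maps are product-preserving $2$-functors under $\mathcal F$; the category is $2\mathbf{Law}$. A $\mathbf{Cat}$-pro is the $\mathbf{Cat}$-enriched analogue of a pro. The forgetful functor from $2\mathbf{Law}$ to $\mathbf{Cat}$-pros has a left adjoint $Q\mapsto L^{\mathbf{Cat}}_Q$; $L_P$ is the free Lawvere theory on a pro $P$; $D$ regards pros and Lawvere theories as $\mathbf{Cat}$-enriched with discrete homs. Let $E(S)$ be the category with object set $S$ and exactly one morphism between any two objects. For a controlled theory $\Omega$, put $\mathcal O^\Omega_{[f]}=E([f])$ and let $Q_\Omega$ be the $\mathbf{Cat}$-pro with $Q_\Omega(n,k)=\coprod_{[f]\in\overline\Omega(n,k)}E([f])$ and composition and sum given on objects by those of $P$. The inclusion of objects is a map $D(P)\to Q_\Omega$, inducing $D(L_P)\to L^{\mathbf{Cat}}_{Q_\Omega}$; and $i$ induces $\bar i:L_P\to\mathbf{Fr}(\mathcal G)$. $L_{\mathcal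 O^\Omega}$ is the pushout in $2\mathbf{Law}$ of $D(\mathbf{Fr}(\mathcal G))\xleftarrow{D(\bar i)}D(L_P)\to L^{\mathbf{Cat}}_{Q_\Omega}$. For $\Phi=(I,h,H)$, $\kappa(\Phi):Q_\Omega\to Q_{\Omega'}$ is the map of $\mathbf{Cat}$-pros given by the functors $E([f])\to E([h(f)])$, $g\mapsto h(g)$. *)

theory Defs
  imports "HOL-Library.FuncSet"
begin

text \<open>
  Size conventions.  A type variable \<open>'u\<close> plays the role of the universe of small sets:
  a small set is a subset of \<open>'u\<close>, and all universal properties below range over structures carried
  by \<open>'u\<close> (by \<open>'u \<times> 'u\<close> for 2-cells).  For infinite \<open>'u\<close> this universe is closed under
  all the free constructions and pushouts that are used.  If \<open>'u\<close> is finite there are no pros and no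
  Lawvere theories over it at all, since these have the infinitely many identities of the objects
  \<open>0, 1, 2, \<dots>\<close>; so finiteness needs no separate treatment.
\<close>

section \<open>Categories\<close>

text \<open>The operations are only meaningful on the carriers \<open>Obj\<close> and \<open>Arr\<close>;
  \<open>Cmp C g f\<close> is \<open>g\<close> after \<open>f\<close>.\<close>

record ('o, 'm) cat =
  Obj :: "'o set"
  Arr :: "'m set"
  Src :: "'m \<Rightarrow> 'o"
  Tgt :: "'m \<Rightarrow> 'o"
  Idt :: "'o \<Rightarrow> 'm"
  Cmp :: "'m \<Rightarrow> 'm \<Rightarrow> 'm"

definition hom :: "('o, 'm) cat \<Rightarrow> 'o \<Rightarrow> 'o \<Rightarrow> 'm set" where
  "hom C a b = {f \<in> Arr C. Src C f = a \<and> Tgt C f = b}"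

definition is_category :: "('o, 'm) cat \<Rightarrow> bool" where
  "is_category C \<longleftrightarrow>
     (\<forall>f\<in>Arr C. Src C f \<in> Obj C \<and> Tgt C f \<in> Obj C) \<and>
     (\<forall>a\<in>Obj C. Idt C a \<in> hom C a a) \<and>
     (\<forall>f\<in>Arr C. \<forall>g\<in>Arr C. Tgt C f = Src C g \<longrightarrow> Cmp C g f \<in> hom C (Src C f) (Tgt C g)) \<and>
     (\<forall>f\<in>Arr C. Cmp C f (Idt C (Src C f)) = f \<and> Cmp C (Idt C (Tgt C f)) f = f) \<and>
     (\<forall>f\<in>Arr C. \<forall>g\<in>Arr C. \<forall>h\<in>Arr C. Tgt C f = Src C g \<longrightarrow> Tgt C g = Src C h \<longrightarrow>
        Cmp C h (Cmp C g f) = Cmp C (Cmp C h g) f)"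

definition is_functor ::
  "('o, 'm) cat \<Rightarrow> ('p, 'n) cat \<Rightarrow> ('o \<Rightarrow> 'p) \<Rightarrow> ('m \<Rightarrow> 'n) \<Rightarrow> bool" where
  "is_functor C D F0 F1 \<longleftrightarrow> is_category C \<and> is_category D \<and>
     (\<forall>a\<in>Obj C. F0 a \<in> Obj D \<and> F1 (Idt C a) = Idt D (F0 a)) \<and>
     (\<forall>f\<in>Arr C. F1 f \<in> hom D (F0 (Src C f)) (F0 (Tgt C f))) \<and>
     (\<forall>f\<in>Arr C. \<forall>g\<in>Arr C. Tgt C f = Src C g \<longrightarrow> F1 (Cmp C g f) = Cmp D (F1 g) (F1 f))"

definition op_cat :: "('o, 'm) cat \<Rightarrow> ('o, 'm) cat" where
  "op_cat C = \<lparr>Obj = Obj C, Arr = Arr C, Src = Tgt C, Tgt = Src C, Idt = Idt C,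
     Cmp = (\<lambda>g f. Cmp C f g)\<rparr>"

text \<open>The cone \<open>p i : c \<rightarrow> x i\<close> (\<open>i < k\<close>) exhibits \<open>c\<close> as the product of the
  finite family \<open>x 0, \<dots>, x (k - 1)\<close>.\<close>

definition is_product ::
  "('o, 'm) cat \<Rightarrow> nat \<Rightarrow> (nat \<Rightarrow> 'o) \<Rightarrow> 'o \<Rightarrow> (nat \<Rightarrow> 'm) \<Rightarrow> bool" where
  "is_product C k x c p \<longleftrightarrow> c \<in> Obj C \<and> (\<forall>i<k. p i \<in> hom C c (x i)) \<and>
     (\<forall>z\<in>Obj C. \<forall>f. (\<forall>i<k. f i \<in> hom C z (x i)) \<longrightarrow>
        (\<exists>!h. h \<in> hom C z c \<and> (\<forall>i<k. Cmp C (p i) h = f i)))"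

definition is_pushout ::
  "('o, 'm) cat \<Rightarrow> 'm \<Rightarrow> 'm \<Rightarrow> 'o \<times> 'm \<times> 'm \<Rightarrow> bool" where
  "is_pushout C f g = (\<lambda>(x, p, q).
     f \<in> Arr C \<and> g \<in> Arr C \<and> Src C f = Src C g \<and> x \<in> Obj C \<and>
     p \<in> hom C (Tgt C f) x \<and> q \<in> hom C (Tgt C g) x \<and> Cmp C p f = Cmp C q g \<and>
     (\<forall>y\<in>Obj C. \<forall>p'\<in>hom C (Tgt C f) y. \<forall>q'\<in>hom C (Tgt C g) y. Cmp C p' f = Cmp C q' g \<longrightarrow>
        (\<exists>!u. u \<in> hom C x y \<and> Cmp C u p = p' \<and> Cmp C u q = q')))"

text \<open>\<open>(a, e)\<close> is a universal arrow from \<open>x \<in> B\<close> to the functor \<open>U : C \<rightarrow> B\<close>,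
  i.e. \<open>a\<close> is the value at \<open>x\<close> of a left adjoint of \<open>U\<close> and \<open>e\<close> is the unit.\<close>

definition universal_arrow ::
  "('o, 'm) cat \<Rightarrow> ('p, 'n) cat \<Rightarrow> ('o \<Rightarrow> 'p) \<Rightarrow> ('m \<Rightarrow> 'n) \<Rightarrow> 'p \<Rightarrow> 'o \<times> 'n \<Rightarrow> bool" where
  "universal_arrow C B U0 U1 x = (\<lambda>(a, e). a \<in> Obj C \<and> e \<in> hom B x (U0 a) \<and>
     (\<forall>c\<in>Obj C. \<forall>f\<in>hom B x (U0 c). \<exists>!g. g \<in> hom C a c \<and> Cmp B (U1 g) e = f))"

definition free_on ::
  "('o, 'm) cat \<Rightarrow> ('p, 'n) cat \<Rightarrow> ('o \<Rightarrow> 'p) \<Rightarrow> ('m \<Rightarrow> 'n) \<Rightarrow> 'p \<Rightarrow> 'o \<times> 'n" where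
  "free_on C B U0 U1 x = (SOME u. universal_arrow C B U0 U1 x u)"

text \<open>The arrow \<open>a \<rightarrow> c\<close> of \<open>C\<close> induced by \<open>f : x \<rightarrow> U c\<close>, for the universal arrow
  \<open>u = (a, e)\<close>.\<close>

definition induced ::
  "('o, 'm) cat \<Rightarrow> ('p, 'n) cat \<Rightarrow> ('m \<Rightarrow> 'n) \<Rightarrow> 'o \<times> 'n \<Rightarrow> 'o \<Rightarrow> 'n \<Rightarrow> 'm" where
  "induced C B U1 u c f = (THE g. g \<in> hom C (fst u) c \<and> Cmp B (U1 g) (snd u) = f)"

text \<open>A category of structures: an arrow is a triple (domain, underlying data, codomain).\<close>

definition struct_cat ::
  "'s set \<Rightarrow> ('s \<Rightarrow> 's \<Rightarrow> 'd set) \<Rightarrow> ('s \<Rightarrow> 'd) \<Rightarrow> ('s \<Rightarrow> 'd \<Rightarrow> 'd \<Rightarrow> 'd) \<Rightarrow> ('s, 's \<times> 'd \<times> 's) cat" where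
  "struct_cat S M e c = \<lparr>Obj = S,
     Arr = {(A, m, B). A \<in> S \<and> B \<in> S \<and> m \<in> M A B},
     Src = (\<lambda>(A, m, B). A), Tgt = (\<lambda>(A, m, B). B),
     Idt = (\<lambda>A. (A, e A, A)),
     Cmp = (\<lambda>(B', n, C) (A, m, B). (A, c A n m, C))\<rparr>"

abbreviation data :: "'s \<times> 'd \<times> 's \<Rightarrow> 'd" where
  "data a \<equiv> fst (snd a)"


section \<open>The category F\<close>

text \<open>The skeleton of finite sets: an arrow \<open>(m, f, n)\<close> is a function
  \<open>f : {0, \<dots>, m - 1} \<rightarrow> {0, \<dots>, n - 1}\<close>.\<close>

type_synonym finmap = "nat \<times> (nat \<Rightarrow> nat) \<times> nat"

definition FinSk :: "(nat, finmap) cat" where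
  "FinSk = struct_cat UNIV (\<lambda>m n. {..<m} \<rightarrow>\<^sub>E {..<n}) (\<lambda>m. \<lambda>i\<in>{..<m}. i) (\<lambda>m. compose {..<m})"

definition FF :: "(nat, finmap) cat" where
  "FF = op_cat FinSk"

text \<open>The projections \<open>n + m \<rightarrow> n\<close> and \<open>n + m \<rightarrow> m\<close> in \<open>FF\<close>.\<close>

definition prj1 :: "nat \<Rightarrow> nat \<Rightarrow> finmap" where
  "prj1 n m = (n, (\<lambda>i\<in>{..<n}. i), n + m)"

definition prj2 :: "nat \<Rightarrow> nat \<Rightarrow> finmap" where
  "prj2 n m = (m, (\<lambda>i\<in>{..<m}. n + i), n + m)"


section \<open>Pros, Lawvere theories and reduced signatures\<close>

record 'm pro =
  pcat :: "(nat, 'm) cat"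
  ptens :: "'m \<Rightarrow> 'm \<Rightarrow> 'm"

definition is_pro :: "'m pro \<Rightarrow> bool" where
  "is_pro P \<longleftrightarrow> (let C = pcat P; t = ptens P in
     is_category C \<and> Obj C = UNIV \<and>
     (\<forall>f\<in>Arr C. \<forall>g\<in>Arr C. t f g \<in> hom C (Src C f + Src C g) (Tgt C f + Tgt C g)) \<and>
     (\<forall>n m. t (Idt C n) (Idt C m) = Idt C (n + m)) \<and>
     (\<forall>f\<in>Arr C. \<forall>g\<in>Arr C. \<forall>f'\<in>Arr C. \<forall>g'\<in>Arr C. Tgt C f = Src C g \<longrightarrow> Tgt C f' = Src C g' \<longrightarrow>
        t (Cmp C g f) (Cmp C g' f') = Cmp C (t g g') (t f f')) \<and>
     (\<forall>f\<in>Arr C. \<forall>g\<in>Arr C. \<forall>h\<in>Arr C. t (t f g) h = t f (t g h)) \<and>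
     (\<forall>f\<in>Arr C. t (Idt C 0) f = f \<and> t f (Idt C 0) = f))"

text \<open>A strict monoidal functor sending 1 to 1 is the identity on the objects \<open>(\<nat>, +, 0)\<close>.  Underlying
  functions of maps are kept extensional, so that equality of maps is equality on the carrier.\<close>

definition pro_maps :: "'m pro \<Rightarrow> 'n pro \<Rightarrow> ('m \<Rightarrow> 'n) set" where
  "pro_maps P P' = {h \<in> extensional (Arr (pcat P)). is_functor (pcat P) (pcat P') (\<lambda>n. n) h \<and>
     (\<forall>f\<in>Arr (pcat P). \<forall>g\<in>Arr (pcat P). h (ptens P f g) = ptens P' (h f) (h g))}"

type_synonym 'u pro_arrow = "'u pro \<times> ('u \<Rightarrow> 'u) \<times> 'u pro"

definition Pro :: "('u pro, 'u pro_arrow) cat" where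
  "Pro = struct_cat {P. is_pro P} pro_maps
     (\<lambda>P. \<lambda>f\<in>Arr (pcat P). f) (\<lambda>P. compose (Arr (pcat P)))"

text \<open>The objects of a Lawvere theory are identified with those of \<open>FF\<close> along the bijective-on-objects
  functor, whose action on arrows is \<open>lfin\<close>.\<close>

record 'm law =
  lcat :: "(nat, 'm) cat"
  lfin :: "finmap \<Rightarrow> 'm"

definition is_law :: "'m law \<Rightarrow> bool" where
  "is_law L \<longleftrightarrow> Obj (lcat L) = UNIV \<and> is_functor FF (lcat L) (\<lambda>n. n) (lfin L) \<and>
     (\<forall>k x c p. is_product FF k x c p \<longrightarrow> is_product (lcat L) k x c (\<lambda>i. lfin L (p i)))"

definition law_maps :: "'m law \<Rightarrow> 'n law \<Rightarrow> ('m \<Rightarrow> 'n) set" where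
  "law_maps L L' = {h \<in> extensional (Arr (lcat L)). is_functor (lcat L) (lcat L') (\<lambda>n. n) h \<and>
     (\<forall>k x c p. is_product (lcat L) k x c p \<longrightarrow> is_product (lcat L') k x c (\<lambda>i. h (p i))) \<and>
     (\<forall>a\<in>Arr FF. h (lfin L a) = lfin L' a)}"

type_synonym 'u law_arrow = "'u law \<times> ('u \<Rightarrow> 'u) \<times> 'u law"

definition Law :: "('u law, 'u law_arrow) cat" where
  "Law = struct_cat {L. is_law L} law_maps
     (\<lambda>L. \<lambda>f\<in>Arr (lcat L). f) (\<lambda>L. compose (Arr (lcat L)))"

text \<open>The product of arrows with respect to the chosen products \<open>n + m\<close> with projections
  \<open>j (prj1 n m)\<close> and \<open>j (prj2 n m)\<close>.\<close>

definition prod_arr :: "(nat, 'm) cat \<Rightarrow> (finmap \<Rightarrow> 'm) \<Rightarrow> 'm \<Rightarrow> 'm \<Rightarrow> 'm" where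
  "prod_arr C j f g = (if f \<in> Arr C \<and> g \<in> Arr C
     then THE h. h \<in> hom C (Src C f + Src C g) (Tgt C f + Tgt C g) \<and>
       Cmp C (j (prj1 (Tgt C f) (Tgt C g))) h = Cmp C f (j (prj1 (Src C f) (Src C g))) \<and>
       Cmp C (j (prj2 (Tgt C f) (Tgt C g))) h = Cmp C g (j (prj2 (Src C f) (Src C g)))
     else undefined)"

text \<open>The forgetful functor from Lawvere theories to pros.\<close>

definition law_pro :: "'m law \<Rightarrow> 'm pro" where
  "law_pro L = \<lparr>pcat = lcat L, ptens = prod_arr (lcat L) (lfin L)\<rparr>"

definition law_pro_arr :: "'u law_arrow \<Rightarrow> 'u pro_arrow" where
  "law_pro_arr = (\<lambda>(L, h, L'). (law_pro L, h, law_pro L'))"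

type_synonym 'u sig = "nat \<Rightarrow> 'u set"
type_synonym 'u sig_arrow = "'u sig \<times> (nat \<Rightarrow> 'u \<Rightarrow> 'u) \<times> 'u sig"

definition Sig :: "('u sig, 'u sig_arrow) cat" where
  "Sig = struct_cat UNIV (\<lambda>G G'. {I. \<forall>n. I n \<in> G n \<rightarrow>\<^sub>E G' n})
     (\<lambda>G n. \<lambda>g\<in>G n. g) (\<lambda>G J I n. compose (G n) (J n) (I n))"

text \<open>The forgetful functor from Lawvere theories to reduced signatures: the \<open>n\<close>-ary operations of
  \<open>L\<close> are the arrows \<open>n \<rightarrow> 1\<close>.\<close>

definition law_sig :: "'u law \<Rightarrow> 'u sig" where
  "law_sig L = (\<lambda>n. hom (lcat L) n 1)"

definition law_sig_arr :: "'u law_arrow \<Rightarrow> 'u sig_arrow" where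
  "law_sig_arr = (\<lambda>(L, h, L'). (law_sig L, (\<lambda>n. restrict h (law_sig L n)), law_sig L'))"

definition Fr_univ :: "'u sig \<Rightarrow> 'u law \<times> 'u sig_arrow" where
  "Fr_univ G = free_on Law Sig law_sig law_sig_arr G"

definition Fr :: "'u sig \<Rightarrow> 'u law" where
  "Fr G = fst (Fr_univ G)"

definition Fr_arr :: "'u sig_arrow \<Rightarrow> 'u law_arrow" where
  "Fr_arr I = induced Law Sig law_sig_arr (Fr_univ (Src Sig I)) (Fr (Tgt Sig I))
     (Cmp Sig (snd (Fr_univ (Tgt Sig I))) I)"

definition LP_univ :: "'u pro \<Rightarrow> 'u law \<times> 'u pro_arrow" where
  "LP_univ P = free_on Law Pro law_pro law_pro_arr P"

definition LP :: "'u pro \<Rightarrow> 'u law" where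
  "LP P = fst (LP_univ P)"


section \<open>Two-dimensional structures\<close>

text \<open>A (strict) 2-category with set of objects \<open>\<nat>\<close>, given by its category \<open>one\<close> of 1-cells, the category
  \<open>two\<close> of 2-cells under horizontal composition, and the category \<open>vert\<close> of 1-cells and 2-cells under
  vertical composition, which is the disjoint union of all the hom-categories: the hom-category from
  \<open>n\<close> to \<open>k\<close> has objects \<open>hom (one C) n k\<close> and arrows \<open>hom (two C) n k\<close>.\<close>

record ('o, 'm) cat2 =
  one :: "(nat, 'o) cat"
  two :: "(nat, 'm) cat"
  vert :: "('o, 'm) cat"

definition is_cat2 :: "('o, 'm) cat2 \<Rightarrow> bool" where
  "is_cat2 C \<longleftrightarrow> is_category (one C) \<and> is_category (two C) \<and> is_category (vert C) \<and>
     Obj (one C) = UNIV \<and> Obj (two C) = UNIV \<and>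
     Obj (vert C) = Arr (one C) \<and> Arr (vert C) = Arr (two C) \<and>
     is_functor (two C) (one C) (\<lambda>n. n) (Src (vert C)) \<and>
     is_functor (two C) (one C) (\<lambda>n. n) (Tgt (vert C)) \<and>
     is_functor (one C) (two C) (\<lambda>n. n) (Idt (vert C)) \<and>
     (\<forall>\<alpha>\<in>Arr (two C). \<forall>\<beta>\<in>Arr (two C). \<forall>\<gamma>\<in>Arr (two C). \<forall>\<delta>\<in>Arr (two C).
        Tgt (vert C) \<alpha> = Src (vert C) \<beta> \<longrightarrow> Tgt (vert C) \<gamma> = Src (vert C) \<delta> \<longrightarrow>
        Tgt (two C) \<alpha> = Src (two C) \<gamma> \<longrightarrow>
        Cmp (two C) (Cmp (vert C) \<delta> \<gamma>) (Cmp (vert C) \<beta> \<alpha>) =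
          Cmp (vert C) (Cmp (two C) \<delta> \<beta>) (Cmp (two C) \<gamma> \<alpha>))"

text \<open>2-functors that are the identity on objects, as pairs of an action on 1-cells and one on 2-cells.\<close>

definition is_2functor ::
  "('o, 'm) cat2 \<Rightarrow> ('p, 'n) cat2 \<Rightarrow> ('o \<Rightarrow> 'p) \<times> ('m \<Rightarrow> 'n) \<Rightarrow> bool" where
  "is_2functor C D = (\<lambda>(F1, F2). is_functor (one C) (one D) (\<lambda>n. n) F1 \<and>
     is_functor (two C) (two D) (\<lambda>n. n) F2 \<and> is_functor (vert C) (vert D) F1 F2)"

text \<open>\<open>Cat\<close>-enriched products: the functors \<open>Hom(z, c) \<rightarrow> \<Prod>i<k. Hom(z, x i)\<close> given by
  composition with the \<open>p i\<close> are isomorphisms of categories, that is, bijective on objects (first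
  conjunct) and on arrows (second conjunct; composition of a 2-cell with \<open>p i\<close> is horizontal composition
  with the identity 2-cell of \<open>p i\<close>).\<close>

definition is_2product ::
  "('o, 'm) cat2 \<Rightarrow> nat \<Rightarrow> (nat \<Rightarrow> nat) \<Rightarrow> nat \<Rightarrow> (nat \<Rightarrow> 'o) \<Rightarrow> bool" where
  "is_2product C k x c p \<longleftrightarrow> is_product (one C) k x c p \<and>
     is_product (two C) k x c (\<lambda>i. Idt (vert C) (p i))"

definition comp_pair ::
  "('o, 'm) cat2 \<Rightarrow> ('p \<Rightarrow> 'q) \<times> ('n \<Rightarrow> 'r) \<Rightarrow> ('o \<Rightarrow> 'p) \<times> ('m \<Rightarrow> 'n) \<Rightarrow> ('o \<Rightarrow> 'q) \<times> ('m \<Rightarrow> 'r)" where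
  "comp_pair C = (\<lambda>(G1, G2) (F1, F2). (compose (Arr (one C)) G1 F1, compose (Arr (two C)) G2 F2))"

definition id_pair :: "('o, 'm) cat2 \<Rightarrow> ('o \<Rightarrow> 'o) \<times> ('m \<Rightarrow> 'm)" where
  "id_pair C = ((\<lambda>f\<in>Arr (one C). f), (\<lambda>\<alpha>\<in>Arr (two C). \<alpha>))"

text \<open>\<open>Cat\<close>-pros: the last four conditions and the first two say that the tensor product is given by
  functors \<open>Hom(n, k) \<times> Hom(m, l) \<rightarrow> Hom(n + m, k + l)\<close> forming a strict monoidal structure.\<close>

record ('o, 'm) catpro =
  cpcat :: "('o, 'm) cat2"
  tens1 :: "'o \<Rightarrow> 'o \<Rightarrow> 'o"
  tens2 :: "'m \<Rightarrow> 'm \<Rightarrow> 'm"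

definition is_catpro :: "('o, 'm) catpro \<Rightarrow> bool" where
  "is_catpro Q \<longleftrightarrow> (let C = cpcat Q; V = vert C in
     is_pro \<lparr>pcat = one C, ptens = tens1 Q\<rparr> \<and>
     is_pro \<lparr>pcat = two C, ptens = tens2 Q\<rparr> \<and>
     is_cat2 C \<and>
     (\<forall>\<alpha>\<in>Arr V. \<forall>\<beta>\<in>Arr V. Src V (tens2 Q \<alpha> \<beta>) = tens1 Q (Src V \<alpha>) (Src V \<beta>)) \<and>
     (\<forall>\<alpha>\<in>Arr V. \<forall>\<beta>\<in>Arr V. Tgt V (tens2 Q \<alpha> \<beta>) = tens1 Q (Tgt V \<alpha>) (Tgt V \<beta>)) \<and>
     (\<forall>f\<in>Obj V. \<forall>g\<in>Obj V. tens2 Q (Idt V f) (Idt V g) = Idt V (tens1 Q f g)) \<and>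
     (\<forall>\<alpha>\<in>Arr V. \<forall>\<beta>\<in>Arr V. \<forall>\<alpha>'\<in>Arr V. \<forall>\<beta>'\<in>Arr V. Tgt V \<alpha> = Src V \<beta> \<longrightarrow> Tgt V \<alpha>' = Src V \<beta>' \<longrightarrow>
        tens2 Q (Cmp V \<beta> \<alpha>) (Cmp V \<beta>' \<alpha>') = Cmp V (tens2 Q \<beta> \<beta>') (tens2 Q \<alpha> \<alpha>')))"

definition catpro_maps ::
  "('o, 'm) catpro \<Rightarrow> ('p, 'n) catpro \<Rightarrow> (('o \<Rightarrow> 'p) \<times> ('m \<Rightarrow> 'n)) set" where
  "catpro_maps Q Q' = {(F1, F2). F1 \<in> extensional (Arr (one (cpcat Q))) \<and>
     F2 \<in> extensional (Arr (two (cpcat Q))) \<and> is_2functor (cpcat Q) (cpcat Q') (F1, F2) \<and>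
     (\<forall>f\<in>Arr (one (cpcat Q)). \<forall>g\<in>Arr (one (cpcat Q)). F1 (tens1 Q f g) = tens1 Q' (F1 f) (F1 g)) \<and>
     (\<forall>\<alpha>\<in>Arr (two (cpcat Q)). \<forall>\<beta>\<in>Arr (two (cpcat Q)). F2 (tens2 Q \<alpha> \<beta>) = tens2 Q' (F2 \<alpha>) (F2 \<beta>))}"

type_synonym 'u cells = "'u \<times> 'u"
type_synonym 'u pair_map = "('u \<Rightarrow> 'u) \<times> ('u cells \<Rightarrow> 'u cells)"
type_synonym 'u catpro_arrow = "('u, 'u cells) catpro \<times> 'u pair_map \<times> ('u, 'u cells) catpro"

definition CatPro :: "(('u, 'u cells) catpro, 'u catpro_arrow) cat" where
  "CatPro = struct_cat {Q. is_catpro Q} catpro_maps (\<lambda>Q. id_pair (cpcat Q)) (\<lambda>Q. comp_pair (cpcat Q))"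

text \<open>Lawvere 2-theories.  Since the hom-categories of \<open>FF\<close> are discrete, a 2-functor from \<open>FF\<close> is
  a functor to the category of 1-cells, and the \<open>Cat\<close>-enriched products of \<open>FF\<close> are its ordinary
  products.\<close>

record ('o, 'm) law2 =
  l2cat :: "('o, 'm) cat2"
  l2fin :: "finmap \<Rightarrow> 'o"

definition is_law2 :: "('o, 'm) law2 \<Rightarrow> bool" where
  "is_law2 L \<longleftrightarrow> is_cat2 (l2cat L) \<and> is_functor FF (one (l2cat L)) (\<lambda>n. n) (l2fin L) \<and>
     (\<forall>k x c p. is_product FF k x c p \<longrightarrow> is_2product (l2cat L) k x c (\<lambda>i. l2fin L (p i)))"

definition law2_maps ::
  "('o, 'm) law2 \<Rightarrow> ('p, 'n) law2 \<Rightarrow> (('o \<Rightarrow> 'p) \<times> ('m \<Rightarrow> 'n)) set" where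
  "law2_maps L L' = {(F1, F2). F1 \<in> extensional (Arr (one (l2cat L))) \<and>
     F2 \<in> extensional (Arr (two (l2cat L))) \<and> is_2functor (l2cat L) (l2cat L') (F1, F2) \<and>
     (\<forall>k x c p. is_2product (l2cat L) k x c p \<longrightarrow> is_2product (l2cat L') k x c (\<lambda>i. F1 (p i))) \<and>
     (\<forall>a\<in>Arr FF. F1 (l2fin L a) = l2fin L' a)}"

type_synonym 'u law2_arrow = "('u, 'u cells) law2 \<times> 'u pair_map \<times> ('u, 'u cells) law2"

definition TwoLaw :: "(('u, 'u cells) law2, 'u law2_arrow) cat" where
  "TwoLaw = struct_cat {L. is_law2 L} law2_maps (\<lambda>L. id_pair (l2cat L)) (\<lambda>L. comp_pair (l2cat L))"

text \<open>The forgetful functor from Lawvere 2-theories to \<open>Cat\<close>-pros and its left adjoint.\<close>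

definition law2_catpro :: "('o, 'm) law2 \<Rightarrow> ('o, 'm) catpro" where
  "law2_catpro L = \<lparr>cpcat = l2cat L, tens1 = prod_arr (one (l2cat L)) (l2fin L),
     tens2 = prod_arr (two (l2cat L)) (\<lambda>a. Idt (vert (l2cat L)) (l2fin L a))\<rparr>"

definition law2_catpro_arr :: "'u law2_arrow \<Rightarrow> 'u catpro_arrow" where
  "law2_catpro_arr = (\<lambda>(L, F, L'). (law2_catpro L, F, law2_catpro L'))"

definition LCat_univ :: "('u, 'u cells) catpro \<Rightarrow> ('u, 'u cells) law2 \<times> 'u catpro_arrow" where
  "LCat_univ Q = free_on TwoLaw CatPro law2_catpro law2_catpro_arr Q"

definition LCat :: "('u, 'u cells) catpro \<Rightarrow> ('u, 'u cells) law2" where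
  "LCat Q = fst (LCat_univ Q)"

definition LCat_arr :: "'u catpro_arrow \<Rightarrow> 'u law2_arrow" where
  "LCat_arr K = induced TwoLaw CatPro law2_catpro_arr (LCat_univ (Src CatPro K)) (LCat (Tgt CatPro K))
     (Cmp CatPro (snd (LCat_univ (Tgt CatPro K))) K)"

text \<open>The category \<open>E(S)\<close>, and the coproduct of the \<open>E(S)\<close> for \<open>S\<close> in a set \<open>K\<close> of
  pairwise disjoint sets.\<close>

definition Ecat :: "'u set \<Rightarrow> ('u, 'u cells) cat" where
  "Ecat S = \<lparr>Obj = S, Arr = S \<times> S, Src = fst, Tgt = snd, Idt = (\<lambda>x. (x, x)),
     Cmp = (\<lambda>\<beta> \<alpha>. (fst \<alpha>, snd \<beta>))\<rparr>"

definition coprod_E :: "'u set set \<Rightarrow> ('u, 'u cells) cat" where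
  "coprod_E K = (Ecat (\<Union>K))\<lparr>Arr := (\<Union>S\<in>K. Arr (Ecat S))\<rparr>"

text \<open>For a pro \<open>P\<close> and a partition \<open>K\<close> of its arrows into sets of parallel arrows that is compatible
  with composition and tensor product: the \<open>Cat\<close>-pro whose hom-categories are the coproducts of the
  \<open>E(S)\<close> for those \<open>S \<in> K\<close> that consist of arrows \<open>n \<rightarrow> k\<close>, with operations on 1-cells
  those of \<open>P\<close>.  Operations on 2-cells are then determined by their sources and targets.\<close>

definition thick_cat2 :: "(nat, 'u) cat \<Rightarrow> 'u set set \<Rightarrow> ('u, 'u cells) cat2" where
  "thick_cat2 C K = \<lparr>one = C,
     two = \<lparr>Obj = Obj C, Arr = Arr (coprod_E K), Src = (\<lambda>\<alpha>. Src C (fst \<alpha>)), Tgt = (\<lambda>\<alpha>. Tgt C (fst \<alpha>)),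
        Idt = (\<lambda>n. (Idt C n, Idt C n)), Cmp = (\<lambda>\<beta> \<alpha>. (Cmp C (fst \<beta>) (fst \<alpha>), Cmp C (snd \<beta>) (snd \<alpha>)))\<rparr>,
     vert = coprod_E K\<rparr>"

definition thick_catpro :: "'u pro \<Rightarrow> 'u set set \<Rightarrow> ('u, 'u cells) catpro" where
  "thick_catpro P K = \<lparr>cpcat = thick_cat2 (pcat P) K, tens1 = ptens P,
     tens2 = (\<lambda>\<alpha> \<beta>. if \<alpha> \<in> Arr (coprod_E K) \<and> \<beta> \<in> Arr (coprod_E K)
        then (ptens P (fst \<alpha>) (fst \<beta>), ptens P (snd \<alpha>) (snd \<beta>)) else undefined)\<rparr>"

text \<open>The functors \<open>D\<close>.  The discrete category on \<open>S\<close> is the coproduct of the \<open>E({f})\<close> for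
  \<open>f \<in> S\<close>: the identity of \<open>f\<close> is \<open>(f, f)\<close>.\<close>

definition singletons :: "'u set \<Rightarrow> 'u set set" where
  "singletons S = (\<lambda>f. {f}) ` S"

definition D_pro :: "'u pro \<Rightarrow> ('u, 'u cells) catpro" where
  "D_pro P = thick_catpro P (singletons (Arr (pcat P)))"

definition D_law :: "'u law \<Rightarrow> ('u, 'u cells) law2" where
  "D_law L = \<lparr>l2cat = thick_cat2 (lcat L) (singletons (Arr (lcat L))), l2fin = lfin L\<rparr>"

definition D_map :: "('o, 'u cells) cat2 \<Rightarrow> ('u \<Rightarrow> 'u) \<Rightarrow> ('u \<Rightarrow> 'u) \<times> ('u cells \<Rightarrow> 'u cells)" where
  "D_map C h = (h, restrict (map_prod h h) (Arr (two C)))"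

definition D_pro_arr :: "'u pro_arrow \<Rightarrow> 'u catpro_arrow" where
  "D_pro_arr = (\<lambda>(P, h, P'). (D_pro P, D_map (cpcat (D_pro P)) h, D_pro P'))"

definition D_law_arr :: "'u law_arrow \<Rightarrow> 'u law2_arrow" where
  "D_law_arr = (\<lambda>(L, h, L'). (D_law L, D_map (l2cat (D_law L)) h, D_law L'))"


section \<open>Controlled theories\<close>

record 'u ctheory =
  csig :: "'u sig"
  cpro :: "'u pro"
  claw :: "'u law"
  cinc :: "'u pro_arrow"
  cst :: "'u law_arrow"

definition is_ctheory :: "'u ctheory \<Rightarrow> bool" where
  "is_ctheory \<Omega> \<longleftrightarrow>
     csig \<Omega> \<in> Obj Sig \<and> cpro \<Omega> \<in> Obj Pro \<and> claw \<Omega> \<in> Obj Law \<and>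
     cinc \<Omega> \<in> hom Pro (cpro \<Omega>) (law_pro (Fr (csig \<Omega>))) \<and>
     (\<forall>n k. inj_on (data (cinc \<Omega>)) (hom (pcat (cpro \<Omega>)) n k)) \<and>
     cst \<Omega> \<in> hom Law (Fr (csig \<Omega>)) (claw \<Omega>) \<and>
     (\<forall>n k. data (cst \<Omega>) ` hom (lcat (Fr (csig \<Omega>))) n k = hom (lcat (claw \<Omega>)) n k)"

type_synonym 'u ctheory_arrow =
  "'u ctheory \<times> ('u sig_arrow \<times> 'u pro_arrow \<times> 'u law_arrow) \<times> 'u ctheory"

definition ctheory_maps ::
  "'u ctheory \<Rightarrow> 'u ctheory \<Rightarrow> ('u sig_arrow \<times> 'u pro_arrow \<times> 'u law_arrow) set" where
  "ctheory_maps \<Omega> \<Omega>' = {(I, h, H).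
     I \<in> hom Sig (csig \<Omega>) (csig \<Omega>') \<and> h \<in> hom Pro (cpro \<Omega>) (cpro \<Omega>') \<and>
     H \<in> hom Law (claw \<Omega>) (claw \<Omega>') \<and>
     Cmp Pro (cinc \<Omega>') h = Cmp Pro (law_pro_arr (Fr_arr I)) (cinc \<Omega>) \<and>
     Cmp Law (cst \<Omega>') (Fr_arr I) = Cmp Law H (cst \<Omega>)}"

definition cTh :: "('u ctheory, 'u ctheory_arrow) cat" where
  "cTh = struct_cat {\<Omega>. is_ctheory \<Omega>} ctheory_maps
     (\<lambda>\<Omega>. (Idt Sig (csig \<Omega>), Idt Pro (cpro \<Omega>), Idt Law (claw \<Omega>)))
     (\<lambda>_ (J, g, G) (I, h, H). (Cmp Sig J I, Cmp Pro g h, Cmp Law G H))"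

text \<open>The class \<open>[f]\<close>, and the set of all classes (over all pairs \<open>n, k\<close>).\<close>

definition cls :: "'u ctheory \<Rightarrow> 'u \<Rightarrow> 'u set" where
  "cls \<Omega> f = (let C = pcat (cpro \<Omega>) in {g \<in> hom C (Src C f) (Tgt C f).
     data (cst \<Omega>) (data (cinc \<Omega>) g) = data (cst \<Omega>) (data (cinc \<Omega>) f)})"

definition classes :: "'u ctheory \<Rightarrow> 'u set set" where
  "classes \<Omega> = cls \<Omega> ` Arr (pcat (cpro \<Omega>))"

definition Qpro :: "'u ctheory \<Rightarrow> ('u, 'u cells) catpro" where
  "Qpro \<Omega> = thick_catpro (cpro \<Omega>) (classes \<Omega>)"

text \<open>The inclusion of objects \<open>D(P) \<rightarrow> Qpro \<Omega>\<close> and the induced map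
  \<open>D(L_P) \<rightarrow> L^Cat_Q\<close>: the unique one that restricts to the inclusion along the units.\<close>

definition incl :: "'u ctheory \<Rightarrow> 'u catpro_arrow" where
  "incl \<Omega> = (D_pro (cpro \<Omega>), id_pair (cpcat (D_pro (cpro \<Omega>))), Qpro \<Omega>)"

definition incl_ind :: "'u ctheory \<Rightarrow> 'u law2_arrow" where
  "incl_ind \<Omega> = (THE m. m \<in> hom TwoLaw (D_law (LP (cpro \<Omega>))) (LCat (Qpro \<Omega>)) \<and>
     Cmp CatPro (law2_catpro_arr m) (D_pro_arr (snd (LP_univ (cpro \<Omega>)))) =
     Cmp CatPro (snd (LCat_univ (Qpro \<Omega>))) (incl \<Omega>))"

definition inc_bar :: "'u ctheory \<Rightarrow> 'u law_arrow" where
  "inc_bar \<Omega> = induced Law Pro law_pro_arr (LP_univ (cpro \<Omega>)) (Fr (csig \<Omega>)) (cinc \<Omega>)"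

definition LO_pushout :: "'u ctheory \<Rightarrow> ('u, 'u cells) law2 \<times> 'u law2_arrow \<times> 'u law2_arrow" where
  "LO_pushout \<Omega> = (SOME t. is_pushout TwoLaw (D_law_arr (inc_bar \<Omega>)) (incl_ind \<Omega>) t)"

definition LO :: "'u ctheory \<Rightarrow> ('u, 'u cells) law2" where
  "LO \<Omega> = fst (LO_pushout \<Omega>)"

definition LO_Fr :: "'u ctheory \<Rightarrow> 'u law2_arrow" where
  "LO_Fr \<Omega> = fst (snd (LO_pushout \<Omega>))"

definition LO_Q :: "'u ctheory \<Rightarrow> 'u law2_arrow" where
  "LO_Q \<Omega> = snd (snd (LO_pushout \<Omega>))"

definition kappa :: "'u ctheory_arrow \<Rightarrow> 'u catpro_arrow" where
  "kappa = (\<lambda>(\<Omega>, (I, h, H), \<Omega>'). (Qpro \<Omega>, D_map (cpcat (Qpro \<Omega>)) (data h), Qpro \<Omega>'))"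

text \<open>The maps \<open>u : LO \<Omega> \<rightarrow> LO \<Omega>'\<close> compatible with \<open>\<Phi> : \<Omega> \<rightarrow> \<Omega>'\<close>
  through the structure maps of the pushouts.\<close>

definition AR_compatible :: "'u ctheory_arrow \<Rightarrow> 'u law2_arrow \<Rightarrow> bool" where
  "AR_compatible = (\<lambda>(\<Omega>, (I, h, H), \<Omega>') u. u \<in> hom TwoLaw (LO \<Omega>) (LO \<Omega>') \<and>
     Cmp TwoLaw u (LO_Fr \<Omega>) = Cmp TwoLaw (LO_Fr \<Omega>') (D_law_arr (Fr_arr I)) \<and>
     Cmp TwoLaw u (LO_Q \<Omega>) = Cmp TwoLaw (LO_Q \<Omega>') (LCat_arr (kappa (\<Omega>, (I, h, H), \<Omega>'))))"

end

theory Submission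
  imports Defs "HOL-Library.Countable_Set" "HOL-Library.Equipollence"
begin

text \<open>
  The realization of a controlled theory is a pushout of objects that are themselves given by universal
  properties: the free Lawvere theories on a signature and on a pro, and the free Lawvere 2-theory on a
  \<open>Cat\<close>-pro.  Once all of these exist, functoriality is formal.  A morphism of controlled theories induces a
  map of the spans defining the two pushouts (\<open>legs_natural\<close>), hence exactly one map of the pushouts that is
  compatible with the structure maps (\<open>AR_unique\<close>).  Identities and composites of compatible maps are
  compatible with identities and composites (\<open>AR_compatible_id\<close>, \<open>AR_compatible_cmp\<close>), so uniqueness makes
  the assignment a functor.

  What needs work is existence, for structures whose cells are drawn from the fixed type \<open>'u\<close>.  One
  construction, in the locale \<open>free_family\<close>, covers all cases.  Consider all models, that is, all Lawvere
  2-theories over \<open>'u\<close> with an interpretation of the generators that satisfies the relations wanted.  In the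
  product of the models, with operations taken pointwise, form the 2-theory generated by the generators.  The
  projections to the models are jointly faithful, so every relation between cells that holds in all models holds in the
  generated 2-theory; in particular the generators satisfy the relations there.  Its projections give the
  required map to every model, and a map out of it is determined by its values on the generators
  (\<open>free_unique\<close>).  It can be carried by \<open>'u\<close> because its cells are values of finite trees over the
  generators: if \<open>'u\<close> is infinite, there are at most as many of these as elements of \<open>'u\<close>
  (\<open>op_closure_lepoll\<close>).  And \<open>'u\<close> is infinite whenever a pro over it exists (\<open>pro_infinite\<close>); otherwise
  there are no controlled theories.

  The instances are the free 2-theories (\<open>LCat_exists\<close>), the pushouts (\<open>pushout_exists\<close>) and, through
  codiscrete 2-theories, the free Lawvere theories (\<open>LP_exists\<close>, \<open>Fr_exists\<close>): maps of Lawvere theories into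
  \<open>L\<close> are maps of 2-theories into the 2-theory with exactly one 2-cell between any two parallel arrows of
  \<open>L\<close>.  Dually, discrete 2-theories show that \<open>D\<close> takes the free Lawvere theory on a pro \<open>P\<close> to the free
  2-theory on \<open>D P\<close> (\<open>D_LP_universal\<close>), which determines the second leg of the span.
\<close>

section \<open>Categories, functors and universal properties\<close>

lemma in_hom: "f \<in> hom C a b \<longleftrightarrow> f \<in> Arr C \<and> Src C f = a \<and> Tgt C f = b"
  by (auto simp: hom_def)

lemma arr_hom: "f \<in> Arr C \<Longrightarrow> f \<in> hom C (Src C f) (Tgt C f)"
  by (simp add: in_hom)

lemma is_categoryI:
  assumes "\<And>f. f \<in> Arr C \<Longrightarrow> Src C f \<in> Obj C \<and> Tgt C f \<in> Obj C"
    and "\<And>a. a \<in> Obj C \<Longrightarrow> Idt C a \<in> hom C a a"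
    and "\<And>f g a b c. f \<in> hom C a b \<Longrightarrow> g \<in> hom C b c \<Longrightarrow> Cmp C g f \<in> hom C a c"
    and "\<And>f a b. f \<in> hom C a b \<Longrightarrow> Cmp C f (Idt C a) = f"
    and "\<And>f a b. f \<in> hom C a b \<Longrightarrow> Cmp C (Idt C b) f = f"
    and "\<And>f g h a b c d. f \<in> hom C a b \<Longrightarrow> g \<in> hom C b c \<Longrightarrow> h \<in> hom C c d \<Longrightarrow>
      Cmp C h (Cmp C g f) = Cmp C (Cmp C h g) f"
  shows "is_category C"
  unfolding is_category_def
  using assms(1,2) assms(3-6)[unfolded in_hom] by (auto simp: in_hom)

lemma cat_obj: "is_category C \<Longrightarrow> f \<in> hom C a b \<Longrightarrow> a \<in> Obj C \<and> b \<in> Obj C"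
  by (auto simp: is_category_def in_hom)

lemma cat_id: "is_category C \<Longrightarrow> a \<in> Obj C \<Longrightarrow> Idt C a \<in> hom C a a"
  by (auto simp: is_category_def)

lemma cat_cmp: "is_category C \<Longrightarrow> f \<in> hom C a b \<Longrightarrow> g \<in> hom C b c \<Longrightarrow> Cmp C g f \<in> hom C a c"
  unfolding is_category_def in_hom by metis

lemma cat_idr: "is_category C \<Longrightarrow> f \<in> hom C a b \<Longrightarrow> Cmp C f (Idt C a) = f"
  unfolding is_category_def in_hom by metis

lemma cat_idl: "is_category C \<Longrightarrow> f \<in> hom C a b \<Longrightarrow> Cmp C (Idt C b) f = f"
  unfolding is_category_def in_hom by metis

lemma cat_assoc: "is_category C \<Longrightarrow> f \<in> hom C a b \<Longrightarrow> g \<in> hom C b c \<Longrightarrow> h \<in> hom C c d \<Longrightarrow>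
    Cmp C h (Cmp C g f) = Cmp C (Cmp C h g) f"
  unfolding is_category_def in_hom by metis

lemma is_functorI:
  assumes "is_category C" "is_category D"
    and "\<And>a. a \<in> Obj C \<Longrightarrow> F0 a \<in> Obj D"
    and "\<And>a. a \<in> Obj C \<Longrightarrow> F1 (Idt C a) = Idt D (F0 a)"
    and "\<And>f a b. f \<in> hom C a b \<Longrightarrow> F1 f \<in> hom D (F0 a) (F0 b)"
    and "\<And>f g a b c. f \<in> hom C a b \<Longrightarrow> g \<in> hom C b c \<Longrightarrow> F1 (Cmp C g f) = Cmp D (F1 g) (F1 f)"
  shows "is_functor C D F0 F1"
  unfolding is_functor_def
  using assms(1-4) assms(5,6)[unfolded in_hom] by (auto simp: in_hom)

lemma functor_cats: "is_functor C D F0 F1 \<Longrightarrow> is_category C \<and> is_category D"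
  by (simp add: is_functor_def)

lemma functor_obj: "is_functor C D F0 F1 \<Longrightarrow> a \<in> Obj C \<Longrightarrow> F0 a \<in> Obj D"
  by (simp add: is_functor_def)

lemma functor_hom: "is_functor C D F0 F1 \<Longrightarrow> f \<in> hom C a b \<Longrightarrow> F1 f \<in> hom D (F0 a) (F0 b)"
  by (auto simp: is_functor_def in_hom)

lemma functor_id: "is_functor C D F0 F1 \<Longrightarrow> a \<in> Obj C \<Longrightarrow> F1 (Idt C a) = Idt D (F0 a)"
  by (simp add: is_functor_def)

lemma functor_cmp: "is_functor C D F0 F1 \<Longrightarrow> f \<in> hom C a b \<Longrightarrow> g \<in> hom C b c \<Longrightarrow>
    F1 (Cmp C g f) = Cmp D (F1 g) (F1 f)"
  by (auto simp: is_functor_def in_hom)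

lemma functor_cong:
  assumes "is_functor C D F0 F1"
    and "\<And>a. a \<in> Obj C \<Longrightarrow> G0 a = F0 a" "\<And>f. f \<in> Arr C \<Longrightarrow> G1 f = F1 f"
  shows "is_functor C D G0 G1"
proof (rule is_functorI)
  show C: "is_category C" and D: "is_category D" using functor_cats[OF assms(1)] by auto
  fix a assume a: "a \<in> Obj C"
  show "G0 a \<in> Obj D" using functor_obj[OF assms(1) a] assms(2)[OF a] by simp
  show "G1 (Idt C a) = Idt D (G0 a)"
    using functor_id[OF assms(1) a] assms(2)[OF a] assms(3) cat_id[OF C a] by (simp add: in_hom)
next
  have C: "is_category C" using functor_cats[OF assms(1)] by auto
  fix f a b assume f: "f \<in> hom C a b"
  show f': "G1 f \<in> hom D (G0 a) (G0 b)"
    using functor_hom[OF assms(1) f] assms(2,3) f cat_obj[OF C f] by (simp add: in_hom)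
  fix g c assume g: "g \<in> hom C b c"
  show "G1 (Cmp C g f) = Cmp D (G1 g) (G1 f)"
    using functor_cmp[OF assms(1) f g] cat_cmp[OF C f g] assms(3) f g by (simp add: in_hom)
qed

lemma functor_compose:
  assumes "is_functor C D F0 F1" "is_functor D E G0 G1"
  shows "is_functor C E (\<lambda>a. G0 (F0 a)) (\<lambda>f. G1 (F1 f))"
  by (rule is_functorI)
     (simp_all add: functor_cats[OF assms(1)] functor_cats[OF assms(2)] functor_obj[OF assms(1)]
       functor_obj[OF assms(2)] functor_id[OF assms(1)] functor_id[OF assms(2)] functor_hom[OF assms(1)]
       functor_hom[OF assms(2)] functor_cmp[OF assms(1)] functor_cmp[OF assms(2) functor_hom[OF assms(1)] functor_hom[OF assms(1)]])

lemma functor_ident: "is_category C \<Longrightarrow> is_functor C C (\<lambda>a. a) (\<lambda>f. f)"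
  by (rule is_functorI) (auto)

lemma struct_cat_hom:
  "f \<in> hom (struct_cat S M e c) A B \<longleftrightarrow> (\<exists>m. f = (A, m, B) \<and> A \<in> S \<and> B \<in> S \<and> m \<in> M A B)"
  by (cases f) (auto simp: struct_cat_def in_hom)

lemma struct_cat_simps:
  "Obj (struct_cat S M e c) = S"
  "(A, m, B) \<in> Arr (struct_cat S M e c) \<longleftrightarrow> A \<in> S \<and> B \<in> S \<and> m \<in> M A B"
  "Src (struct_cat S M e c) (A, m, B) = A"
  "Tgt (struct_cat S M e c) (A, m, B) = B"
  "Idt (struct_cat S M e c) A = (A, e A, A)"
  "Cmp (struct_cat S M e c) (B', n, C) (A, m, B) = (A, c A n m, C)"
  by (auto simp: struct_cat_def)

lemma struct_cat_category:
  assumes "\<And>A. A \<in> S \<Longrightarrow> e A \<in> M A A"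
    and "\<And>A B C m n. A \<in> S \<Longrightarrow> B \<in> S \<Longrightarrow> C \<in> S \<Longrightarrow> m \<in> M A B \<Longrightarrow> n \<in> M B C \<Longrightarrow> c A n m \<in> M A C"
    and "\<And>A B m. A \<in> S \<Longrightarrow> B \<in> S \<Longrightarrow> m \<in> M A B \<Longrightarrow> c A m (e A) = m"
    and "\<And>A B m. A \<in> S \<Longrightarrow> B \<in> S \<Longrightarrow> m \<in> M A B \<Longrightarrow> c A (e B) m = m"
    and "\<And>A B C D m n p. A \<in> S \<Longrightarrow> B \<in> S \<Longrightarrow> C \<in> S \<Longrightarrow> D \<in> S \<Longrightarrow>
      m \<in> M A B \<Longrightarrow> n \<in> M B C \<Longrightarrow> p \<in> M C D \<Longrightarrow> c A p (c A n m) = c A (c B p n) m"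
  shows "is_category (struct_cat S M e c)"
  apply (rule is_categoryI)
       apply (force simp: struct_cat_def)
  unfolding struct_cat_hom
      apply (auto simp: struct_cat_simps intro: assms(1,2))
    apply (simp_all add: assms(3,4,5))
  done

lemma productD:
  assumes "is_product C k x c p"
  shows "c \<in> Obj C" "i < k \<Longrightarrow> p i \<in> hom C c (x i)"
    "z \<in> Obj C \<Longrightarrow> (\<And>i. i < k \<Longrightarrow> f i \<in> hom C z (x i)) \<Longrightarrow>
      \<exists>!h. h \<in> hom C z c \<and> (\<forall>i<k. Cmp C (p i) h = f i)"
  using assms unfolding is_product_def by auto

lemma product_joint:
  assumes "is_category C" "is_product C k x c p" "h \<in> hom C z c" "h' \<in> hom C z c"
    and "\<And>i. i < k \<Longrightarrow> Cmp C (p i) h = Cmp C (p i) h'"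
  shows "h = h'"
proof -
  have "\<exists>!u. u \<in> hom C z c \<and> (\<forall>i<k. Cmp C (p i) u = Cmp C (p i) h)"
    by (rule productD(3)[OF assms(2)])
       (use cat_cmp[OF assms(1,3) productD(2)[OF assms(2)]] cat_obj[OF assms(1,3)] in auto)
  then show ?thesis using assms(3-5) by metis
qed

text \<open>Any two products of a family are isomorphic, and functors preserve isomorphisms; so a functor that
  preserves one product of a family preserves every other one.\<close>

lemma product_transfer:
  assumes F: "is_functor C D (\<lambda>n. n) F" and q: "is_product C k x c q"
    and Fq: "is_product D k x c (\<lambda>i. F (q i))" and p: "is_product C k x c' p"
  shows "is_product D k x c' (\<lambda>i. F (p i))"
proof -
  have C: "is_category C" and D: "is_category D" using functor_cats[OF F] by auto
  note pD = productD[OF p] and qD = productD[OF q] and FqD = productD[OF Fq]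
  obtain u where u: "u \<in> hom C c' c" "\<And>i. i < k \<Longrightarrow> Cmp C (q i) u = p i"
    using qD(3)[of c' p] pD by blast
  obtain v where v: "v \<in> hom C c c'" "\<And>i. i < k \<Longrightarrow> Cmp C (p i) v = q i"
    using pD(3)[of c q] qD by blast
  have vu: "Cmp C v u = Idt C c'"
    by (rule product_joint[OF C p, of _ c'])
       (auto simp: cat_assoc[OF C u(1) v(1) pD(2)] u v pD cat_idr[OF C pD(2)]
         intro: cat_cmp[OF C u(1) v(1)] cat_id[OF C])
  have Fvu: "Cmp D (F v) (F u) = Idt D c'"
    using functor_cmp[OF F u(1) v(1)] functor_id[OF F pD(1)] vu by simp
  have Fu: "F u \<in> hom D c' c" and Fv: "F v \<in> hom D c c'"
    using functor_hom[OF F] u v by auto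
  have Fp: "F (p i) \<in> hom D c' (x i)" if "i < k" for i using functor_hom[OF F pD(2)[OF that]] .
  have Fq': "F (q i) \<in> hom D c (x i)" if "i < k" for i using functor_hom[OF F qD(2)[OF that]] .
  have Fpv: "Cmp D (F (p i)) (F v) = F (q i)" if "i < k" for i
    using functor_cmp[OF F v(1) pD(2)[OF that]] v(2)[OF that] by simp
  have Fqu: "Cmp D (F (q i)) (F u) = F (p i)" if "i < k" for i
    using functor_cmp[OF F u(1) qD(2)[OF that]] u(2)[OF that] by simp
  show ?thesis unfolding is_product_def
  proof (intro conjI allI impI ballI)
    show "c' \<in> Obj D" using functor_obj[OF F pD(1)] by simp
    show "i < k \<Longrightarrow> F (p i) \<in> hom D c' (x i)" for i by (rule Fp)
    fix z f assume z: "z \<in> Obj D" and f: "\<forall>i<k. f i \<in> hom D z (x i)"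
    obtain h where h: "h \<in> hom D z c" "\<And>i. i < k \<Longrightarrow> Cmp D (F (q i)) h = f i"
      using FqD(3)[OF z, of f] f by blast
    show "\<exists>!h. h \<in> hom D z c' \<and> (\<forall>i<k. Cmp D (F (p i)) h = f i)"
    proof (rule ex1I[of _ "Cmp D (F v) h"], intro conjI allI impI)
      show "Cmp D (F v) h \<in> hom D z c'" by (rule cat_cmp[OF D h(1) Fv])
      fix i assume i: "i < k"
      show "Cmp D (F (p i)) (Cmp D (F v) h) = f i"
        using cat_assoc[OF D h(1) Fv Fp[OF i]] Fpv[OF i] h(2)[OF i] by simp
    next
      fix h' assume h': "h' \<in> hom D z c' \<and> (\<forall>i<k. Cmp D (F (p i)) h' = f i)"
      have "Cmp D (F u) h' = h"
      proof (rule product_joint[OF D Fq])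
        fix i assume i: "i < k"
        show "Cmp D (F (q i)) (Cmp D (F u) h') = Cmp D (F (q i)) h"
          using cat_assoc[OF D conjunct1[OF h'] Fu Fq'[OF i]] conjunct2[OF h'] Fqu[OF i] i h(2)[OF i] by simp
      qed (use h h' Fu cat_cmp[OF D _ Fu] in auto)
      then show "h' = Cmp D (F v) h"
        using cat_assoc[OF D conjunct1[OF h'] Fu Fv] Fvu cat_idl[OF D conjunct1[OF h']] by simp
    qed
  qed
qed

section \<open>Products in F\<close>

lemma FF_simps [simp]:
  "Obj FF = UNIV"
  "(m, f, n) \<in> Arr FF \<longleftrightarrow> f \<in> {..<m} \<rightarrow>\<^sub>E {..<n}"
  "Src FF (m, f, n) = n" "Tgt FF (m, f, n) = m"
  "Idt FF n = (n, \<lambda>i\<in>{..<n}. i, n)"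
  "Cmp FF (l, g, k) (k', f, n) = (l, compose {..<l} f g, n)"
  by (auto simp: FF_def FinSk_def op_cat_def struct_cat_simps)

lemma FF_hom: "x \<in> hom FF n k \<longleftrightarrow> (\<exists>f \<in> {..<k} \<rightarrow>\<^sub>E {..<n}. x = (k, f, n))"
  by (cases x) (auto simp: in_hom)

lemma FF_category: "is_category FF"
proof (rule is_categoryI)
  fix f :: finmap and a b assume "f \<in> hom FF a b"
  then obtain f' where f: "f = (b, f', a)" "f' \<in> {..<b} \<rightarrow>\<^sub>E {..<a}" by (auto simp: FF_hom)
  have "i < b \<Longrightarrow> f' i < a" "\<not> i < b \<Longrightarrow> f' i = undefined" for i
    using f(2) by (auto simp: PiE_iff extensional_def)
  then show "Cmp FF f (Idt FF a) = f" "Cmp FF (Idt FF b) f = f"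
    using f(1) by (auto simp: compose_def restrict_def intro!: ext)
next
  fix f g h :: finmap and a b c d
  assume "f \<in> hom FF a b" "g \<in> hom FF b c" "h \<in> hom FF c d"
  then obtain f' g' h' where "f = (b, f', a)" "g = (c, g', b)" "h = (d, h', c)"
    "h' \<in> {..<d} \<rightarrow>\<^sub>E {..<c}" by (auto simp: FF_hom)
  moreover from this have "i < d \<Longrightarrow> h' i < c" for i by (auto simp: PiE_iff)
  ultimately show "Cmp FF h (Cmp FF g f) = Cmp FF (Cmp FF h g) f"
    by (auto simp: compose_def restrict_def intro!: ext)
next
  fix f g :: finmap and a b c assume "f \<in> hom FF a b" "g \<in> hom FF b c"
  then obtain f' g' where "f = (b, f', a)" "g = (c, g', b)" "g' \<in> {..<c} \<rightarrow>\<^sub>E {..<b}"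
    "f' \<in> {..<b} \<rightarrow>\<^sub>E {..<a}" by (auto simp: FF_hom)
  then show "Cmp FF g f \<in> hom FF a c"
    by (auto simp: FF_hom compose_def PiE_iff)
qed (auto simp: FF_hom)

text \<open>The arrow \<open>n \<rightarrow> 1\<close> of \<open>FF\<close> given by the element \<open>i\<close> of \<open>n\<close>; its image in a Lawvere
  theory is the \<open>i\<close>-th projection of the power \<open>n = 1 + \<dots> + 1\<close>.\<close>

definition el :: "nat \<Rightarrow> nat \<Rightarrow> finmap" where
  "el n i = (1, \<lambda>_\<in>{..<1}. i, n)"

lemma el_hom: "i < n \<Longrightarrow> el n i \<in> hom FF n 1"
  by (auto simp: el_def FF_hom)

lemma el_cmp: "m < k \<Longrightarrow> Cmp FF (el k m) (k, f, n) = el n (f m)"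
  by (auto simp: el_def compose_def)

text \<open>A cone over a finite family is a product in \<open>FF\<close> exactly if the underlying functions exhibit a
  disjoint union.\<close>

definition coprod_cone :: "nat \<Rightarrow> (nat \<Rightarrow> nat) \<Rightarrow> nat \<Rightarrow> (nat \<Rightarrow> nat \<Rightarrow> nat) \<Rightarrow> bool" where
  "coprod_cone k x c q \<longleftrightarrow> bij_betw (\<lambda>(i, m). q i m) (SIGMA i:{..<k}. {..<x i}) {..<c}"

text \<open>Test the universal property against the object \<open>2\<close>: arrows \<open>2 \<rightarrow> c\<close> of \<open>FF\<close> are subsets of
  \<open>c\<close>.  Singletons in the summands give injectivity, and an element outside the images would give two
  different mediating arrows.\<close>

lemma FF_product_cone:
  assumes "is_product FF k x c p"
  obtains q where "\<And>i. i < k \<Longrightarrow> p i = (x i, q i, c)" "coprod_cone k x c q"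
proof -
  note pD = productD[OF assms]
  define q where "q i = fst (snd (p i))" for i
  have p: "p i = (x i, q i, c)" "q i \<in> {..<x i} \<rightarrow>\<^sub>E {..<c}" if i: "i < k" for i
  proof -
    obtain g where "p i = (x i, g, c)" "g \<in> {..<x i} \<rightarrow>\<^sub>E {..<c}"
      using pD(2)[OF i] unfolding FF_hom by blast
    then show "p i = (x i, q i, c)" "q i \<in> {..<x i} \<rightarrow>\<^sub>E {..<c}" by (simp_all add: q_def)
  qed
  have inj: "i = i' \<and> m = m'" if i: "i < k" "m < x i" "i' < k" "m' < x i'" "q i m = q i' m'" for i m i' m'
  proof -
    define f where "f a = (x a, \<lambda>b\<in>{..<x a}. if a = i \<and> b = m then 1 else 0::nat, 2::nat)" for a
    have "\<exists>!h. h \<in> hom FF 2 c \<and> (\<forall>i<k. Cmp FF (p i) h = f i)"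
      by (rule pD(3)) (auto simp: f_def FF_hom)
    then obtain h where h: "\<And>a. a < k \<Longrightarrow> Cmp FF (p a) (c, h, 2) = f a"
      by (auto simp: FF_hom)
    have "h (q a b) = (if a = i \<and> b = m then 1 else 0)" if "a < k" "b < x a" for a b
    proof -
      have "compose {..<x a} h (q a) = (\<lambda>b\<in>{..<x a}. if a = i \<and> b = m then 1 else 0::nat)"
        using h[OF that(1)] by (simp add: p[OF that(1)] f_def)
      from fun_cong[OF this, of b] show ?thesis using that by (simp add: compose_def)
    qed
    note hq = this
    have "h (q i m) = 1" using hq[of i m] i by simp
    then have "(if i' = i \<and> m' = m then 1 else 0) = (1::nat)" using hq[of i' m'] i by metis
    then show ?thesis by (simp split: if_splits)
  qed
  have surj: "\<exists>i<k. \<exists>m<x i. q i m = j" if j: "j < c" for j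
  proof (rule ccontr)
    assume n: "\<not> ?thesis"
    let ?h = "\<lambda>b::nat. (c, \<lambda>a\<in>{..<c}. if a = j then b else 0, 2::nat)"
    have "?h 0 = ?h 1"
    proof (rule product_joint[OF FF_category assms, of _ 2])
      fix i assume i: "i < k"
      then have "q i m \<noteq> j" if "m < x i" for m using n that by blast
      then show "Cmp FF (p i) (?h 0) = Cmp FF (p i) (?h 1)"
        by (simp add: p(1)[OF i] compose_def restrict_def fun_eq_iff)
    qed (auto simp: FF_hom)
    then have "(\<lambda>a\<in>{..<c}. if a = j then 0 else 0) j = (\<lambda>a\<in>{..<c}. if a = j then 1 else 0::nat) j"
      by (metis prod.inject)
    then show False using j by simp
  qed
  have qc: "q i m < c" if "i < k" "m < x i" for i m using p(2)[OF that(1)] that(2) by (auto simp: PiE_iff)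
  have "inj_on (\<lambda>(i, m). q i m) (SIGMA i:{..<k}. {..<x i})"
  proof (rule inj_onI)
    fix s t assume "s \<in> (SIGMA i:{..<k}. {..<x i})" "t \<in> (SIGMA i:{..<k}. {..<x i})"
      "(\<lambda>(i, m). q i m) s = (\<lambda>(i, m). q i m) t"
    then show "s = t" using inj[of "fst s" "snd s" "fst t" "snd t"] by (auto simp: prod_eq_iff)
  qed
  moreover have "(\<lambda>(i, m). q i m) ` (SIGMA i:{..<k}. {..<x i}) = {..<c}"
  proof (intro equalityI subsetI)
    fix j assume "j \<in> {..<c}"
    then obtain i m where "i < k" "m < x i" "q i m = j" using surj[of j] by blast
    then show "j \<in> (\<lambda>(i, m). q i m) ` (SIGMA i:{..<k}. {..<x i})"
      by (intro image_eqI[of _ _ "(i, m)"]) auto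
  qed (use qc in auto)
  ultimately have "coprod_cone k x c q" by (simp add: coprod_cone_def bij_betw_def)
  then show ?thesis using that p(1) by blast
qed

lemma FF_cone_product:
  assumes q: "coprod_cone k x c q" and p: "\<And>i. i < k \<Longrightarrow> p i = (x i, restrict (q i) {..<x i}, c)"
  shows "is_product FF k x c p"
proof -
  define r where "r = the_inv_into (SIGMA i:{..<k}. {..<x i}) (\<lambda>(i, m). q i m)"
  have inj: "inj_on (\<lambda>(i, m). q i m) (SIGMA i:{..<k}. {..<x i})"
    using q by (simp add: coprod_cone_def bij_betw_def)
  have im: "(\<lambda>(i, m). q i m) ` (SIGMA i:{..<k}. {..<x i}) = {..<c}"
    using q by (simp add: coprod_cone_def bij_betw_def)
  have r: "r (q i m) = (i, m)" if "i < k" "m < x i" for i m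
    using the_inv_into_f_f[OF inj, of "(i, m)"] that by (simp add: r_def)
  have qc: "q i m < c" if "i < k" "m < x i" for i m using im that by force
  have qs: "\<exists>i<k. \<exists>m<x i. j = q i m" if "j < c" for j
  proof -
    have "j \<in> (\<lambda>(i, m). q i m) ` (SIGMA i:{..<k}. {..<x i})" using im that by simp
    then show ?thesis by force
  qed
  show ?thesis unfolding is_product_def
  proof (intro conjI allI impI ballI)
    show "i < k \<Longrightarrow> p i \<in> hom FF c (x i)" for i using qc p by (auto simp: FF_hom)
    fix z :: nat and f :: "nat \<Rightarrow> finmap" assume f: "\<forall>i<k. f i \<in> hom FF z (x i)"
    define f' where "f' i = fst (snd (f i))" for i
    have f': "f i = (x i, f' i, z)" "f' i \<in> {..<x i} \<rightarrow>\<^sub>E {..<z}" if "i < k" for i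
    proof -
      have "f i \<in> hom FF z (x i)" using f that by blast
      then obtain g where "f i = (x i, g, z)" "g \<in> {..<x i} \<rightarrow>\<^sub>E {..<z}" by (auto simp: FF_hom)
      then show "f i = (x i, f' i, z)" "f' i \<in> {..<x i} \<rightarrow>\<^sub>E {..<z}" by (auto simp: f'_def)
    qed
    let ?h = "(c, \<lambda>j\<in>{..<c}. case r j of (i, m) \<Rightarrow> f' i m, z)"
    have f'z: "f' i m < z" if "i < k" "m < x i" for i m
      using f'(2)[OF that(1)] that(2) by (auto simp: PiE_iff)
    have hz: "(case r j of (i, m) \<Rightarrow> f' i m) < z" if "j < c" for j
      using qs[OF that] f'z r by auto
    show "\<exists>!h. h \<in> hom FF z c \<and> (\<forall>i<k. Cmp FF (p i) h = f i)"
    proof (rule ex1I[of _ ?h], intro conjI allI impI)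
      show "?h \<in> hom FF z c"
        using hz by (auto simp: FF_hom)
      fix i assume i: "i < k"
      show "Cmp FF (p i) ?h = f i"
        using f'[OF i] i by (simp add: p compose_def r qc fun_eq_iff PiE_iff extensional_def restrict_def)
    next
      fix h assume h: "h \<in> hom FF z c \<and> (\<forall>i<k. Cmp FF (p i) h = f i)"
      then obtain g where g: "h = (c, g, z)" "g \<in> {..<c} \<rightarrow>\<^sub>E {..<z}" by (auto simp: FF_hom)
      have "g (q i m) = f' i m" if "i < k" "m < x i" for i m
      proof -
        have "compose {..<x i} g (restrict (q i) {..<x i}) = f' i"
          using spec[OF conjunct2[OF h], of i] that(1) by (simp add: g p f'(1)[OF that(1)])
        from fun_cong[OF this, of m] show ?thesis using that by (simp add: compose_def)
      qed
      then have "g j = (case r j of (i, m) \<Rightarrow> f' i m)" if "j < c" for j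
        using qs[OF that] r by fastforce
      then show "h = ?h" using g by (simp add: PiE_iff extensional_def fun_eq_iff restrict_def)
    qed
  qed simp
qed

lemma FF_product_exists: obtains c p where "is_product FF k x c p"
proof -
  let ?S = "SIGMA i:{..<k}. {..<x i}"
  have "finite ?S" by simp
  then obtain b where b: "bij_betw b ?S {..<card ?S}"
    using ex_bij_betw_finite_nat[of ?S] by (auto simp: atLeast0LessThan)
  have "coprod_cone k x (card ?S) (\<lambda>i m. b (i, m))"
    using b by (simp add: coprod_cone_def case_prod_unfold)
  from FF_cone_product[OF this, of "\<lambda>i. (x i, restrict (\<lambda>m. b (i, m)) {..<x i}, card ?S)"]
  show ?thesis using that by blast
qed

lemma FF_el_product: "is_product FF k (\<lambda>_. 1) k (el k)"
  by (rule FF_cone_product[of k "\<lambda>_. 1" k "\<lambda>i _. i"])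
     (auto simp: coprod_cone_def el_def bij_betw_def inj_on_def image_iff)

lemma prj_hom: "prj1 n m \<in> hom FF (n + m) n" "prj2 n m \<in> hom FF (n + m) m"
  by (auto simp: prj1_def prj2_def FF_hom)

lemma el_prj: "i < n \<Longrightarrow> Cmp FF (el n i) (prj1 n m) = el (n + m) i"
   "i < m \<Longrightarrow> Cmp FF (el m i) (prj2 n m) = el (n + m) (n + i)"
  by (auto simp: prj1_def prj2_def el_cmp)

lemma FF_prj_product:
  "is_product FF 2 (\<lambda>i. if i = 0 then n else m) (n + m) (\<lambda>i. if i = 0 then prj1 n m else prj2 n m)"
proof (rule FF_cone_product)
  let ?q = "\<lambda>(i::nat) j. if i = 0 then j else n + j"
  have "j \<in> (\<lambda>(i, m). ?q i m) ` (SIGMA i:{..<2}. {..<if i = 0 then n else m})" if "j < n + m" for j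
  proof (cases "j < n")
    case True then show ?thesis by (intro image_eqI[of _ _ "(0, j)"]) auto
  next
    case False then show ?thesis using that by (intro image_eqI[of _ _ "(1, j - n)"]) auto
  qed
  then show "coprod_cone 2 (\<lambda>i. if i = 0 then n else m) (n + m) ?q"
    by (auto simp: coprod_cone_def bij_betw_def inj_on_def split: if_splits)
qed (auto simp: prj1_def prj2_def)

section \<open>Lawvere theories\<close>

lemma cmp_arr:
  assumes "is_category C" "f \<in> Arr C" "g \<in> Arr C" "Tgt C f = Src C g"
  shows "Cmp C g f \<in> Arr C" "Src C (Cmp C g f) = Src C f" "Tgt C (Cmp C g f) = Tgt C g"
  using cat_cmp[OF assms(1), of f "Src C f" "Src C g" g "Tgt C g"] assms by (auto simp: in_hom)

text \<open>The same notion as \<open>is_law\<close>, with the two components separated: it applies to the 1-cells and to the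
  2-cells of a Lawvere 2-theory alike.\<close>

locale lawv =
  fixes C :: "(nat, 'm) cat" and j :: "finmap \<Rightarrow> 'm"
  assumes law: "is_law \<lparr>lcat = C, lfin = j\<rparr>"
begin

lemma objs [simp]: "Obj C = UNIV"
  and fin_functor: "is_functor FF C (\<lambda>n. n) j"
  and fin_product: "is_product FF k x c p \<Longrightarrow> is_product C k x c (\<lambda>i. j (p i))"
  using law by (auto simp: is_law_def)

lemma cat: "is_category C"
  using functor_cats[OF fin_functor] by blast

lemmas cmp_hom = cat_cmp[OF cat] and idt_hom = cat_id[OF cat, simplified]
  and idl = cat_idl[OF cat] and idr = cat_idr[OF cat] and assoc = cat_assoc[OF cat]
  and fin_hom = functor_hom[OF fin_functor] and fin_cmp = functor_cmp[OF fin_functor]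

lemma fin_id: "j (Idt FF n) = Idt C n"
  using functor_id[OF fin_functor, of n] by simp

lemma el_joint:
  assumes "h \<in> hom C z k" "h' \<in> hom C z k" "\<And>i. i < k \<Longrightarrow> Cmp C (j (el k i)) h = Cmp C (j (el k i)) h'"
  shows "h = h'"
  using product_joint[OF cat fin_product[OF FF_el_product] assms] .

lemma pair_ex:
  assumes "f \<in> hom C z n" "g \<in> hom C z m"
  shows "\<exists>!h. h \<in> hom C z (n + m) \<and> Cmp C (j (prj1 n m)) h = f \<and> Cmp C (j (prj2 n m)) h = g"
proof -
  have "\<exists>!h. h \<in> hom C z (n + m) \<and>
    (\<forall>i<2::nat. Cmp C (j (if i = 0 then prj1 n m else prj2 n m)) h = (if i = 0 then f else g))"
    by (rule productD(3)[OF fin_product[OF FF_prj_product]]) (use assms in auto)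
  moreover have "(\<forall>i<2::nat. P i) \<longleftrightarrow> P 0 \<and> P 1" for P by (auto simp: less_2_cases_iff)
  ultimately show ?thesis by simp
qed

lemma pair_eqI:
  assumes "h \<in> hom C z (n + m)" "h' \<in> hom C z (n + m)"
    and "Cmp C (j (prj1 n m)) h = Cmp C (j (prj1 n m)) h'"
    and "Cmp C (j (prj2 n m)) h = Cmp C (j (prj2 n m)) h'"
  shows "h = h'"
  using pair_ex[OF cmp_hom[OF assms(1) fin_hom[OF prj_hom(1)]] cmp_hom[OF assms(1) fin_hom[OF prj_hom(2)]]]
    assms by metis

end

definition pairing :: "(nat, 'm) cat \<Rightarrow> (finmap \<Rightarrow> 'm) \<Rightarrow> 'm \<Rightarrow> 'm \<Rightarrow> 'm" where
  "pairing C j f g = (THE h. h \<in> hom C (Src C f) (Tgt C f + Tgt C g) \<and>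
     Cmp C (j (prj1 (Tgt C f) (Tgt C g))) h = f \<and> Cmp C (j (prj2 (Tgt C f) (Tgt C g))) h = g)"

context lawv begin

lemma pairing:
  assumes "f \<in> hom C z n" "g \<in> hom C z m"
  shows "pairing C j f g \<in> hom C z (n + m)"
    "Cmp C (j (prj1 n m)) (pairing C j f g) = f" "Cmp C (j (prj2 n m)) (pairing C j f g) = g"
  using theI'[OF pair_ex[OF assms]] assms by (auto simp: pairing_def in_hom)

lemma pairing_eqI:
  assumes "h \<in> hom C z (n + m)" "Cmp C (j (prj1 n m)) h = f" "Cmp C (j (prj2 n m)) h = g"
  shows "h = pairing C j f g"
proof -
  have "f \<in> hom C z n" "g \<in> hom C z m"
    using assms(2,3) cmp_hom[OF assms(1) fin_hom[OF prj_hom(1)]] cmp_hom[OF assms(1) fin_hom[OF prj_hom(2)]]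
    by auto
  from pairing[OF this] show ?thesis using pair_eqI[OF assms(1)] assms by metis
qed

lemma prod_arr_pairing:
  assumes "f \<in> hom C a b" "g \<in> hom C c d"
  shows "prod_arr C j f g = pairing C j (Cmp C f (j (prj1 a c))) (Cmp C g (j (prj2 a c)))"
proof -
  have "Cmp C f (j (prj1 a c)) \<in> hom C (a + c) b" "Cmp C g (j (prj2 a c)) \<in> hom C (a + c) d"
    using cmp_hom[OF fin_hom[OF prj_hom(1)] assms(1)] cmp_hom[OF fin_hom[OF prj_hom(2)] assms(2)] by auto
  then show ?thesis using assms by (simp add: pairing_def prod_arr_def in_hom)
qed

lemma prod_arr:
  assumes "f \<in> hom C a b" "g \<in> hom C c d"
  shows "prod_arr C j f g \<in> hom C (a + c) (b + d)"
    "Cmp C (j (prj1 b d)) (prod_arr C j f g) = Cmp C f (j (prj1 a c))"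
    "Cmp C (j (prj2 b d)) (prod_arr C j f g) = Cmp C g (j (prj2 a c))"
  unfolding prod_arr_pairing[OF assms]
  using pairing[OF cmp_hom[OF fin_hom[OF prj_hom(1)] assms(1)] cmp_hom[OF fin_hom[OF prj_hom(2)] assms(2)]]
  by auto

lemma prod_arr_eqI:
  assumes "f \<in> hom C a b" "g \<in> hom C c d" "h \<in> hom C (a + c) (b + d)"
    "Cmp C (j (prj1 b d)) h = Cmp C f (j (prj1 a c))" "Cmp C (j (prj2 b d)) h = Cmp C g (j (prj2 a c))"
  shows "prod_arr C j f g = h"
  unfolding prod_arr_pairing[OF assms(1,2)] using pairing_eqI[OF assms(3-5)] by simp

lemma prod_arr_tail:
  assumes "f \<in> hom C a b" "g \<in> hom C c d" "z \<in> hom C y (a + c)"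
  shows "Cmp C (j (prj1 b d)) (Cmp C (prod_arr C j f g) z) = Cmp C f (Cmp C (j (prj1 a c)) z)"
    "Cmp C (j (prj2 b d)) (Cmp C (prod_arr C j f g) z) = Cmp C g (Cmp C (j (prj2 a c)) z)"
  using assoc[OF assms(3) prod_arr(1)[OF assms(1,2)] fin_hom[OF prj_hom(1)]]
    assoc[OF assms(3) prod_arr(1)[OF assms(1,2)] fin_hom[OF prj_hom(2)]]
    assoc[OF assms(3) fin_hom[OF prj_hom(1)] assms(1)] assoc[OF assms(3) fin_hom[OF prj_hom(2)] assms(2)]
    prod_arr(2,3)[OF assms(1,2)] by auto

end

lemma prod_arr_cong: "(\<And>f. f \<in> Arr FF \<Longrightarrow> j' f = j f) \<Longrightarrow> prod_arr C j' u v = prod_arr C j u v"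
  using prj_hom unfolding prod_arr_def in_hom by simp

text \<open>The objects \<open>(a + b) + c\<close> and \<open>a + (b + c)\<close> are equal, and so are their projections; hence the tensor
  product of arrows is strictly associative.\<close>

lemma prj_assoc:
  "Cmp FF (prj1 a b) (prj1 (a + b) c) = prj1 a (b + c)"
  "Cmp FF (prj2 a b) (prj1 (a + b) c) = Cmp FF (prj1 b c) (prj2 a (b + c))"
  "prj2 (a + b) c = Cmp FF (prj2 b c) (prj2 a (b + c))"
  by (auto simp: prj1_def prj2_def compose_def restrict_def fun_eq_iff add.assoc)

lemma is_proI:
  assumes "is_category C" "Obj C = UNIV"
    and "\<And>f g a b c d. f \<in> hom C a b \<Longrightarrow> g \<in> hom C c d \<Longrightarrow> t f g \<in> hom C (a + c) (b + d)"
    and "\<And>n m. t (Idt C n) (Idt C m) = Idt C (n + m)"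
    and "\<And>f g f' g' a b c a' b' c'. f \<in> hom C a b \<Longrightarrow> g \<in> hom C b c \<Longrightarrow> f' \<in> hom C a' b' \<Longrightarrow>
      g' \<in> hom C b' c' \<Longrightarrow> t (Cmp C g f) (Cmp C g' f') = Cmp C (t g g') (t f f')"
    and "\<And>f g h a a' b b' c c'. f \<in> hom C a a' \<Longrightarrow> g \<in> hom C b b' \<Longrightarrow> h \<in> hom C c c' \<Longrightarrow>
      t (t f g) h = t f (t g h)"
    and "\<And>f a b. f \<in> hom C a b \<Longrightarrow> t (Idt C 0) f = f \<and> t f (Idt C 0) = f"
  shows "is_pro \<lparr>pcat = C, ptens = t\<rparr>"
  unfolding is_pro_def Let_def
  using assms(1,2,4) assms(3,5,6,7)[unfolded in_hom] by (simp add: in_hom)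

text \<open>Every axiom is an equation between arrows into a product, hence can be checked after composition with the
  projections.\<close>

lemma (in lawv) prod_pro: "is_pro \<lparr>pcat = C, ptens = prod_arr C j\<rparr>"
proof (rule is_proI)
  note P1 = fin_hom[OF prj_hom(1)] and P2 = fin_hom[OF prj_hom(2)]
  show "is_category C" "Obj C = UNIV" by (simp_all add: cat)
  show "prod_arr C j f g \<in> hom C (a + c) (b + d)" if "f \<in> hom C a b" "g \<in> hom C c d" for f g a b c d
    by (rule prod_arr(1)[OF that])
  show "prod_arr C j (Idt C n) (Idt C m) = Idt C (n + m)" for n m
    by (rule prod_arr_eqI[OF idt_hom idt_hom idt_hom])
      (simp_all add: idl[OF P1] idr[OF P1] idl[OF P2] idr[OF P2])
  show "prod_arr C j (Cmp C g f) (Cmp C g' f') = Cmp C (prod_arr C j g g') (prod_arr C j f f')"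
    if "f \<in> hom C a b" "g \<in> hom C b c" "f' \<in> hom C a' b'" "g' \<in> hom C b' c'" for f g f' g' a b c a' b' c'
  proof (rule prod_arr_eqI)
    show "Cmp C g f \<in> hom C a c" "Cmp C g' f' \<in> hom C a' c'"
      "Cmp C (prod_arr C j g g') (prod_arr C j f f') \<in> hom C (a + a') (c + c')"
      using that by (auto intro: cmp_hom prod_arr)
  qed (use assoc[OF P1 that(1,2)] assoc[OF P2 that(3,4)] prod_arr[OF that(1,3)]
      prod_arr_tail[OF that(2,4) prod_arr(1)[OF that(1,3)]] in simp_all)
  show "prod_arr C j (Idt C 0) f = f \<and> prod_arr C j f (Idt C 0) = f" if f: "f \<in> hom C a b" for f a b
  proof (intro conjI prod_arr_eqI)
    have 0: "h = h'" if "h \<in> hom C n 0" "h' \<in> hom C n 0" for h h' n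
      using el_joint[OF that] by simp
    have i: "prj2 0 n = Idt FF n" "prj1 n 0 = Idt FF n" for n by (auto simp: prj1_def prj2_def)
    show "Cmp C (j (prj1 0 b)) f = Cmp C (Idt C 0) (j (prj1 0 a))"
      "Cmp C (j (prj2 b 0)) f = Cmp C (Idt C 0) (j (prj2 a 0))"
      using cmp_hom[OF _ P1, of f a 0 b] cmp_hom[OF _ P2, of f a b 0] cmp_hom[OF P1 idt_hom, of 0 a]
        cmp_hom[OF P2[of a 0] idt_hom] f by (auto intro: 0)
    show "Cmp C (j (prj2 0 b)) f = Cmp C f (j (prj2 0 a))" "Cmp C (j (prj1 b 0)) f = Cmp C f (j (prj1 a 0))"
      using f by (simp_all only: i fin_id idl idr)
  qed (use f idt_hom in auto)
  fix f g h a a' b b' c c' assume f: "f \<in> hom C a a'" and g: "g \<in> hom C b b'" and h: "h \<in> hom C c c'"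
  let ?t = "prod_arr C j"
  note fg = prod_arr(1)[OF f g] and gh = prod_arr(1)[OF g h]
  note Y = prod_arr[OF f gh]
  show "?t (?t f g) h = ?t f (?t g h)"
  proof (rule prod_arr_eqI[OF fg h])
    show Y1: "?t f (?t g h) \<in> hom C (a + b + c) (a' + b' + c')" using Y(1) by (simp add: add.assoc)
    have prjs: "Cmp C (j (prj1 a b)) (j (prj1 (a + b) c)) = j (prj1 a (b + c))"
      "Cmp C (j (prj2 a b)) (j (prj1 (a + b) c)) = Cmp C (j (prj1 b c)) (j (prj2 a (b + c)))"
      "j (prj2 (a + b) c) = Cmp C (j (prj2 b c)) (j (prj2 a (b + c)))" for a b c
      using fin_cmp[OF prj_hom(1)[of "a + b" c] prj_hom(1)] fin_cmp[OF prj_hom(1)[of "a + b" c] prj_hom(2)]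
        fin_cmp[OF prj_hom(2)[of a "b + c"] prj_hom(1)] fin_cmp[OF prj_hom(2)[of a "b + c"] prj_hom(2)]
      by (simp_all add: prj_assoc)
    have P1': "j (prj1 a (b + c)) \<in> hom C (a + b + c) a" "j (prj2 a (b + c)) \<in> hom C (a + b + c) (b + c)" for a b c
      using P1[of a "b + c"] P2[of a "b + c"] by (simp_all add: add.assoc)
    show "Cmp C (j (prj1 (a' + b') c')) (?t f (?t g h)) = Cmp C (?t f g) (j (prj1 (a + b) c))"
    proof (rule pair_eqI)
      show "Cmp C (j (prj1 (a' + b') c')) (?t f (?t g h)) \<in> hom C (a + b + c) (a' + b')"
        "Cmp C (?t f g) (j (prj1 (a + b) c)) \<in> hom C (a + b + c) (a' + b')"
        using cmp_hom[OF Y1 P1] cmp_hom[OF P1 fg] .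
      show "Cmp C (j (prj1 a' b')) (Cmp C (j (prj1 (a' + b') c')) (?t f (?t g h))) =
        Cmp C (j (prj1 a' b')) (Cmp C (?t f g) (j (prj1 (a + b) c)))"
        using assoc[OF Y1 P1 P1] prod_arr_tail(1)[OF f g P1] Y(2) by (simp add: prjs)
      show "Cmp C (j (prj2 a' b')) (Cmp C (j (prj1 (a' + b') c')) (?t f (?t g h))) =
        Cmp C (j (prj2 a' b')) (Cmp C (?t f g) (j (prj1 (a + b) c)))"
        using assoc[OF Y1 P1 P2] prod_arr_tail(2)[OF f g P1] Y(3) assoc[OF Y1 P1'(2) P1]
          prod_arr_tail(1)[OF g h P1'(2)] by (simp add: prjs)
    qed
    show "Cmp C (j (prj2 (a' + b') c')) (?t f (?t g h)) = Cmp C h (j (prj2 (a + b) c))"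
      using assoc[OF Y1 P1'(2) P2] Y(3) prod_arr_tail(2)[OF g h P1'(2)] by (simp add: prjs)
  qed
qed

text \<open>It suffices to have all tuples of arrows into \<open>1\<close>: every product of \<open>FF\<close> is a re-indexed
  family of copies of \<open>1\<close>.\<close>

lemma lawvI:
  assumes F: "is_functor FF C (\<lambda>n. n) j" and O: "Obj C = UNIV"
    and ex: "\<And>n k f. (\<And>i. i < k \<Longrightarrow> f i \<in> hom C n 1) \<Longrightarrow>
      \<exists>h \<in> hom C n k. \<forall>i<k. Cmp C (j (el k i)) h = f i"
    and joint: "\<And>n k h h'. h \<in> hom C n k \<Longrightarrow> h' \<in> hom C n k \<Longrightarrow>
      (\<And>i. i < k \<Longrightarrow> Cmp C (j (el k i)) h = Cmp C (j (el k i)) h') \<Longrightarrow> h = h'"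
  shows "lawv C j"
proof -
  have C: "is_category C" using functor_cats[OF F] by simp
  note jh = functor_hom[OF F]
  have "is_product C k x c (\<lambda>i. j (p i))" if p: "is_product FF k x c p" for k x c p
    unfolding is_product_def
  proof (intro conjI allI impI ballI)
    show "c \<in> Obj C" by (simp add: O)
    show ph: "i < k \<Longrightarrow> j (p i) \<in> hom C c (x i)" for i using jh[OF productD(2)[OF p]] .
    obtain q where q: "\<And>i. i < k \<Longrightarrow> p i = (x i, q i, c)" "coprod_cone k x c q"
      using FF_product_cone[OF p] by blast
    have bij: "bij_betw (\<lambda>(i, m). q i m) (SIGMA i:{..<k}. {..<x i}) {..<c}"
      using q(2) by (simp add: coprod_cone_def)
    define r where "r = the_inv_into (SIGMA i:{..<k}. {..<x i}) (\<lambda>(i, m). q i m)"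
    have r: "r (q i m) = (i, m)" if "i < k" "m < x i" for i m
      using the_inv_into_f_f[OF bij_betw_imp_inj_on[OF bij], of "(i, m)"] that by (simp add: r_def)
    have qs: "\<exists>i<k. \<exists>m<x i. l = q i m" if "l < c" for l
    proof -
      have "l \<in> (\<lambda>(i, m). q i m) ` (SIGMA i:{..<k}. {..<x i})"
        using that bij_betw_imp_surj_on[OF bij] by simp
      then show ?thesis by force
    qed
    have qc: "q i m < c" if "i < k" "m < x i" for i m
    proof -
      have "q i m \<in> (\<lambda>(i, m). q i m) ` (SIGMA i:{..<k}. {..<x i})"
        using that by (intro image_eqI[of _ _ "(i, m)"]) auto
      then show ?thesis using bij_betw_imp_surj_on[OF bij] by simp
    qed
    have elq: "Cmp C (j (el c (q i m))) h = Cmp C (j (el (x i) m)) (Cmp C (j (p i)) h)"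
      if i: "i < k" "m < x i" and h: "h \<in> hom C z c" for i m h z
    proof -
      have "j (el c (q i m)) = Cmp C (j (el (x i) m)) (j (p i))"
        using functor_cmp[OF F productD(2)[OF p i(1)] el_hom[OF i(2)]] el_cmp[OF i(2)] q(1)[OF i(1)] by simp
      then show ?thesis using cat_assoc[OF C h ph[OF i(1)] jh[OF el_hom[OF i(2)]]] by simp
    qed
    fix z f assume z: "z \<in> Obj C" and f: "\<forall>i<k. f i \<in> hom C z (x i)"
    define s where "s l = (case r l of (i, m) \<Rightarrow> Cmp C (j (el (x i) m)) (f i))" for l
    have "s l \<in> hom C z 1" if "l < c" for l
      using qs[OF that] f r cat_cmp[OF C _ jh[OF el_hom]] by (fastforce simp: s_def)
    then obtain h where h: "h \<in> hom C z c" "\<And>l. l < c \<Longrightarrow> Cmp C (j (el c l)) h = s l"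
      using ex by blast
    show "\<exists>!h. h \<in> hom C z c \<and> (\<forall>i<k. Cmp C (j (p i)) h = f i)"
    proof (rule ex1I[of _ h], intro conjI allI impI)
      show "h \<in> hom C z c" by (rule h)
      fix i assume i: "i < k"
      show "Cmp C (j (p i)) h = f i"
      proof (rule joint)
        show "Cmp C (j (p i)) h \<in> hom C z (x i)" by (rule cat_cmp[OF C h(1) ph[OF i]])
        show "f i \<in> hom C z (x i)" using f i by simp
        fix m assume m: "m < x i"
        show "Cmp C (j (el (x i) m)) (Cmp C (j (p i)) h) = Cmp C (j (el (x i) m)) (f i)"
          using elq[OF i m h(1)] h(2)[OF qc[OF i m]] by (simp add: s_def r[OF i m])
      qed
    next
      fix h' assume h': "h' \<in> hom C z c \<and> (\<forall>i<k. Cmp C (j (p i)) h' = f i)"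
      show "h' = h"
      proof (rule joint)
        fix l assume "l < c"
        then obtain i m where im: "i < k" "m < x i" "l = q i m" using qs by blast
        show "Cmp C (j (el c l)) h' = Cmp C (j (el c l)) h"
          using elq[OF im(1,2) conjunct1[OF h']] conjunct2[OF h'] im h(2)[OF qc[OF im(1,2)]]
          by (simp add: s_def r)
      qed (use h h' in auto)
    qed
  qed
  then show ?thesis using F O by (simp add: lawv_def is_law_def)
qed

lemma law_lawv: "is_law L \<longleftrightarrow> lawv (lcat L) (lfin L)"
  by (cases L) (simp add: lawv_def)

text \<open>For functors under \<open>FF\<close>, preservation of all finite products is automatic, because every product is
  isomorphic to the image of one in \<open>FF\<close> (lemma \<open>map_product\<close>).\<close>

locale lawv_map = A: lawv C j + B: lawv C' j'
  for C :: "(nat, 'm) cat" and j and C' :: "(nat, 'n) cat" and j' +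
  fixes F :: "'m \<Rightarrow> 'n"
  assumes funct: "is_functor C C' (\<lambda>n. n) F"
    and fin: "a \<in> Arr FF \<Longrightarrow> F (j a) = j' a"
begin

lemmas hom = functor_hom[OF funct] and cmp = functor_cmp[OF funct]

lemma fin_prj: "F (j (prj1 n m)) = j' (prj1 n m)" "F (j (prj2 n m)) = j' (prj2 n m)"
  using fin prj_hom by (auto simp: in_hom)

lemma map_pairing:
  assumes "f \<in> hom C z n" "g \<in> hom C z m"
  shows "F (pairing C j f g) = pairing C' j' (F f) (F g)"
proof (rule B.pairing_eqI)
  note P = A.pairing[OF assms]
  show "F (pairing C j f g) \<in> hom C' z (n + m)" using hom[OF P(1)] .
  show "Cmp C' (j' (prj1 n m)) (F (pairing C j f g)) = F f"
    using cmp[OF P(1) A.fin_hom[OF prj_hom(1)]] by (simp add: P fin_prj)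
  show "Cmp C' (j' (prj2 n m)) (F (pairing C j f g)) = F g"
    using cmp[OF P(1) A.fin_hom[OF prj_hom(2)]] by (simp add: P fin_prj)
qed

lemma map_prod_arr:
  assumes "f \<in> hom C a b" "g \<in> hom C c d"
  shows "F (prod_arr C j f g) = prod_arr C' j' (F f) (F g)"
  using map_pairing[OF A.cmp_hom[OF A.fin_hom[OF prj_hom(1)] assms(1)] A.cmp_hom[OF A.fin_hom[OF prj_hom(2)] assms(2)]]
    cmp[OF A.fin_hom[OF prj_hom(1)] assms(1)] cmp[OF A.fin_hom[OF prj_hom(2)] assms(2)]
  by (simp add: A.prod_arr_pairing[OF assms] B.prod_arr_pairing[OF hom[OF assms(1)] hom[OF assms(2)]] fin_prj)

lemma map_product:
  assumes p: "is_product C k x c p"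
  shows "is_product C' k x c (\<lambda>i. F (p i))"
proof -
  obtain d q where q: "is_product FF k x d q" using FF_product_exists .
  have "is_product C' k x d (\<lambda>i. F (j (q i)))"
    using B.fin_product[OF q] productD(2)[OF q] unfolding is_product_def by (auto simp: fin in_hom)
  from product_transfer[OF funct A.fin_product[OF q] this p] show ?thesis .
qed

end

lemma law_maps_iff:
  assumes "is_law L" "is_law L'"
  shows "h \<in> law_maps L L' \<longleftrightarrow> h \<in> extensional (Arr (lcat L)) \<and>
    lawv_map (lcat L) (lfin L) (lcat L') (lfin L') h"
proof
  assume h: "h \<in> law_maps L L'"
  then show "h \<in> extensional (Arr (lcat L)) \<and> lawv_map (lcat L) (lfin L) (lcat L') (lfin L') h"
    using assms by (auto simp: law_maps_def lawv_map_def lawv_map_axioms_def law_lawv)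
next
  assume h: "h \<in> extensional (Arr (lcat L)) \<and> lawv_map (lcat L) (lfin L) (lcat L') (lfin L') h"
  then interpret lawv_map "lcat L" "lfin L" "lcat L'" "lfin L'" h by simp
  show "h \<in> law_maps L L'" using h by (simp add: law_maps_def funct fin map_product)
qed

lemma lawv_cong:
  assumes "lawv C j" "\<And>x. x \<in> Arr FF \<Longrightarrow> j' x = j x"
  shows "lawv C j'"
proof -
  interpret lawv C j by (rule assms(1))
  have "is_product C k x c (\<lambda>i. j' (p i))" if p: "is_product FF k x c p" for k x c p
    using fin_product[OF p] productD(2)[OF p] assms(2) unfolding is_product_def by (auto simp: in_hom)
  moreover have "is_functor FF C (\<lambda>n. n) j'" by (rule functor_cong[OF fin_functor]) (simp_all add: assms(2))
  ultimately show ?thesis by (simp add: lawv_def is_law_def)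
qed

lemma lawv_map_cong:
  assumes "lawv_map C j C' k F" "\<And>x. x \<in> Arr FF \<Longrightarrow> j' x = j x"
  shows "lawv_map C j' C' k F"
  using assms lawv_cong[of C j j'] by (simp add: lawv_map_def lawv_map_axioms_def)

section \<open>Two-dimensional structures\<close>

locale cat2 =
  fixes C :: "('o, 'm) cat2"
  assumes c2: "is_cat2 C"
begin

lemma one_cat: "is_category (one C)" and two_cat: "is_category (two C)" and vert_cat: "is_category (vert C)"
  and objs [simp]: "Obj (one C) = UNIV" "Obj (two C) = UNIV"
  and vert_obj [simp]: "Obj (vert C) = Arr (one C)" and vert_arr [simp]: "Arr (vert C) = Arr (two C)"
  and src_functor: "is_functor (two C) (one C) (\<lambda>n. n) (Src (vert C))"
  and tgt_functor: "is_functor (two C) (one C) (\<lambda>n. n) (Tgt (vert C))"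
  and idt_functor: "is_functor (one C) (two C) (\<lambda>n. n) (Idt (vert C))"
  using c2 by (simp_all add: is_cat2_def)

lemma two_vhom:
  assumes "\<alpha> \<in> hom (two C) n k"
  shows "\<alpha> \<in> hom (vert C) (Src (vert C) \<alpha>) (Tgt (vert C) \<alpha>)"
    "Src (vert C) \<alpha> \<in> hom (one C) n k" "Tgt (vert C) \<alpha> \<in> hom (one C) n k"
  using functor_hom[OF src_functor assms] functor_hom[OF tgt_functor assms] assms by (auto simp: in_hom)

lemma vhom_two:
  assumes "\<alpha> \<in> hom (vert C) f g" "f \<in> hom (one C) n k"
  shows "\<alpha> \<in> hom (two C) n k" "g \<in> hom (one C) n k"
proof -
  have "\<alpha> \<in> Arr (two C)" using assms(1) by (simp add: in_hom)
  from two_vhom[OF arr_hom[OF this]] assms this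
  show "\<alpha> \<in> hom (two C) n k" "g \<in> hom (one C) n k" by (auto simp: in_hom)
qed

lemma vhom_one: "\<alpha> \<in> hom (vert C) f g \<Longrightarrow> f \<in> Arr (one C) \<and> g \<in> Arr (one C)"
  using cat_obj[OF vert_cat] by simp

lemma idt_vhom: "f \<in> Arr (one C) \<Longrightarrow> Idt (vert C) f \<in> hom (vert C) f f"
  using cat_id[OF vert_cat] by simp

lemma idt_hom: "f \<in> hom (one C) n k \<Longrightarrow> Idt (vert C) f \<in> hom (two C) n k"
  using functor_hom[OF idt_functor] by simp

lemma interchange:
  assumes "\<alpha> \<in> hom (vert C) f g" "\<beta> \<in> hom (vert C) g h" "\<gamma> \<in> hom (vert C) f' g'" "\<delta> \<in> hom (vert C) g' h'"
    "f \<in> hom (one C) n k" "f' \<in> hom (one C) k l"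
  shows "Cmp (two C) (Cmp (vert C) \<delta> \<gamma>) (Cmp (vert C) \<beta> \<alpha>) =
    Cmp (vert C) (Cmp (two C) \<delta> \<beta>) (Cmp (two C) \<gamma> \<alpha>)"
proof -
  have "Tgt (two C) \<alpha> = Src (two C) \<gamma>"
    using vhom_two(1)[OF assms(1,5)] vhom_two(1)[OF assms(3,6)] by (simp add: in_hom)
  then show ?thesis using c2 assms(1-4) unfolding is_cat2_def in_hom by simp
qed

end

lemma is_cat2I:
  assumes "is_category (one C)" "is_category (two C)" "is_category (vert C)"
    "Obj (one C) = UNIV" "Obj (two C) = UNIV" "Obj (vert C) = Arr (one C)" "Arr (vert C) = Arr (two C)"
    "is_functor (two C) (one C) (\<lambda>n. n) (Src (vert C))" "is_functor (two C) (one C) (\<lambda>n. n) (Tgt (vert C))"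
    "is_functor (one C) (two C) (\<lambda>n. n) (Idt (vert C))"
    and "\<And>\<alpha> \<beta> \<gamma> \<delta> f g h f' g' h' n k l. \<alpha> \<in> hom (vert C) f g \<Longrightarrow> \<beta> \<in> hom (vert C) g h \<Longrightarrow>
      \<gamma> \<in> hom (vert C) f' g' \<Longrightarrow> \<delta> \<in> hom (vert C) g' h' \<Longrightarrow> \<alpha> \<in> hom (two C) n k \<Longrightarrow> \<beta> \<in> hom (two C) n k \<Longrightarrow>
      \<gamma> \<in> hom (two C) k l \<Longrightarrow> \<delta> \<in> hom (two C) k l \<Longrightarrow>
      Cmp (two C) (Cmp (vert C) \<delta> \<gamma>) (Cmp (vert C) \<beta> \<alpha>) =
      Cmp (vert C) (Cmp (two C) \<delta> \<beta>) (Cmp (two C) \<gamma> \<alpha>)"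
  shows "is_cat2 C"
proof -
  have par: "Src (two C) \<beta> = Src (two C) \<alpha> \<and> Tgt (two C) \<beta> = Tgt (two C) \<alpha>"
    if "\<alpha> \<in> Arr (two C)" "\<beta> \<in> Arr (two C)" "Tgt (vert C) \<alpha> = Src (vert C) \<beta>" for \<alpha> \<beta>
    using functor_hom[OF assms(9) arr_hom[OF that(1)]] functor_hom[OF assms(8) arr_hom[OF that(2)]] that(3)
    by (simp add: in_hom)
  show ?thesis unfolding is_cat2_def
    using assms(1-10) assms(11)[unfolded in_hom, simplified assms(7)] par by auto
qed

locale law2 =
  fixes L :: "('o, 'm) law2"
  assumes l2: "is_law2 L"

text \<open>A Lawvere 2-theory is a 2-category for which both the 1-cells and the 2-cells under horizontal composition
  form Lawvere theories.  All facts about products of 2-cells are thus instances of those for 1-cells.\<close>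

lemma law2_iff: "is_law2 L \<longleftrightarrow> is_cat2 (l2cat L) \<and> lawv (one (l2cat L)) (l2fin L) \<and>
    lawv (two (l2cat L)) (\<lambda>a. Idt (vert (l2cat L)) (l2fin L a))"
  (is "?l \<longleftrightarrow> ?c \<and> ?r1 \<and> ?r2")
proof
  assume l: ?l
  then interpret cat2 "l2cat L" by unfold_locales (simp add: is_law2_def)
  have "is_functor FF (two (l2cat L)) (\<lambda>n. n) (\<lambda>a. Idt (vert (l2cat L)) (l2fin L a))"
    using functor_compose[OF _ idt_functor, of FF "\<lambda>n. n" "l2fin L"] l by (simp add: is_law2_def)
  then show "?c \<and> ?r1 \<and> ?r2"
    using l by (simp add: lawv_def is_law_def is_law2_def is_2product_def)
next
  assume "?c \<and> ?r1 \<and> ?r2"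
  then show ?l by (auto simp: lawv_def is_law_def is_law2_def is_2product_def)
qed

sublocale law2 \<subseteq> cat2 "l2cat L"
  by unfold_locales (use l2 in \<open>simp add: is_law2_def\<close>)

sublocale law2 \<subseteq> L1: lawv "one (l2cat L)" "l2fin L"
  using l2 by (simp add: law2_iff)

sublocale law2 \<subseteq> L2: lawv "two (l2cat L)" "\<lambda>a. Idt (vert (l2cat L)) (l2fin L a)"
  using l2 by (simp add: law2_iff)

context law2 begin

abbreviation "C1 \<equiv> one (l2cat L)"
abbreviation "C2 \<equiv> two (l2cat L)"
abbreviation "CV \<equiv> vert (l2cat L)"
abbreviation "j1 \<equiv> l2fin L"
abbreviation "j2 \<equiv> \<lambda>a. Idt (vert (l2cat L)) (l2fin L a)"

lemma fin_arr: "a \<in> Arr FF \<Longrightarrow> l2fin L a \<in> Arr C1"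
  using L1.fin_hom[OF arr_hom] by (auto simp: in_hom)

text \<open>Source, target and identity assignment are functors under \<open>FF\<close> between the two Lawvere theories, so
  they commute with tensor products.\<close>

lemma src_map: "lawv_map C2 j2 C1 j1 (Src CV)"
  by unfold_locales (use src_functor fin_arr idt_vhom in \<open>auto simp: in_hom\<close>)

lemma tgt_map: "lawv_map C2 j2 C1 j1 (Tgt CV)"
  by unfold_locales (use tgt_functor fin_arr idt_vhom in \<open>auto simp: in_hom\<close>)

lemma idt_map: "lawv_map C1 j1 C2 j2 (Idt CV)"
  by unfold_locales (use idt_functor in auto)

text \<open>The projections determine a 2-cell into a product, and they are unaffected by vertical
  composition with identities; so the interchange law makes the tensor product of 2-cells functorial.\<close>

lemma prod_arr_vcmp:
  assumes "\<alpha> \<in> hom CV f g" "\<beta> \<in> hom CV g h" "\<alpha>' \<in> hom CV f' g'" "\<beta>' \<in> hom CV g' h'"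
  shows "prod_arr C2 j2 (Cmp CV \<beta> \<alpha>) (Cmp CV \<beta>' \<alpha>') = Cmp CV (prod_arr C2 j2 \<beta> \<beta>') (prod_arr C2 j2 \<alpha> \<alpha>')"
proof -
  interpret S: lawv_map C2 j2 C1 j1 "Src CV" by (rule src_map)
  interpret T: lawv_map C2 j2 C1 j1 "Tgt CV" by (rule tgt_map)
  obtain a b where f: "f \<in> hom C1 a b" using arr_hom[OF conjunct1[OF vhom_one[OF assms(1)]]] by (rule that)
  obtain c d where f': "f' \<in> hom C1 c d" using arr_hom[OF conjunct1[OF vhom_one[OF assms(3)]]] by (rule that)
  note al = vhom_two[OF assms(1) f] and al' = vhom_two[OF assms(3) f']
  note be = vhom_two[OF assms(2) al(2)] and be' = vhom_two[OF assms(4) al'(2)]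
  note ba = vhom_two(1)[OF cat_cmp[OF vert_cat assms(1,2)] f]
  note ba' = vhom_two(1)[OF cat_cmp[OF vert_cat assms(3,4)] f']
  let ?t = "prod_arr C2 j2" and ?u = "prod_arr C1 j1"
  note ta = L2.prod_arr[OF al(1) al'(1)] and tb = L2.prod_arr[OF be(1) be'(1)]
  have tav: "?t \<alpha> \<alpha>' \<in> hom CV (?u f f') (?u g g')"
    using S.map_prod_arr[OF al(1) al'(1)] T.map_prod_arr[OF al(1) al'(1)] two_vhom(1)[OF ta(1)] assms
    by (simp add: in_hom)
  have tbv: "?t \<beta> \<beta>' \<in> hom CV (?u g g') (?u h h')"
    using S.map_prod_arr[OF be(1) be'(1)] T.map_prod_arr[OF be(1) be'(1)] two_vhom(1)[OF tb(1)] assms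
    by (simp add: in_hom)
  note uf = L1.prod_arr(1)[OF f f']
  have idid: "Cmp CV (Idt CV x) (Idt CV x) = Idt CV x" if "x \<in> Arr C1" for x
    using cat_idl[OF vert_cat idt_vhom[OF that]] .
  show ?thesis
  proof (rule L2.prod_arr_eqI[OF ba ba'])
    show "Cmp CV (?t \<beta> \<beta>') (?t \<alpha> \<alpha>') \<in> hom C2 (a + c) (b + d)"
      by (rule vhom_two(1)[OF cat_cmp[OF vert_cat tav tbv] uf])
    note p = L1.fin_hom[OF prj_hom(1)] L1.fin_hom[OF prj_hom(2)]
    have pa: "j1 (prj1 n m) \<in> Arr C1" "j1 (prj2 n m) \<in> Arr C1" for n m using p[of n m] by (auto simp: in_hom)
    note pv = idt_vhom[OF pa(1)] idt_vhom[OF pa(2)]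
    show "Cmp C2 (j2 (prj1 b d)) (Cmp CV (?t \<beta> \<beta>') (?t \<alpha> \<alpha>')) = Cmp C2 (Cmp CV \<beta> \<alpha>) (j2 (prj1 a c))"
      using interchange[OF tav tbv pv(1) pv(1) uf p(1)] interchange[OF pv(1) pv(1) assms(1,2) p(1) f]
        ta(2) tb(2) by (simp add: idid pa)
    show "Cmp C2 (j2 (prj2 b d)) (Cmp CV (?t \<beta> \<beta>') (?t \<alpha> \<alpha>')) = Cmp C2 (Cmp CV \<beta>' \<alpha>') (j2 (prj2 a c))"
      using interchange[OF tav tbv pv(2) pv(2) uf p(2)] interchange[OF pv(2) pv(2) assms(3,4) p(2) f']
        ta(3) tb(3) by (simp add: idid pa)
  qed
qed

lemma catpro: "is_catpro (law2_catpro L)"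
proof -
  interpret S: lawv_map C2 j2 C1 j1 "Src CV" by (rule src_map)
  interpret T: lawv_map C2 j2 C1 j1 "Tgt CV" by (rule tgt_map)
  interpret I: lawv_map C1 j1 C2 j2 "Idt CV" by (rule idt_map)
  show ?thesis
    unfolding is_catpro_def law2_catpro_def Let_def
    using L1.prod_pro L2.prod_pro c2 S.map_prod_arr[OF arr_hom arr_hom] T.map_prod_arr[OF arr_hom arr_hom]
      I.map_prod_arr[OF arr_hom arr_hom] prod_arr_vcmp[unfolded in_hom] by simp
qed

end

lemma twofunctor_iff: "is_2functor C D F \<longleftrightarrow> is_functor (one C) (one D) (\<lambda>n. n) (fst F) \<and>
     is_functor (two C) (two D) (\<lambda>n. n) (snd F) \<and> is_functor (vert C) (vert D) (fst F) (snd F)"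
  by (cases F) (simp add: is_2functor_def)

lemma twofunctor_compose:
  assumes "is_2functor C D F" "is_2functor D E G"
  shows "is_2functor C E (fst G \<circ> fst F, snd G \<circ> snd F)"
  using assms unfolding twofunctor_iff comp_def by (auto intro: functor_compose)

lemma twofunctor_cong:
  assumes "is_2functor C D F" "is_cat2 C"
    "\<And>f. f \<in> Arr (one C) \<Longrightarrow> fst G f = fst F f" "\<And>f. f \<in> Arr (two C) \<Longrightarrow> snd G f = snd F f"
  shows "is_2functor C D G"
proof -
  have "Obj (vert C) = Arr (one C)" "Arr (vert C) = Arr (two C)" using assms(2) by (simp_all add: is_cat2_def)
  then show ?thesis
    using functor_cong[of "one C" "one D" "\<lambda>n. n" "fst F" "\<lambda>n. n" "fst G"]
      functor_cong[of "two C" "two D" "\<lambda>n. n" "snd F" "\<lambda>n. n" "snd G"]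
      functor_cong[of "vert C" "vert D" "fst F" "snd F" "fst G" "snd G"] assms(1,3,4)
    unfolding twofunctor_iff by simp
qed

lemma comp_pair_2functor:
  assumes "is_2functor C D F" "is_2functor D E G" "is_cat2 C"
  shows "is_2functor C E (comp_pair C G F)"
  by (rule twofunctor_cong[OF twofunctor_compose[OF assms(1,2)] assms(3)])
    (auto simp: comp_pair_def compose_def split: prod.split)

lemma id_pair_2functor: "is_cat2 C \<Longrightarrow> is_2functor C C (id_pair C)"
  by (rule twofunctor_cong[of _ _ "(\<lambda>f. f, \<lambda>f. f)"])
    (auto simp: id_pair_def twofunctor_iff is_cat2_def intro: functor_ident)

locale law2_map = A: law2 L + B: law2 L'
  for L :: "('o, 'm) law2" and L' :: "('p, 'n) law2" +
  fixes F :: "('o \<Rightarrow> 'p) \<times> ('m \<Rightarrow> 'n)"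
  assumes f2: "is_2functor (l2cat L) (l2cat L') F"
    and fin1: "a \<in> Arr FF \<Longrightarrow> fst F (l2fin L a) = l2fin L' a"
begin

lemma vert_functor: "is_functor (vert (l2cat L)) (vert (l2cat L')) (fst F) (snd F)"
  and one_functor: "is_functor (one (l2cat L)) (one (l2cat L')) (\<lambda>n. n) (fst F)"
  and two_functor: "is_functor (two (l2cat L)) (two (l2cat L')) (\<lambda>n. n) (snd F)"
  using f2 by (auto simp: twofunctor_iff)

end

sublocale law2_map \<subseteq> M1: lawv_map "one (l2cat L)" "l2fin L" "one (l2cat L')" "l2fin L'" "fst F"
  by unfold_locales (use one_functor fin1 in auto)

sublocale law2_map \<subseteq> M2: lawv_map "two (l2cat L)" "\<lambda>a. Idt (vert (l2cat L)) (l2fin L a)"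
    "two (l2cat L')" "\<lambda>a. Idt (vert (l2cat L')) (l2fin L' a)" "snd F"
  by unfold_locales (use two_functor functor_id[OF vert_functor] A.fin_arr fin1 in auto)

lemma law2_maps_iff:
  assumes "is_law2 L" "is_law2 L'"
  shows "F \<in> law2_maps L L' \<longleftrightarrow> fst F \<in> extensional (Arr (one (l2cat L))) \<and>
    snd F \<in> extensional (Arr (two (l2cat L))) \<and> law2_map L L' F"
proof
  assume h: "F \<in> law2_maps L L'"
  then show "fst F \<in> extensional (Arr (one (l2cat L))) \<and>
    snd F \<in> extensional (Arr (two (l2cat L))) \<and> law2_map L L' F"
    using assms by (auto simp: law2_maps_def law2_map_def law2_map_axioms_def law2_def)
next
  assume h: "fst F \<in> extensional (Arr (one (l2cat L))) \<and>
    snd F \<in> extensional (Arr (two (l2cat L))) \<and> law2_map L L' F"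
  then interpret law2_map L L' F by simp
  have "is_2product (l2cat L') k x c (\<lambda>i. fst F (p i))" if p: "is_2product (l2cat L) k x c p" for k x c p
  proof -
    have "Idt (vert (l2cat L')) (fst F (p i)) = snd F (Idt (vert (l2cat L)) (p i))" if "i < k" for i
      using functor_id[OF vert_functor, of "p i"] p that by (auto simp: is_2product_def is_product_def in_hom)
    then show ?thesis
      using M1.map_product[of k x c p] M2.map_product[of k x c "\<lambda>i. Idt (vert (l2cat L)) (p i)"] p
      unfolding is_2product_def is_product_def by simp
  qed
  then show "F \<in> law2_maps L L'" using h f2 fin1 by (auto simp: law2_maps_def)
qed

lemma law2_maps_catpro:
  assumes "is_law2 L" "is_law2 L'" "F \<in> law2_maps L L'"
  shows "F \<in> catpro_maps (law2_catpro L) (law2_catpro L')"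
proof -
  interpret law2_map L L' F using assms law2_maps_iff by blast
  show ?thesis
    using assms(3) M1.map_prod_arr[OF arr_hom arr_hom] M2.map_prod_arr[OF arr_hom arr_hom]
    by (auto simp: catpro_maps_def law2_maps_def law2_catpro_def)
qed


section \<open>The categories of structures\<close>

lemma pro_cat: "is_pro P \<Longrightarrow> is_category (pcat P)" "is_pro P \<Longrightarrow> Obj (pcat P) = UNIV"
  by (simp_all add: is_pro_def Let_def)

lemma Pro_category: "is_category Pro"
  unfolding Pro_def
proof (rule struct_cat_category; unfold mem_Collect_eq)
  fix P Q R :: "'u pro" and f g
  assume P: "is_pro P" and Q: "is_pro Q" and f: "f \<in> pro_maps P Q" and g: "g \<in> pro_maps Q R"
  have fA: "f x \<in> Arr (pcat Q)" if "x \<in> Arr (pcat P)" for x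
    using f functor_hom[OF _ arr_hom[OF that]] by (force simp: pro_maps_def in_hom)
  have F: "is_functor (pcat P) (pcat R) (\<lambda>n. n) (compose (Arr (pcat P)) g f)"
    by (rule functor_cong[OF functor_compose[of "pcat P" "pcat Q" "\<lambda>n. n" f "pcat R" "\<lambda>n. n" g]])
      (use f g in \<open>auto simp: pro_maps_def compose_def\<close>)
  have t: "ptens P x y \<in> Arr (pcat P)" if "x \<in> Arr (pcat P)" "y \<in> Arr (pcat P)" for x y
    using P that by (simp add: is_pro_def Let_def in_hom)
  show "compose (Arr (pcat P)) g f \<in> pro_maps P R"
    using f g F t fA by (simp add: pro_maps_def) (simp add: compose_def)
next
  fix P :: "'u pro" assume P: "is_pro P"
  have t: "ptens P x y \<in> Arr (pcat P)" if "x \<in> Arr (pcat P)" "y \<in> Arr (pcat P)" for x y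
    using P that by (simp add: is_pro_def Let_def in_hom)
  show "(\<lambda>f\<in>Arr (pcat P). f) \<in> pro_maps P P"
    using functor_cong[OF functor_ident[OF pro_cat(1)[OF P]], of "\<lambda>n. n" "\<lambda>f\<in>Arr (pcat P). f"] t
    by (simp add: pro_maps_def)
next
  fix P Q R S :: "'u pro" and f g h
  assume P: "is_pro P" and Q: "is_pro Q" and f: "f \<in> pro_maps P Q"
  have fA: "f x \<in> Arr (pcat Q)" if "x \<in> Arr (pcat P)" for x
    using f functor_hom[OF _ arr_hom[OF that]] by (force simp: pro_maps_def in_hom)
  have fe: "f x = undefined" if "x \<notin> Arr (pcat P)" for x
    using f that by (simp add: pro_maps_def extensional_def)
  show "compose (Arr (pcat P)) f (\<lambda>f\<in>Arr (pcat P). f) = f"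
    "compose (Arr (pcat P)) (\<lambda>f\<in>Arr (pcat Q). f) f = f"
    "compose (Arr (pcat P)) h (compose (Arr (pcat P)) g f) = compose (Arr (pcat P)) (compose (Arr (pcat Q)) h g) f"
    using fA fe by (auto simp: compose_def restrict_def fun_eq_iff)
qed

lemma Law_category: "is_category Law"
  unfolding Law_def
proof (rule struct_cat_category; unfold mem_Collect_eq)
  fix P Q R :: "'u law" and f g
  assume P: "is_law P" and Q: "is_law Q" and R: "is_law R" and f: "f \<in> law_maps P Q" and g: "g \<in> law_maps Q R"
  interpret f: lawv_map "lcat P" "lfin P" "lcat Q" "lfin Q" f using f law_maps_iff[OF P Q] by simp
  interpret g: lawv_map "lcat Q" "lfin Q" "lcat R" "lfin R" g using g law_maps_iff[OF Q R] by simp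
  have fA: "lfin P x \<in> Arr (lcat P)" if "x \<in> Arr FF" for x
    using f.A.fin_hom[OF arr_hom[OF that]] by (force simp: in_hom)
  have F: "is_functor (lcat P) (lcat R) (\<lambda>n. n) (compose (Arr (lcat P)) g f)"
    by (rule functor_cong[OF functor_compose[OF f.funct g.funct]]) (auto simp: compose_def)
  have "lawv_map (lcat P) (lfin P) (lcat R) (lfin R) (compose (Arr (lcat P)) g f)"
    by unfold_locales (use F fA in \<open>auto simp: compose_def f.fin g.fin\<close>)
  then show "compose (Arr (lcat P)) g f \<in> law_maps P R"
    using law_maps_iff[OF P R] by simp
next
  fix P :: "'u law" assume P: "is_law P"
  interpret lawv "lcat P" "lfin P" using P law_lawv[of P] by simp
  have fA: "lfin P x \<in> Arr (lcat P)" if "x \<in> Arr FF" for x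
    using fin_hom[OF arr_hom[OF that]] by (force simp: in_hom)
  have "lawv_map (lcat P) (lfin P) (lcat P) (lfin P) (\<lambda>f\<in>Arr (lcat P). f)"
    by unfold_locales (use functor_cong[OF functor_ident[OF cat]] fA in auto)
  then show "(\<lambda>f\<in>Arr (lcat P). f) \<in> law_maps P P"
    using law_maps_iff[OF P P] by simp
next
  fix P Q R S :: "'u law" and f g h
  assume P: "is_law P" and Q: "is_law Q" and f: "f \<in> law_maps P Q"
  have fA: "f x \<in> Arr (lcat Q)" if "x \<in> Arr (lcat P)" for x
    using f functor_hom[OF _ arr_hom[OF that]] by (force simp: law_maps_def in_hom)
  have fe: "f x = undefined" if "x \<notin> Arr (lcat P)" for x
    using f that by (simp add: law_maps_def extensional_def)
  show "compose (Arr (lcat P)) f (\<lambda>f\<in>Arr (lcat P). f) = f"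
    "compose (Arr (lcat P)) (\<lambda>f\<in>Arr (lcat Q). f) f = f"
    "compose (Arr (lcat P)) h (compose (Arr (lcat P)) g f) = compose (Arr (lcat P)) (compose (Arr (lcat Q)) h g) f"
    using fA fe by (auto simp: compose_def restrict_def fun_eq_iff)
qed

lemma Sig_category: "is_category Sig"
  unfolding Sig_def
  by (rule struct_cat_category)
    (auto simp: compose_def restrict_def fun_eq_iff PiE_iff extensional_def)

lemma comp_pair_eq_iff:
  "comp_pair C F G = comp_pair C F' G' \<longleftrightarrow>
    (\<forall>f\<in>Arr (one C). fst F (fst G f) = fst F' (fst G' f)) \<and>
    (\<forall>\<alpha>\<in>Arr (two C). snd F (snd G \<alpha>) = snd F' (snd G' \<alpha>))"
  by (auto simp: comp_pair_def compose_def restrict_def fun_eq_iff split: prod.splits)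

lemma comp_pair_laws:
  assumes "is_2functor C D F" "fst F \<in> extensional (Arr (one C))" "snd F \<in> extensional (Arr (two C))"
  shows "comp_pair C F (id_pair C) = F" "comp_pair C (id_pair D) F = F"
    "comp_pair C H (comp_pair C G F) = comp_pair C (comp_pair D H G) F"
proof -
  have fA: "fst F x \<in> Arr (one D)" if "x \<in> Arr (one C)" for x
    using assms functor_hom[OF _ arr_hom[OF that]] by (force simp: twofunctor_iff in_hom)
  have gA: "snd F x \<in> Arr (two D)" if "x \<in> Arr (two C)" for x
    using assms functor_hom[OF _ arr_hom[OF that]] by (force simp: twofunctor_iff in_hom)
  show "comp_pair C F (id_pair C) = F" "comp_pair C (id_pair D) F = F"
    "comp_pair C H (comp_pair C G F) = comp_pair C (comp_pair D H G) F"
    using fA gA assms(2,3)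
    by (auto simp: comp_pair_def id_pair_def compose_def restrict_def fun_eq_iff extensional_def split: prod.splits)
      metis+
qed

lemma catpro_mapsD:
  assumes "F \<in> catpro_maps Q Q'"
  shows "fst F \<in> extensional (Arr (one (cpcat Q)))" "snd F \<in> extensional (Arr (two (cpcat Q)))"
    "is_2functor (cpcat Q) (cpcat Q') F"
    "f \<in> Arr (one (cpcat Q)) \<Longrightarrow> g \<in> Arr (one (cpcat Q)) \<Longrightarrow> fst F (tens1 Q f g) = tens1 Q' (fst F f) (fst F g)"
    "\<alpha> \<in> Arr (two (cpcat Q)) \<Longrightarrow> \<beta> \<in> Arr (two (cpcat Q)) \<Longrightarrow> snd F (tens2 Q \<alpha> \<beta>) = tens2 Q' (snd F \<alpha>) (snd F \<beta>)"
  using assms by (auto simp: catpro_maps_def)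

lemma catpro_mapsI:
  assumes "fst F \<in> extensional (Arr (one (cpcat Q)))" "snd F \<in> extensional (Arr (two (cpcat Q)))"
    "is_2functor (cpcat Q) (cpcat Q') F"
    "\<And>f g. f \<in> Arr (one (cpcat Q)) \<Longrightarrow> g \<in> Arr (one (cpcat Q)) \<Longrightarrow> fst F (tens1 Q f g) = tens1 Q' (fst F f) (fst F g)"
    "\<And>\<alpha> \<beta>. \<alpha> \<in> Arr (two (cpcat Q)) \<Longrightarrow> \<beta> \<in> Arr (two (cpcat Q)) \<Longrightarrow> snd F (tens2 Q \<alpha> \<beta>) = tens2 Q' (snd F \<alpha>) (snd F \<beta>)"
  shows "F \<in> catpro_maps Q Q'"
  using assms by (auto simp: catpro_maps_def split: prod.splits)

lemma catpro_tens:
  assumes "is_catpro Q"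
  shows "f \<in> Arr (one (cpcat Q)) \<Longrightarrow> g \<in> Arr (one (cpcat Q)) \<Longrightarrow> tens1 Q f g \<in> Arr (one (cpcat Q))"
    "\<alpha> \<in> Arr (two (cpcat Q)) \<Longrightarrow> \<beta> \<in> Arr (two (cpcat Q)) \<Longrightarrow> tens2 Q \<alpha> \<beta> \<in> Arr (two (cpcat Q))"
    "is_cat2 (cpcat Q)"
  using assms by (simp_all add: is_catpro_def is_pro_def Let_def in_hom)

lemma CatPro_category: "is_category CatPro"
  unfolding CatPro_def
proof (rule struct_cat_category; unfold mem_Collect_eq)
  fix P Q R :: "('u, 'u cells) catpro" and F G
  assume P: "is_catpro P" and Q: "is_catpro Q" and F: "F \<in> catpro_maps P Q" and G: "G \<in> catpro_maps Q R"
  note FD = catpro_mapsD[OF F] and GD = catpro_mapsD[OF G]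
  have fA: "fst F x \<in> Arr (one (cpcat Q))" if "x \<in> Arr (one (cpcat P))" for x
    using FD(3) functor_hom[OF _ arr_hom[OF that]] by (force simp: twofunctor_iff in_hom)
  have gA: "snd F x \<in> Arr (two (cpcat Q))" if "x \<in> Arr (two (cpcat P))" for x
    using FD(3) functor_hom[OF _ arr_hom[OF that]] by (force simp: twofunctor_iff in_hom)
  show "comp_pair (cpcat P) G F \<in> catpro_maps P R"
  proof (rule catpro_mapsI)
    show "is_2functor (cpcat P) (cpcat R) (comp_pair (cpcat P) G F)"
      by (rule comp_pair_2functor[OF FD(3) GD(3) catpro_tens(3)[OF P]])
  qed (use catpro_tens[OF P] FD(4,5) GD(4,5) fA gA in
      \<open>auto simp: comp_pair_def case_prod_unfold compose_def\<close>)
next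
  fix P :: "('u, 'u cells) catpro" assume P: "is_catpro P"
  show "id_pair (cpcat P) \<in> catpro_maps P P"
    by (rule catpro_mapsI)
       (use catpro_tens[OF P] id_pair_2functor in \<open>auto simp: id_pair_def\<close>)
qed (auto intro!: comp_pair_laws dest: catpro_mapsD)

lemma TwoLaw_category: "is_category TwoLaw"
  unfolding TwoLaw_def
proof (rule struct_cat_category; unfold mem_Collect_eq)
  fix P Q R :: "('u, 'u cells) law2" and F G
  assume P: "is_law2 P" and Q: "is_law2 Q" and R: "is_law2 R" and F: "F \<in> law2_maps P Q" and G: "G \<in> law2_maps Q R"
  interpret f: law2_map P Q F using F law2_maps_iff[OF P Q] by simp
  interpret g: law2_map Q R G using G law2_maps_iff[OF Q R] by simp
  have "law2_map P R (comp_pair (l2cat P) G F)"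
    by unfold_locales (use comp_pair_2functor[OF f.f2 g.f2 f.A.c2] f.A.fin_arr f.fin1 g.fin1 in
      \<open>auto simp: comp_pair_def case_prod_unfold compose_def\<close>)
  then show "comp_pair (l2cat P) G F \<in> law2_maps P R"
    using law2_maps_iff[OF P R] by (simp add: comp_pair_def case_prod_unfold)
next
  fix P :: "('u, 'u cells) law2" assume P: "is_law2 P"
  interpret law2 P by unfold_locales (rule P)
  have "law2_map P P (id_pair (l2cat P))"
    by unfold_locales (use id_pair_2functor[OF c2] fin_arr in \<open>auto simp: id_pair_def\<close>)
  then show "id_pair (l2cat P) \<in> law2_maps P P"
    using law2_maps_iff[OF P P] by (simp add: id_pair_def)
qed (auto intro!: comp_pair_laws simp: law2_maps_iff dest: law2_map.f2)

lemma law_simps [simp]: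
  "Obj Law = {L. is_law L}" "Src Law (A, m, B) = A" "Tgt Law (A, m, B) = B" "Idt Law A = (A, (\<lambda>f\<in>Arr (lcat A). f), A)"
  "Cmp Law (B', n, D) (A, m, B) = (A, compose (Arr (lcat A)) n m, D)"
  by (simp_all add: Law_def struct_cat_simps)

lemma law_hom: "f \<in> hom Law A B \<longleftrightarrow> (\<exists>m. f = (A, m, B) \<and> is_law A \<and> is_law B \<and> m \<in> law_maps A B)"
  by (auto simp: Law_def struct_cat_hom)

lemma pro_simps [simp]:
  "Obj Pro = {L. is_pro L}" "Src Pro (A, m, B) = A" "Tgt Pro (A, m, B) = B" "Idt Pro A = (A, (\<lambda>f\<in>Arr (pcat A). f), A)"
  "Cmp Pro (B', n, D) (A, m, B) = (A, compose (Arr (pcat A)) n m, D)"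
  by (simp_all add: Pro_def struct_cat_simps)

lemma pro_hom: "f \<in> hom Pro A B \<longleftrightarrow> (\<exists>m. f = (A, m, B) \<and> is_pro A \<and> is_pro B \<and> m \<in> pro_maps A B)"
  by (auto simp: Pro_def struct_cat_hom)

lemma catpro_simps [simp]:
  "Obj CatPro = {L. is_catpro L}" "Src CatPro (A, m, B) = A" "Tgt CatPro (A, m, B) = B" "Idt CatPro A = (A, id_pair (cpcat A), A)"
  "Cmp CatPro (B', n, D) (A, m, B) = (A, comp_pair (cpcat A) n m, D)"
  by (simp_all add: CatPro_def struct_cat_simps)

lemma catpro_hom: "f \<in> hom CatPro A B \<longleftrightarrow> (\<exists>m. f = (A, m, B) \<and> is_catpro A \<and> is_catpro B \<and> m \<in> catpro_maps A B)"
  by (auto simp: CatPro_def struct_cat_hom)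

lemma law2_simps [simp]:
  "Obj TwoLaw = {L. is_law2 L}" "Src TwoLaw (A, m, B) = A" "Tgt TwoLaw (A, m, B) = B" "Idt TwoLaw A = (A, id_pair (l2cat A), A)"
  "Cmp TwoLaw (B', n, D) (A, m, B) = (A, comp_pair (l2cat A) n m, D)"
  by (simp_all add: TwoLaw_def struct_cat_simps)

lemma law2_hom: "f \<in> hom TwoLaw A B \<longleftrightarrow> (\<exists>m. f = (A, m, B) \<and> is_law2 A \<and> is_law2 B \<and> m \<in> law2_maps A B)"
  by (auto simp: TwoLaw_def struct_cat_hom)

lemma sig_simps [simp]:
  "Obj Sig = UNIV" "Src Sig (A, m, B) = A" "Tgt Sig (A, m, B) = B" "Idt Sig A = (A, (\<lambda>k. \<lambda>g\<in>A k. g), A)"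
  "Cmp Sig (B', n, D) (A, m, B) = (A, (\<lambda>k. compose (A k) (n k) (m k)), D)"
  by (simp_all add: Sig_def struct_cat_simps)

lemma sig_hom: "f \<in> hom Sig A B \<longleftrightarrow> (\<exists>m. f = (A, m, B) \<and> (\<forall>k. m k \<in> A k \<rightarrow>\<^sub>E B k))"
  unfolding Sig_def struct_cat_hom by simp

section \<open>Locally thick 2-categories\<close>

text \<open>The relation of lying in a common member of \<open>K\<close>; its pairs are the 2-cells of the thick 2-category.\<close>

definition pairs :: "'u set set \<Rightarrow> 'u cells set" where
  "pairs K = (\<Union>S\<in>K. S \<times> S)"

lemma coprod_E_simps [simp]:
  "Obj (coprod_E K) = \<Union>K" "Arr (coprod_E K) = pairs K" "Src (coprod_E K) = fst"
  "Tgt (coprod_E K) = snd" "Idt (coprod_E K) f = (f, f)" "Cmp (coprod_E K) \<beta> \<alpha> = (fst \<alpha>, snd \<beta>)"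
  by (simp_all add: coprod_E_def Ecat_def pairs_def)

lemma thick_simps [simp]:
  "one (thick_cat2 C K) = C" "vert (thick_cat2 C K) = coprod_E K"
  "Obj (two (thick_cat2 C K)) = Obj C" "Arr (two (thick_cat2 C K)) = pairs K"
  "Src (two (thick_cat2 C K)) \<alpha> = Src C (fst \<alpha>)" "Tgt (two (thick_cat2 C K)) \<alpha> = Tgt C (fst \<alpha>)"
  "Idt (two (thick_cat2 C K)) n = (Idt C n, Idt C n)"
  "Cmp (two (thick_cat2 C K)) \<beta> \<alpha> = (Cmp C (fst \<beta>) (fst \<alpha>), Cmp C (snd \<beta>) (snd \<alpha>))"
  by (simp_all add: thick_cat2_def)

locale thick =
  fixes C :: "(nat, 'u) cat" and K :: "'u set set"
  assumes cat: "is_category C" and objs [simp]: "Obj C = UNIV" and arrs: "\<Union>K = Arr C"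
    and par: "(f, g) \<in> pairs K \<Longrightarrow> Src C f = Src C g \<and> Tgt C f = Tgt C g"
    and trans: "(f, g) \<in> pairs K \<Longrightarrow> (g, h) \<in> pairs K \<Longrightarrow> (f, h) \<in> pairs K"
    and cmp: "(f, g) \<in> pairs K \<Longrightarrow> (f', g') \<in> pairs K \<Longrightarrow> Tgt C f = Src C f' \<Longrightarrow>
      (Cmp C f' f, Cmp C g' g) \<in> pairs K"
begin

abbreviation "R \<equiv> pairs K"
abbreviation "T \<equiv> thick_cat2 C K"

lemma R_arr: "(f, g) \<in> R \<Longrightarrow> f \<in> Arr C \<and> g \<in> Arr C"
  using arrs by (auto simp: pairs_def)

lemma R_refl: "f \<in> Arr C \<Longrightarrow> (f, f) \<in> R"
  using arrs by (auto simp: pairs_def)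

lemma two_hom: "\<alpha> \<in> hom (two T) n k \<longleftrightarrow> (fst \<alpha>, snd \<alpha>) \<in> R \<and> fst \<alpha> \<in> hom C n k \<and> snd \<alpha> \<in> hom C n k"
  using par[of "fst \<alpha>" "snd \<alpha>"] R_arr[of "fst \<alpha>" "snd \<alpha>"] by (auto simp: in_hom)

lemma vert_hom: "\<alpha> \<in> hom (vert T) f g \<longleftrightarrow> \<alpha> = (f, g) \<and> (f, g) \<in> R"
  by (cases \<alpha>) (auto simp: in_hom)

lemmas vert_hom' = vert_hom[unfolded thick_simps]

lemma two_cat: "is_category (two T)"
proof (rule is_categoryI)
  show "Idt (two T) a \<in> hom (two T) a a" for a
    using R_refl cat_id[OF cat, of a] unfolding two_hom by (simp add: in_hom)
  fix \<alpha> \<beta> a b c assume \<alpha>: "\<alpha> \<in> hom (two T) a b" and \<beta>: "\<beta> \<in> hom (two T) b c"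
  then have "Tgt C (fst \<alpha>) = Src C (fst \<beta>)" by (simp add: in_hom)
  then show "Cmp (two T) \<beta> \<alpha> \<in> hom (two T) a c"
    using \<alpha> \<beta> cmp[of "fst \<alpha>" "snd \<alpha>" "fst \<beta>" "snd \<beta>"]
    unfolding two_hom by (auto intro: cat_cmp[OF cat])
qed (auto simp: two_hom cat_idl[OF cat] cat_idr[OF cat] intro: cat_assoc[OF cat])

lemma vert_cat: "is_category (vert T)"
proof (rule is_categoryI)
  show "Idt (vert T) f \<in> hom (vert T) f f" if "f \<in> Obj (vert T)" for f
    using that R_refl arrs unfolding vert_hom by simp
  show "Cmp (vert T) \<beta> \<alpha> \<in> hom (vert T) f h" if "\<alpha> \<in> hom (vert T) f g" "\<beta> \<in> hom (vert T) g h" for \<alpha> \<beta> f g h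
    using that trans unfolding vert_hom by (auto)
qed (use R_arr arrs in \<open>auto simp: vert_hom'\<close>)

lemma T_cat2: "is_cat2 T"
proof (rule is_cat2I)
  show "is_functor (two T) (one T) (\<lambda>n. n) (Src (vert T))"
    "is_functor (two T) (one T) (\<lambda>n. n) (Tgt (vert T))"
    using cat two_cat by (auto intro!: is_functorI simp: two_hom)
  show "is_functor (one T) (two T) (\<lambda>n. n) (Idt (vert T))"
    using cat two_cat R_refl by (auto intro!: is_functorI simp: two_hom in_hom)
qed (use cat two_cat vert_cat arrs in \<open>auto simp: vert_hom'\<close>)

text \<open>A 2-cell of a thick 2-category is no more than the pair of its source and target, so the action of a
  2-functor into it on 2-cells is forced, and all equations between 2-cells hold automatically.\<close>

lemma functor_into:
  assumes "is_cat2 M" and h: "is_functor (one M) C (\<lambda>n. n) h"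
    and hR: "\<And>\<alpha>. \<alpha> \<in> Arr (two M) \<Longrightarrow> (h (Src (vert M) \<alpha>), h (Tgt (vert M) \<alpha>)) \<in> R"
  shows "is_2functor M T (h, \<lambda>\<alpha>\<in>Arr (two M). (h (Src (vert M) \<alpha>), h (Tgt (vert M) \<alpha>)))"
proof -
  interpret M: cat2 M by unfold_locales (rule assms(1))
  let ?F = "\<lambda>\<alpha>\<in>Arr (two M). (h (Src (vert M) \<alpha>), h (Tgt (vert M) \<alpha>))"
  have "is_functor (two M) (two T) (\<lambda>n. n) ?F"
  proof (rule is_functorI[OF M.two_cat two_cat])
    show "?F (Idt (two M) a) = Idt (two T) a" for a
      using cat_id[OF M.two_cat, of a] functor_id[OF M.src_functor, of a] functor_id[OF M.tgt_functor, of a]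
        functor_id[OF h, of a] by (simp add: in_hom)
    show "?F \<alpha> \<in> hom (two T) a b" if "\<alpha> \<in> hom (two M) a b" for \<alpha> a b
      using functor_hom[OF h M.two_vhom(2)[OF that]] functor_hom[OF h M.two_vhom(3)[OF that]] that hR[of \<alpha>]
      unfolding two_hom by (simp add: in_hom[of \<alpha>])
    show "?F (Cmp (two M) \<beta> \<alpha>) = Cmp (two T) (?F \<beta>) (?F \<alpha>)"
      if "\<alpha> \<in> hom (two M) a b" "\<beta> \<in> hom (two M) b c" for \<alpha> \<beta> a b c
      using that cat_cmp[OF M.two_cat that] functor_cmp[OF M.src_functor that] functor_cmp[OF M.tgt_functor that]
        functor_cmp[OF h M.two_vhom(2)[OF that(1)] M.two_vhom(2)[OF that(2)]]
        functor_cmp[OF h M.two_vhom(3)[OF that(1)] M.two_vhom(3)[OF that(2)]]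
      by (simp add: in_hom[of \<alpha>] in_hom[of \<beta>] in_hom[of "Cmp (two M) \<beta> \<alpha>"])
  qed simp
  moreover have "is_functor (vert M) (vert T) h ?F"
  proof (rule is_functorI[OF M.vert_cat vert_cat])
    show "h f \<in> Obj (vert T)" if "f \<in> Obj (vert M)" for f
      using that functor_hom[OF h arr_hom[of f]] arrs by (simp add: in_hom)
    show "?F (Idt (vert M) f) = Idt (vert T) (h f)" if "f \<in> Obj (vert M)" for f
      using M.idt_vhom[of f] that by (simp add: in_hom)
    show "?F \<alpha> \<in> hom (vert T) (h f) (h g)" if "\<alpha> \<in> hom (vert M) f g" for \<alpha> f g
      using that hR[of \<alpha>] unfolding vert_hom by (simp add: in_hom)
    show "?F (Cmp (vert M) \<beta> \<alpha>) = Cmp (vert T) (?F \<beta>) (?F \<alpha>)"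
      if "\<alpha> \<in> hom (vert M) f g" "\<beta> \<in> hom (vert M) g k" for \<alpha> \<beta> f g k
      using cat_cmp[OF M.vert_cat that] that by (simp add: in_hom)
  qed
  ultimately show ?thesis using h by (simp add: twofunctor_iff)
qed

text \<open>A tuple of 2-cells is the pair of the tuples of sources and of targets; the assumption on \<open>R\<close> says that
  this pair is again a 2-cell.\<close>

lemma T_law2:
  assumes "lawv C j"
    and joint: "\<And>n k f g. f \<in> hom C n k \<Longrightarrow> g \<in> hom C n k \<Longrightarrow>
      (\<And>i. i < k \<Longrightarrow> (Cmp C (j (el k i)) f, Cmp C (j (el k i)) g) \<in> R) \<Longrightarrow> (f, g) \<in> R"
  shows "is_law2 \<lparr>l2cat = T, l2fin = j\<rparr>"
proof -
  interpret lawv C j by (rule assms(1))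
  interpret T: cat2 T by unfold_locales (rule T_cat2)
  have "lawv (two T) (\<lambda>a. Idt (vert T) (j a))"
  proof (rule lawvI)
    show "is_functor FF (two T) (\<lambda>n. n) (\<lambda>a. Idt (vert T) (j a))"
      using functor_compose[OF fin_functor, of "two T" "\<lambda>n. n" "Idt (vert T)"] T.idt_functor by simp
    show "Obj (two T) = UNIV" by simp
  next
    fix n k :: nat and \<phi> assume \<phi>: "\<And>i. i < k \<Longrightarrow> \<phi> i \<in> hom (two T) n 1"
    obtain f where f: "f \<in> hom C n k" "\<And>i. i < k \<Longrightarrow> Cmp C (j (el k i)) f = fst (\<phi> i)"
      using productD(3)[OF fin_product[OF FF_el_product], of n k "\<lambda>i. fst (\<phi> i)"] \<phi>
      unfolding two_hom by auto
    obtain g where g: "g \<in> hom C n k" "\<And>i. i < k \<Longrightarrow> Cmp C (j (el k i)) g = snd (\<phi> i)"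
      using productD(3)[OF fin_product[OF FF_el_product], of n k "\<lambda>i. snd (\<phi> i)"] \<phi>
      unfolding two_hom by auto
    have "(f, g) \<in> R" by (rule joint[OF f(1) g(1)]) (use \<phi> f g in \<open>simp add: two_hom\<close>)
    then have "(f, g) \<in> hom (two T) n k" using f g by (simp add: two_hom)
    then show "\<exists>\<theta>\<in>hom (two T) n k. \<forall>i<k. Cmp (two T) (Idt (vert T) (j (el k i))) \<theta> = \<phi> i"
      using f g by (auto intro!: bexI[of _ "(f, g)"])
  next
    fix n k :: nat and \<theta> \<theta>' assume *: "\<theta> \<in> hom (two T) n k" "\<theta>' \<in> hom (two T) n k"
      "\<And>i. i < k \<Longrightarrow> Cmp (two T) (Idt (vert T) (j (el k i))) \<theta> = Cmp (two T) (Idt (vert T) (j (el k i))) \<theta>'"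
    have "fst \<theta> = fst \<theta>'"
      by (rule el_joint[of _ n k]) (use *(1,2) *(3) in \<open>simp_all add: two_hom\<close>)
    moreover have "snd \<theta> = snd \<theta>'"
      by (rule el_joint[of _ n k]) (use *(1,2) *(3) in \<open>simp_all add: two_hom\<close>)
    ultimately show "\<theta> = \<theta>'" by (simp add: prod_eq_iff)
  qed
  then show ?thesis using T_cat2 assms(1) by (simp add: law2_iff)
qed

end

lemma D_map_2functor:
  assumes "thick C K" "thick C' K'" "is_functor C C' (\<lambda>n. n) h"
    and "\<And>f g. (f, g) \<in> pairs K \<Longrightarrow> (h f, h g) \<in> pairs K'"
  shows "is_2functor (thick_cat2 C K) (thick_cat2 C' K') (D_map (thick_cat2 C K) h)"
proof -
  have "(\<lambda>\<alpha>\<in>Arr (two (thick_cat2 C K)). (h (Src (vert (thick_cat2 C K)) \<alpha>), h (Tgt (vert (thick_cat2 C K)) \<alpha>)))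
    = restrict (map_prod h h) (Arr (two (thick_cat2 C K)))"
    by (auto simp: restrict_def fun_eq_iff)
  then show ?thesis
    using thick.functor_into[OF assms(2) thick.T_cat2[OF assms(1)], of h] assms(3,4)
    unfolding D_map_def by (auto)
qed

lemma thick_catpro:
  assumes P: "is_pro P" and "thick (pcat P) K"
    and tens: "\<And>f g f' g'. (f, g) \<in> pairs K \<Longrightarrow> (f', g') \<in> pairs K \<Longrightarrow>
      (ptens P f f', ptens P g g') \<in> pairs K"
  shows "is_catpro (thick_catpro P K)"
proof -
  interpret thick "pcat P" K by (rule assms(2))
  interpret T: cat2 T by unfold_locales (rule T_cat2)
  have sel: "cpcat (thick_catpro P K) = T" "tens1 (thick_catpro P K) = ptens P"
    by (simp_all add: thick_catpro_def)
  let ?t = "tens2 (thick_catpro P K)" and ?C = "pcat P" and ?u = "ptens P"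
  have t: "?t \<alpha> \<beta> = (?u (fst \<alpha>) (fst \<beta>), ?u (snd \<alpha>) (snd \<beta>))" if "\<alpha> \<in> R" "\<beta> \<in> R" for \<alpha> \<beta>
    using that unfolding thick_catpro_def by simp
  have t': "?t \<alpha> \<beta> = (?u (fst \<alpha>) (fst \<beta>), ?u (snd \<alpha>) (snd \<beta>))" "\<alpha> \<in> R" "\<beta> \<in> R"
    if "\<alpha> \<in> hom (two T) a b" "\<beta> \<in> hom (two T) c d" for \<alpha> \<beta> a b c d
    using t[of \<alpha> \<beta>] that unfolding two_hom by auto
  have tR: "?t \<alpha> \<beta> \<in> R" if "\<alpha> \<in> R" "\<beta> \<in> R" for \<alpha> \<beta>
    using tens[of "fst \<alpha>" "snd \<alpha>" "fst \<beta>" "snd \<beta>"] t[OF that] that by (simp)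
  have ut: "?u f g \<in> hom ?C (a + c) (b + d)" if "f \<in> hom ?C a b" "g \<in> hom ?C c d" for f g a b c d
    using P that by (auto simp: is_pro_def Let_def in_hom)
  have uid: "?u (Idt ?C n) (Idt ?C m) = Idt ?C (n + m)" for n m
    using P by (auto simp: is_pro_def Let_def)
  have uc: "?u (Cmp ?C g f) (Cmp ?C g' f') = Cmp ?C (?u g g') (?u f f')"
    if "f \<in> hom ?C a b" "g \<in> hom ?C b c" "f' \<in> hom ?C a' b'" "g' \<in> hom ?C b' c'" for f g f' g' a b c a' b' c'
    using P that by (auto simp: is_pro_def Let_def in_hom)
  have ua: "?u (?u f g) h = ?u f (?u g h)" if "f \<in> hom ?C a b" "g \<in> hom ?C c d" "h \<in> hom ?C a' b'" for f g h a b c d a' b'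
    using P that by (auto simp: is_pro_def Let_def in_hom)
  have u0: "?u (Idt ?C 0) f = f" "?u f (Idt ?C 0) = f" if "f \<in> hom ?C a b" for f a b
    using P that by (auto simp: is_pro_def Let_def in_hom)
  have thom: "?t \<alpha> \<beta> \<in> hom (two T) (a + c) (b + d)" if "\<alpha> \<in> hom (two T) a b" "\<beta> \<in> hom (two T) c d" for \<alpha> \<beta> a b c d
    using tR[OF t'(2,3)[OF that]] t'(1)[OF that] that ut unfolding two_hom by (simp)
  have "is_pro \<lparr>pcat = two T, ptens = ?t\<rparr>"
  proof (rule is_proI)
    show "?t \<alpha> \<beta> \<in> hom (two T) (a + c) (b + d)" if "\<alpha> \<in> hom (two T) a b" "\<beta> \<in> hom (two T) c d" for \<alpha> \<beta> a b c d
      by (rule thom[OF that])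
    show "?t (Idt (two T) n) (Idt (two T) m) = Idt (two T) (n + m)" for n m
      using t'(1)[OF cat_id[OF two_cat] cat_id[OF two_cat], of n m] by (simp add: uid)
    show "?t (Cmp (two T) g f) (Cmp (two T) g' f') = Cmp (two T) (?t g g') (?t f f')"
      if "f \<in> hom (two T) a b" "g \<in> hom (two T) b c" "f' \<in> hom (two T) a' b'" "g' \<in> hom (two T) b' c'"
      for f g f' g' a b c a' b' c'
      using t'(1)[OF cat_cmp[OF two_cat that(1,2)] cat_cmp[OF two_cat that(3,4)]]
        t'(1)[OF that(1,3)] t'(1)[OF that(2,4)] that uc[of "fst f" a b "fst g" c "fst f'" a' b' "fst g'" c']
        uc[of "snd f" a b "snd g" c "snd f'" a' b' "snd g'" c'] unfolding two_hom by simp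
    show "?t (?t f g) h = ?t f (?t g h)"
      if "f \<in> hom (two T) a a'" "g \<in> hom (two T) b b'" "h \<in> hom (two T) c c'" for f g h a a' b b' c c'
      using t'(1)[OF thom[OF that(1,2)] that(3)] t'(1)[OF that(1) thom[OF that(2,3)]]
        t'(1)[OF that(1,2)] t'(1)[OF that(2,3)] that ua[of "fst f" a a' "fst g" b b' "fst h" c c']
        ua[of "snd f" a a' "snd g" b b' "snd h" c c'] unfolding two_hom by simp
    show "?t (Idt (two T) 0) f = f \<and> ?t f (Idt (two T) 0) = f" if "f \<in> hom (two T) a b" for f a b
      using t'(1)[OF cat_id[OF two_cat] that, of 0] t'(1)[OF that cat_id[OF two_cat], of 0] that u0
      unfolding two_hom by (auto simp: prod_eq_iff)
  qed (simp_all add: two_cat)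
  moreover have "is_pro \<lparr>pcat = ?C, ptens = ?u\<rparr>" using P by (cases P) simp
  moreover have "?t (Cmp (vert T) \<beta> \<alpha>) (Cmp (vert T) \<beta>' \<alpha>') = Cmp (vert T) (?t \<beta> \<beta>') (?t \<alpha> \<alpha>')"
    if "\<alpha> \<in> Arr (vert T)" "\<beta> \<in> Arr (vert T)" "\<alpha>' \<in> Arr (vert T)" "\<beta>' \<in> Arr (vert T)"
      "Tgt (vert T) \<alpha> = Src (vert T) \<beta>" "Tgt (vert T) \<alpha>' = Src (vert T) \<beta>'" for \<alpha> \<beta> \<alpha>' \<beta>'
  proof -
    have "Cmp (vert T) \<beta> \<alpha> \<in> Arr (vert T)" "Cmp (vert T) \<beta>' \<alpha>' \<in> Arr (vert T)"
      using cmp_arr(1)[OF vert_cat] that by blast+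
    then show ?thesis using t that by (simp)
  qed
  ultimately show ?thesis
    unfolding is_catpro_def Let_def sel
    using P T_cat2 t R_refl arrs by simp
qed

lemma singletons_R: "pairs (singletons A) = Id_on A"
  by (auto simp: pairs_def singletons_def)

lemma discrete_thick: "is_category C \<Longrightarrow> Obj C = UNIV \<Longrightarrow> thick C (singletons (Arr C))"
  unfolding thick_def singletons_R by (auto simp: singletons_def cmp_arr)

lemma D_law: "is_law L \<Longrightarrow> is_law2 (D_law L)"
proof -
  assume "is_law L"
  then interpret lawv "lcat L" "lfin L" by (rule law_lawv[THEN iffD1])
  show "is_law2 (D_law L)" unfolding D_law_def
  proof (rule thick.T_law2[OF discrete_thick[OF cat objs] lawv_axioms], unfold singletons_R)
    fix n k f g assume *: "f \<in> hom (lcat L) n k" "g \<in> hom (lcat L) n k"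
      "\<And>i. i < k \<Longrightarrow> (Cmp (lcat L) (lfin L (el k i)) f, Cmp (lcat L) (lfin L (el k i)) g) \<in> Id_on (Arr (lcat L))"
    have "f = g" by (rule el_joint[OF *(1,2)]) (use *(3) in \<open>simp add: Id_on_iff\<close>)
    moreover have "f \<in> Arr (lcat L)" using *(1) by (simp add: in_hom)
    ultimately show "(f, g) \<in> Id_on (Arr (lcat L))" by auto
  qed
qed

lemma D_pro: "is_pro P \<Longrightarrow> is_catpro (D_pro P)"
  unfolding D_pro_def
  by (rule thick_catpro, assumption, rule discrete_thick)
    (simp_all only: singletons_R, auto simp: is_pro_def Let_def in_hom)

lemma functor_from_discrete:
  assumes C: "is_category C" "Obj C = UNIV" and "is_cat2 M" and g: "is_functor C (one M) (\<lambda>n. n) g"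
  shows "is_2functor (thick_cat2 C (singletons (Arr C))) M
    (g, \<lambda>\<alpha>\<in>Id_on (Arr C). Idt (vert M) (g (fst \<alpha>)))"
proof -
  interpret thick C "singletons (Arr C)" by (rule discrete_thick[OF C])
  interpret M: cat2 M by unfold_locales (rule assms(3))
  let ?F = "\<lambda>\<alpha>\<in>Id_on (Arr C). Idt (vert M) (g (fst \<alpha>))"
  note gi = functor_compose[OF g M.idt_functor]
  have gA: "g f \<in> Arr (one M)" if "f \<in> Arr C" for f
    using functor_hom[OF g arr_hom[OF that]] by (simp add: in_hom)
  have v: "\<alpha> \<in> hom (vert T) f f' \<longleftrightarrow> \<alpha> = (f, f) \<and> f' = f \<and> f \<in> Arr C" for \<alpha> f f'
    unfolding vert_hom singletons_R by auto
  have t: "\<alpha> \<in> hom (two T) n k \<longleftrightarrow> (\<exists>f. \<alpha> = (f, f) \<and> f \<in> hom C n k)" for \<alpha> n k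
    unfolding two_hom singletons_R by (cases \<alpha>) (auto simp: in_hom)
  have idc: "Cmp (vert M) (Idt (vert M) x) (Idt (vert M) x) = Idt (vert M) x" if "x \<in> Arr (one M)" for x
    using cat_idl[OF M.vert_cat M.idt_vhom[OF that]] .
  have "is_functor (two T) (two M) (\<lambda>n. n) ?F"
  proof (rule is_functorI[OF two_cat M.two_cat])
    show "?F (Idt (two T) a) = Idt (two M) a" for a
      using functor_id[OF gi, of a] cat_id[OF C(1), of a] C(2) by (simp add: in_hom Id_on_iff)
    show "?F \<alpha> \<in> hom (two M) a b" if "\<alpha> \<in> hom (two T) a b" for \<alpha> a b
      using functor_hom[OF gi] that unfolding t by (auto simp: in_hom)
    show "?F (Cmp (two T) \<beta> \<alpha>) = Cmp (two M) (?F \<beta>) (?F \<alpha>)"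
      if "\<alpha> \<in> hom (two T) a b" "\<beta> \<in> hom (two T) b c" for \<alpha> \<beta> a b c
      using functor_cmp[OF gi] cat_cmp[OF C(1)] that unfolding t by (auto simp: in_hom)
  qed simp
  moreover have "is_functor (vert T) (vert M) g ?F"
  proof (rule is_functorI[OF vert_cat M.vert_cat])
    show "g f \<in> Obj (vert M)" "?F (Idt (vert T) f) = Idt (vert M) (g f)" if "f \<in> Obj (vert T)" for f
      using that arrs gA by (simp_all add: Id_on_iff)
    show "?F \<alpha> \<in> hom (vert M) (g f) (g f')" if "\<alpha> \<in> hom (vert T) f f'" for \<alpha> f f'
      using that M.idt_vhom[OF gA] unfolding v by (simp add: Id_on_iff)
    show "?F (Cmp (vert T) \<beta> \<alpha>) = Cmp (vert M) (?F \<beta>) (?F \<alpha>)"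
      if "\<alpha> \<in> hom (vert T) f f'" "\<beta> \<in> hom (vert T) f' f''" for \<alpha> \<beta> f f' f''
      using that idc[OF gA] unfolding v by (simp add: Id_on_iff)
  qed
  ultimately show ?thesis using g by (simp add: twofunctor_iff)
qed

lemma functor_from_discrete_unique:
  assumes "is_2functor (thick_cat2 C (singletons (Arr C))) M F" "f \<in> Arr C"
  shows "snd F (f, f) = Idt (vert M) (fst F f)"
  using functor_id[of "coprod_E (singletons (Arr C))" "vert M" "fst F" "snd F" f] assms
  by (simp add: twofunctor_iff singletons_def)

text \<open>The codiscrete 2-category on a Lawvere theory, with exactly one 2-cell between any two parallel
  arrows.\<close>

definition parallel_classes :: "(nat, 'u) cat \<Rightarrow> 'u set set" where
  "parallel_classes C = {hom C n k | n k. True}"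

definition codiscrete :: "'u law \<Rightarrow> ('u, 'u cells) law2" where
  "codiscrete L = \<lparr>l2cat = thick_cat2 (lcat L) (parallel_classes (lcat L)), l2fin = lfin L\<rparr>"

lemma parallel_R: "(f, g) \<in> pairs (parallel_classes C) \<longleftrightarrow>
    f \<in> Arr C \<and> g \<in> Arr C \<and> Src C f = Src C g \<and> Tgt C f = Tgt C g"
proof -
  have "pairs (parallel_classes C) = (\<Union>n k. hom C n k \<times> hom C n k)"
    by (auto simp: pairs_def parallel_classes_def)
  then show ?thesis by (auto simp: in_hom)
qed

lemma codiscrete_thick:
  assumes "is_category C" "Obj C = UNIV"
  shows "thick C (parallel_classes C)"
proof -
  have "\<Union>(parallel_classes C) = (\<Union>n k. hom C n k)" by (auto simp: parallel_classes_def)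
  then have "\<Union>(parallel_classes C) = Arr C" by (auto simp: in_hom)
  then show ?thesis unfolding thick_def parallel_R using assms by (auto simp: cmp_arr)
qed

lemma codiscrete_law2: "is_law L \<Longrightarrow> is_law2 (codiscrete L)"
proof -
  assume "is_law L"
  then interpret lawv "lcat L" "lfin L" by (rule law_lawv[THEN iffD1])
  show "is_law2 (codiscrete L)" unfolding codiscrete_def
    by (rule thick.T_law2[OF codiscrete_thick[OF cat objs] lawv_axioms], unfold parallel_R) (auto simp: in_hom)
qed

section \<open>Small sets\<close>

text \<open>Terms over a set of generators, for a sequence of binary operations: the closure of a set under such
  operations consists of the values of these trees, and there are no more trees than leaves if the latter are
  infinite in number.\<close>

datatype 'b tree = Leaf 'b | Node nat "'b tree" "'b tree"

fun tree_value :: "(nat \<Rightarrow> 'x \<Rightarrow> 'x \<Rightarrow> 'x) \<Rightarrow> ('b \<Rightarrow> 'x) \<Rightarrow> 'b tree \<Rightarrow> 'x" where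
  "tree_value f g (Leaf x) = g x"
| "tree_value f g (Node n l r) = f n (tree_value f g l) (tree_value f g r)"

inductive_set op_closure :: "(nat \<Rightarrow> 'x \<Rightarrow> 'x \<Rightarrow> 'x) \<Rightarrow> 'x set \<Rightarrow> 'x set"
  for f B where
  base: "x \<in> B \<Longrightarrow> x \<in> op_closure f B"
| step: "x \<in> op_closure f B \<Longrightarrow> y \<in> op_closure f B \<Longrightarrow> f n x y \<in> op_closure f B"

lemma infinite_square:
  assumes "infinite (UNIV :: 'u set)"
  obtains p :: "'u \<times> 'u \<Rightarrow> 'u" where "inj p"
proof -
  have "(UNIV :: 'u set) \<times> (UNIV :: 'u set) \<approx> (UNIV :: 'u set)"
    unfolding eqpoll_iff_card_of_ordIso by (rule card_of_Times_same_infinite[OF assms])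
  then show ?thesis using that by (auto simp: eqpoll_def bij_betw_def)
qed

lemma trees_lepoll:
  assumes "infinite (UNIV :: 'u set)"
  shows "(UNIV :: 'u tree set) \<lesssim> (UNIV :: 'u set)"
proof -
  obtain p :: "'u \<times> 'u \<Rightarrow> 'u" where p: "inj p" using infinite_square[OF assms] .
  obtain t :: "nat \<Rightarrow> 'u" where t: "inj t"
    using infinite_countable_subset[OF assms] by blast
  define e where "e = rec_tree (\<lambda>x. p (t 0, x)) (\<lambda>n _ _ l r. p (t (Suc n), p (l, r)))"
  have e: "e (Leaf x) = p (t 0, x)" "e (Node n l r) = p (t (Suc n), p (e l, e r))" for x n l r
    by (simp_all add: e_def)
  have "e x = e y \<Longrightarrow> x = y" for x y
  proof (induction x arbitrary: y)
    case (Leaf x) then show ?case by (cases y) (auto simp: e inj_eq[OF p] inj_eq[OF t])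
  next
    case (Node n l r) then show ?case by (cases y) (auto simp: e inj_eq[OF p] inj_eq[OF t])
  qed
  then have "inj e" by (rule injI)
  then show ?thesis by (auto simp: lepoll_def)
qed

lemma op_closure_lepoll:
  assumes inf: "infinite (UNIV :: 'u set)" and "B \<lesssim> (UNIV :: 'u set)"
  shows "op_closure f B \<lesssim> (UNIV :: 'u set)"
proof -
  obtain g :: "'u \<Rightarrow> _" where g: "B \<subseteq> range g" using assms(2) by (auto simp: lepoll_iff)
  have "x \<in> range (tree_value f g)" if "x \<in> op_closure f B" for x
    using that
  proof induction
    case (base x)
    then obtain u where "x = g u" using g by auto
    then show ?case by (intro range_eqI[of _ _ "Leaf u"]) simp
  next
    case (step x y n)
    then obtain l r where "x = tree_value f g l" "y = tree_value f g r" by auto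
    then show ?case by (intro range_eqI[of _ _ "Node n l r"]) simp
  qed
  then have "op_closure f B \<lesssim> (UNIV :: 'u tree set)" by (auto intro: subset_image_lepoll)
  then show ?thesis using trees_lepoll[OF inf] lepoll_trans by blast
qed

lemma countable_lepoll_infinite:
  assumes "countable A" "infinite B" shows "A \<lesssim> B"
proof -
  have "A \<lesssim> (UNIV :: nat set)" using assms(1) by (auto simp: lepoll_def countable_def)
  then show ?thesis using assms(2) infinite_le_lepoll lepoll_trans by blast
qed

lemma Un_lepoll_infinite:
  assumes inf: "infinite (UNIV :: 'u set)" and "A \<lesssim> (UNIV :: 'u set)" "B \<lesssim> (UNIV :: 'u set)"
  shows "A \<union> B \<lesssim> (UNIV :: 'u set)"
proof -
  obtain g h :: "'u \<Rightarrow> _" where "A \<subseteq> range g" "B \<subseteq> range h" using assms(2,3) by (auto simp: lepoll_iff)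
  moreover have "range g \<union> range h \<subseteq> case_sum g h ` (UNIV <+> UNIV)"
    by (auto intro: image_eqI[of _ _ "Inl _"] image_eqI[of _ _ "Inr _"])
  ultimately have AB: "A \<union> B \<subseteq> case_sum g h ` (UNIV <+> UNIV)" by blast
  have "(UNIV :: 'u set) <+> (UNIV :: 'u set) \<approx> (UNIV :: 'u set)"
    unfolding eqpoll_iff_card_of_ordIso by (rule card_of_Plus_infinite1[OF inf card_of_mono1[OF subset_UNIV]])
  then show ?thesis using subset_image_lepoll[OF AB] eqpoll_imp_lepoll lepoll_trans by blast
qed

lemma lepoll_univ: "A \<lesssim> (UNIV :: 'u set)" for A :: "'u set"
  by (simp add: subset_imp_lepoll)

lemma cells_lepoll: "infinite (UNIV :: 'u set) \<Longrightarrow> A \<lesssim> (UNIV :: 'u set)" for A :: "'u cells set"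
  by (metis infinite_square lepoll_def subset_UNIV inj_on_subset)

lemma sum_lepoll:
  assumes inf: "infinite (UNIV :: 'u set)" and "A \<lesssim> (UNIV :: 'u set)" "B \<lesssim> (UNIV :: 'u set)"
  shows "A <+> B \<lesssim> (UNIV :: 'u set)"
  unfolding Plus_def
  by (intro Un_lepoll_infinite[OF inf] lepoll_trans[OF image_lepoll assms(2)] lepoll_trans[OF image_lepoll assms(3)])

lemma FF_countable: "countable (Arr FF)"
proof -
  have "x \<in> range (\<lambda>(m, l, n). (m, \<lambda>i\<in>{..<m}. l ! i, n))" if "x \<in> Arr FF" for x
  proof -
    obtain m f n where x: "x = (m, f, n)" by (cases x)
    then have "f = (\<lambda>i\<in>{..<m}. map f [0..<m] ! i)"
      using that by (auto simp: fun_eq_iff PiE_iff extensional_def)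
    then show ?thesis using x by (intro range_eqI[of _ _ "(m, map f [0..<m], n)"]) simp
  qed
  then show ?thesis by (intro countable_subset[OF _ countable_image[OF countableI_type]]) auto
qed


section \<open>Jointly faithful families of functors\<close>

text \<open>A structure with a jointly faithful family of structure-preserving projections to categories satisfies every
  equation that holds in all of them.  The following lemmas draw this conclusion for the axioms of a category, for
  functors into it, and for Lawvere theories.\<close>

lemma reflect_category:
  assumes "\<And>f. f \<in> Arr C \<Longrightarrow> Src C f \<in> Obj C \<and> Tgt C f \<in> Obj C"
    and "\<And>a. a \<in> Obj C \<Longrightarrow> Idt C a \<in> hom C a a"
    and "\<And>f g a b c. f \<in> hom C a b \<Longrightarrow> g \<in> hom C b c \<Longrightarrow> Cmp C g f \<in> hom C a c"
    and D: "\<And>i. i \<in> I \<Longrightarrow> is_category (D i)"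
    and "\<And>i a. i \<in> I \<Longrightarrow> a \<in> Obj C \<Longrightarrow> Po i a \<in> Obj (D i)"
    and Pid: "\<And>i a. i \<in> I \<Longrightarrow> a \<in> Obj C \<Longrightarrow> Pa i (Idt C a) = Idt (D i) (Po i a)"
    and Phom: "\<And>i f a b. i \<in> I \<Longrightarrow> f \<in> hom C a b \<Longrightarrow> Pa i f \<in> hom (D i) (Po i a) (Po i b)"
    and Pcmp: "\<And>i f g a b c. i \<in> I \<Longrightarrow> f \<in> hom C a b \<Longrightarrow> g \<in> hom C b c \<Longrightarrow>
      Pa i (Cmp C g f) = Cmp (D i) (Pa i g) (Pa i f)"
    and faith: "\<And>f g a b. f \<in> hom C a b \<Longrightarrow> g \<in> hom C a b \<Longrightarrow> (\<And>i. i \<in> I \<Longrightarrow> Pa i f = Pa i g) \<Longrightarrow> f = g"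
  shows "is_category C" "\<And>i. i \<in> I \<Longrightarrow> is_functor C (D i) (Po i) (Pa i)"
proof -
  have ob: "a \<in> Obj C" "b \<in> Obj C" if "f \<in> hom C a b" for f a b
    using assms(1) that by (auto simp: in_hom)
  show C: "is_category C"
  proof (rule is_categoryI)
    fix f g h a b c d assume f: "f \<in> hom C a b" and g: "g \<in> hom C b c" and h: "h \<in> hom C c d"
    show "Cmp C h (Cmp C g f) = Cmp C (Cmp C h g) f"
    proof (rule faith)
      fix i assume i: "i \<in> I"
      show "Pa i (Cmp C h (Cmp C g f)) = Pa i (Cmp C (Cmp C h g) f)"
        using Pcmp[OF i assms(3)[OF f g] h] Pcmp[OF i f g] Pcmp[OF i f assms(3)[OF g h]] Pcmp[OF i g h]
          cat_assoc[OF D[OF i] Phom[OF i f] Phom[OF i g] Phom[OF i h]] by simp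
    qed (use assms(3) f g h in blast)+
  next
    fix f a b assume f: "f \<in> hom C a b"
    note ids = assms(2)[OF ob(1)[OF f]] assms(2)[OF ob(2)[OF f]]
    show "Cmp C f (Idt C a) = f"
      by (rule faith[OF assms(3)[OF ids(1) f] f])
        (simp add: Pcmp[OF _ ids(1) f] Pid ob[OF f] cat_idr[OF D Phom[OF _ f]])
    show "Cmp C (Idt C b) f = f"
      by (rule faith[OF assms(3)[OF f ids(2)] f])
        (simp add: Pcmp[OF _ f ids(2)] Pid ob[OF f] cat_idl[OF D Phom[OF _ f]])
  qed (use assms(1-3) in auto)
  show "is_functor C (D i) (Po i) (Pa i)" if "i \<in> I" for i
    by (rule is_functorI) (use C assms that in auto)
qed

lemma reflect_functor:
  assumes A: "is_category A" and C: "is_category C"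
    and P: "\<And>i. i \<in> I \<Longrightarrow> is_functor C (D i) (Po i) (Pa i)"
    and faith: "\<And>f g a b. f \<in> hom C a b \<Longrightarrow> g \<in> hom C a b \<Longrightarrow> (\<And>i. i \<in> I \<Longrightarrow> Pa i f = Pa i g) \<Longrightarrow> f = g"
    and obj: "\<And>a. a \<in> Obj A \<Longrightarrow> F0 a \<in> Obj C"
    and hm: "\<And>f a b. f \<in> hom A a b \<Longrightarrow> F1 f \<in> hom C (F0 a) (F0 b)"
    and PF: "\<And>i. i \<in> I \<Longrightarrow> is_functor A (D i) (\<lambda>a. Po i (F0 a)) (\<lambda>f. Pa i (F1 f))"
  shows "is_functor A C F0 F1"
proof (rule is_functorI[OF A C obj _ hm])
  fix a assume a: "a \<in> Obj A"
  show "F1 (Idt A a) = Idt C (F0 a)"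
    by (rule faith[OF hm[OF cat_id[OF A a]] cat_id[OF C obj[OF a]]])
      (simp add: functor_id[OF PF a] functor_id[OF P obj[OF a]])
next
  fix f g a b c assume f: "f \<in> hom A a b" and g: "g \<in> hom A b c"
  show "F1 (Cmp A g f) = Cmp C (F1 g) (F1 f)"
    by (rule faith[OF hm[OF cat_cmp[OF A f g]] cat_cmp[OF C hm[OF f] hm[OF g]]])
      (simp add: functor_cmp[OF PF f g] functor_cmp[OF P hm[OF f] hm[OF g]])
qed

text \<open>Tuples are built by iterated binary pairing.  Their uniqueness is again an equation: the components determine
  the images under every projection.\<close>

lemma reflect_lawv:
  assumes C: "is_category C" and O: "Obj C = UNIV"
    and P: "\<And>i. i \<in> I \<Longrightarrow> is_functor C (D i) (\<lambda>n. n) (P i)"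
    and faith: "\<And>f g a b. f \<in> hom C a b \<Longrightarrow> g \<in> hom C a b \<Longrightarrow> (\<And>i. i \<in> I \<Longrightarrow> P i f = P i g) \<Longrightarrow> f = g"
    and jh: "\<And>x n k. x \<in> hom FF n k \<Longrightarrow> j x \<in> hom C n k"
    and Pj: "\<And>i x. i \<in> I \<Longrightarrow> x \<in> Arr FF \<Longrightarrow> P i (j x) = jD i x"
    and D: "\<And>i. i \<in> I \<Longrightarrow> lawv (D i) (jD i)"
    and pair: "\<And>f g n k l. f \<in> hom C n k \<Longrightarrow> g \<in> hom C n l \<Longrightarrow>
      \<exists>h \<in> hom C n (k + l). \<forall>i\<in>I. P i h = pairing (D i) (jD i) (P i f) (P i g)"
  shows "lawv C j"
proof (rule lawvI[OF _ O])
  show F: "is_functor FF C (\<lambda>n. n) j"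
  proof (rule reflect_functor[OF FF_category C P faith])
    show "is_functor FF (D i) (\<lambda>a. a) (\<lambda>f. P i (j f))" if "i \<in> I" for i
      by (rule functor_cong[OF lawv.fin_functor[OF D[OF that]]]) (use Pj that in auto)
  qed (use jh O in auto)
  have Pel: "P i (Cmp C (j (el k m)) h) = Cmp (D i) (jD i (el k m)) (P i h)"
    if "i \<in> I" "m < k" "h \<in> hom C n k" for i m k h n
    using functor_cmp[OF P[OF that(1)] that(3) jh[OF el_hom[OF that(2)]]] Pj[OF that(1)] el_hom[OF that(2)]
    by (simp add: in_hom)
  show joint: "h = h'" if h: "h \<in> hom C n k" "h' \<in> hom C n k"
    "\<And>i. i < k \<Longrightarrow> Cmp C (j (el k i)) h = Cmp C (j (el k i)) h'" for n k h h'
  proof (rule faith[OF h(1,2)])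
    fix i assume i: "i \<in> I"
    show "P i h = P i h'"
      by (rule lawv.el_joint[OF D[OF i] functor_hom[OF P[OF i] h(1)] functor_hom[OF P[OF i] h(2)]])
        (simp add: Pel[OF i _ h(1), symmetric] Pel[OF i _ h(2), symmetric] h(3))
  qed
  fix n k :: nat and f assume "\<And>i. i < k \<Longrightarrow> f i \<in> hom C n 1"
  then show "\<exists>h\<in>hom C n k. \<forall>i<k. Cmp C (j (el k i)) h = f i"
  proof (induction k)
    case 0
    have "(0, (\<lambda>i\<in>{..<0}. i), n) \<in> hom FF n 0" by (simp add: FF_hom restrict_def)
    then show ?case using jh by blast
  next
    case (Suc k)
    obtain h where h: "h \<in> hom C n k" "\<And>i. i < k \<Longrightarrow> Cmp C (j (el k i)) h = f i"
      using Suc.IH Suc.prems by auto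
    have fk: "f k \<in> hom C n 1" using Suc.prems by simp
    obtain g where g: "g \<in> hom C n (k + 1)" "\<And>i. i \<in> I \<Longrightarrow> P i g = pairing (D i) (jD i) (P i h) (P i (f k))"
      using pair[OF h(1) fk] by blast
    have "Cmp C (j (el (k + 1) m)) g = f m" if m: "m < k + 1" for m
    proof (rule faith)
      show "Cmp C (j (el (k + 1) m)) g \<in> hom C n 1" by (rule cat_cmp[OF C g(1) jh[OF el_hom[OF m]]])
      show "f m \<in> hom C n 1" using Suc.prems m by simp
      fix i assume i: "i \<in> I"
      interpret lawv "D i" "jD i" by (rule D[OF i])
      note Ph = functor_hom[OF P[OF i] h(1)] and Pf = functor_hom[OF P[OF i] fk]
      note pr = pairing[OF Ph Pf]
      show "P i (Cmp C (j (el (k + 1) m)) g) = P i (f m)"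
      proof (cases "m < k")
        case True
        have "Cmp (D i) (jD i (el (k + 1) m)) (P i g) = Cmp (D i) (jD i (el k m)) (P i h)"
          using fin_cmp[OF prj_hom(1) el_hom[OF True], of 1] assoc[OF pr(1) fin_hom[OF prj_hom(1)] fin_hom[OF el_hom[OF True]]]
            pr(2) g(2)[OF i] el_prj(1)[OF True, of 1] by simp
        then show ?thesis using Pel[OF i m g(1)] Pel[OF i True h(1)] h(2)[OF True] by simp
      next
        case False
        then have mk: "m = k" using m by simp
        have "el 1 0 = Idt FF 1" by (auto simp: el_def fun_eq_iff)
        then have "prj2 k 1 = el (k + 1) k"
          using el_prj(2)[of 0 1 k] cat_idl[OF FF_category prj_hom(2)[of k 1]] by simp
        then show ?thesis using Pel[OF i m g(1)] pr(3) g(2)[OF i] mk by simp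
      qed
    qed
    then show ?case using g(1) by auto
  qed
qed

section \<open>Categories of families\<close>

abbreviation cod :: "'a \<times> 'b \<times> 'c \<Rightarrow> 'c" where
  "cod x \<equiv> snd (snd x)"

text \<open>Arrows \<open>n \<rightarrow> k\<close> of a product of categories with objects \<open>\<nat>\<close> are families of arrows
  \<open>\<phi> i : n \<rightarrow> k\<close>, recorded as triples \<open>(n, \<phi>, k)\<close> with \<open>\<phi>\<close> extensional on \<open>I\<close>.\<close>

definition "fam_fin I j x = (Src FF x, \<lambda>i\<in>I. j i x, Tgt FF x)"
definition "fam_cmp I D y x = (fst x, \<lambda>i\<in>I. Cmp (D i) (data y i) (data x i), cod y)"
definition "fam_pair I D j x y = (fst x, \<lambda>i\<in>I. pairing (D i) (j i) (data x i) (data y i), cod x + cod y)"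

lemma fam_eqI:
  assumes "fst x = fst y" "cod x = cod y" "data x \<in> extensional I" "data y \<in> extensional I"
    "\<And>i. i \<in> I \<Longrightarrow> data x i = data y i"
  shows "x = y"
  using assms extensionalityI[of "data x" I "data y"] by (simp add: prod_eq_iff)

text \<open>A set \<open>X\<close> of families that is closed under the operations of the product of the Lawvere theories
  \<open>D i\<close>, transported to the type \<open>'n\<close> along an injection \<open>enc\<close>.\<close>

locale fam_law =
  fixes I :: "'i set" and D :: "'i \<Rightarrow> (nat, 'm) cat" and j :: "'i \<Rightarrow> finmap \<Rightarrow> 'm"
    and X :: "(nat \<times> ('i \<Rightarrow> 'm) \<times> nat) set" and enc :: "nat \<times> ('i \<Rightarrow> 'm) \<times> nat \<Rightarrow> 'n"
  assumes D: "i \<in> I \<Longrightarrow> lawv (D i) (j i)"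
    and X_hom: "x \<in> X \<Longrightarrow> i \<in> I \<Longrightarrow> data x i \<in> hom (D i) (fst x) (cod x)"
    and X_ext: "x \<in> X \<Longrightarrow> data x \<in> extensional I"
    and X_fin: "f \<in> Arr FF \<Longrightarrow> fam_fin I j f \<in> X"
    and X_cmp: "x \<in> X \<Longrightarrow> y \<in> X \<Longrightarrow> cod x = fst y \<Longrightarrow> fam_cmp I D y x \<in> X"
    and X_pair: "x \<in> X \<Longrightarrow> y \<in> X \<Longrightarrow> fst x = fst y \<Longrightarrow> fam_pair I D j x y \<in> X"
    and enc_inj: "inj_on enc X"
begin

definition "dec = inv_into X enc"

definition fcat :: "(nat, 'n) cat" where
  "fcat = \<lparr>Obj = UNIV, Arr = enc ` X, Src = (\<lambda>u. fst (dec u)), Tgt = (\<lambda>u. cod (dec u)),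
     Idt = (\<lambda>n. enc (fam_fin I j (Idt FF n))), Cmp = (\<lambda>v u. enc (fam_cmp I D (dec v) (dec u)))\<rparr>"

definition "ffin f = enc (fam_fin I j f)"

abbreviation "proj i u \<equiv> data (dec u) i"

lemma dec [simp]: "x \<in> X \<Longrightarrow> dec (enc x) = x"
  using inv_into_f_f[OF enc_inj] by (simp add: dec_def)

lemma enc_eq: "x \<in> X \<Longrightarrow> y \<in> X \<Longrightarrow> enc x = enc y \<longleftrightarrow> x = y"
  using inj_on_eq_iff[OF enc_inj] .

lemma fcat_hom: "u \<in> hom fcat n k \<longleftrightarrow> (\<exists>x \<in> X. u = enc x \<and> fst x = n \<and> cod x = k)"
  by (auto simp: in_hom fcat_def)

lemma enc_hom: "x \<in> X \<Longrightarrow> enc x \<in> hom fcat (fst x) (cod x)"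
  unfolding fcat_hom by blast

lemma fcat_simps [simp]: "Obj fcat = UNIV" "Arr fcat = enc ` X"
  by (simp_all add: fcat_def)

lemma fcat_ops:
  "x \<in> X \<Longrightarrow> y \<in> X \<Longrightarrow> Cmp fcat (enc y) (enc x) = enc (fam_cmp I D y x)"
  "Idt fcat n = ffin (Idt FF n)"
  by (simp_all add: fcat_def ffin_def)

lemma faithful:
  assumes "u \<in> hom fcat n k" "v \<in> hom fcat n k" "\<And>i. i \<in> I \<Longrightarrow> proj i u = proj i v"
  shows "u = v"
  using assms X_ext fam_eqI unfolding fcat_hom by (metis dec)

lemma proj_hom: "i \<in> I \<Longrightarrow> u \<in> hom fcat n k \<Longrightarrow> proj i u \<in> hom (D i) n k"
  using X_hom unfolding fcat_hom by auto

lemma ffin_hom: "f \<in> hom FF n k \<Longrightarrow> ffin f \<in> hom fcat n k"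
  using enc_hom[OF X_fin, of f] by (simp add: in_hom[of f] ffin_def) (simp add: fam_fin_def)

lemma proj_fin: "i \<in> I \<Longrightarrow> f \<in> Arr FF \<Longrightarrow> proj i (ffin f) = j i f"
  using X_fin by (simp add: ffin_def) (simp add: fam_fin_def)

lemma fcat_category: "is_category fcat"
  and proj_functor: "\<And>i. i \<in> I \<Longrightarrow> is_functor fcat (D i) (\<lambda>n. n) (proj i)"
proof -
  have id: "Idt FF n \<in> hom FF n n" for n using cat_id[OF FF_category] by simp
  have A: "Src fcat f \<in> Obj fcat \<and> Tgt fcat f \<in> Obj fcat" for f by simp
  have B: "Idt fcat n \<in> hom fcat n n" for n unfolding fcat_ops by (rule ffin_hom[OF id])
  have C: "Cmp fcat g f \<in> hom fcat n l" if "f \<in> hom fcat n k" "g \<in> hom fcat k l" for f g n k l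
    using that X_cmp unfolding fcat_hom by (auto simp: fcat_ops) (auto simp: fam_cmp_def intro!: bexI)
  have O: "a \<in> Obj (D i)" if "i \<in> I" for i a using lawv.objs[OF D[OF that]] by simp
  have E: "is_category (D i)" if "i \<in> I" for i by (rule lawv.cat[OF D[OF that]])
  have F: "proj i (Idt fcat n) = Idt (D i) n" if "i \<in> I" for i n
    using proj_fin[OF that, of "Idt FF n"] lawv.fin_id[OF D[OF that]] id[of n]
    unfolding fcat_ops by (simp add: in_hom del: FF_simps(5))
  have H: "proj i (Cmp fcat g f) = Cmp (D i) (proj i g) (proj i f)"
    if i: "i \<in> I" and "f \<in> hom fcat n k" "g \<in> hom fcat k l" for i f g n k l
    using that X_cmp unfolding fcat_hom by (auto simp: fcat_ops) (auto simp: fam_cmp_def)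
  show "is_category fcat"
    by (rule reflect_category(1)[where I = I and D = D and Po = "\<lambda>i n. n" and Pa = proj])
      ((rule A B E O F; assumption) | rule A B | (rule C proj_hom H; assumption) | (erule (1) faithful, simp))+
  show "is_functor fcat (D i) (\<lambda>n. n) (proj i)" if "i \<in> I" for i
    by (rule reflect_category(2)[where I = I and D = D and Po = "\<lambda>i n. n" and Pa = proj])
      ((rule A B E O F; assumption) | rule A B that | (rule C proj_hom H; assumption) | (erule (1) faithful, simp))+
qed

lemma fcat_lawv: "lawv fcat ffin"
proof (rule reflect_lawv[OF fcat_category _ proj_functor faithful])
  fix f g n k l assume "f \<in> hom fcat n k" "g \<in> hom fcat n l"
  then obtain x y where xy: "x \<in> X" "f = enc x" "fst x = n" "cod x = k" "y \<in> X" "g = enc y" "fst y = n" "cod y = l"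
    unfolding fcat_hom by blast
  have p: "fam_pair I D j x y \<in> X" using X_pair xy by simp
  show "\<exists>h\<in>hom fcat n (k + l). \<forall>i\<in>I. proj i h = pairing (D i) (j i) (proj i f) (proj i g)"
  proof (rule bexI)
    show "enc (fam_pair I D j x y) \<in> hom fcat n (k + l)" using enc_hom[OF p] by (simp add: fam_pair_def xy)
    show "\<forall>i\<in>I. proj i (enc (fam_pair I D j x y)) = pairing (D i) (j i) (proj i f) (proj i g)"
      using p xy by simp (simp add: fam_pair_def)
  qed
qed (simp_all add: ffin_hom proj_fin D)

lemma proj_map: "i \<in> I \<Longrightarrow> lawv_map fcat ffin (D i) (j i) (proj i)"
  using proj_functor fcat_lawv D proj_fin by (simp add: lawv_map_def lawv_map_axioms_def)

lemma enc_pair: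
  assumes "x \<in> X" "y \<in> X" "fst x = fst y"
  shows "enc (fam_pair I D j x y) = pairing fcat ffin (enc x) (enc y)"
proof (rule faithful)
  note p = X_pair[OF assms]
  have y: "enc y \<in> hom fcat (fst x) (cod y)" using enc_hom[OF assms(2)] assms(3) by simp
  show "enc (fam_pair I D j x y) \<in> hom fcat (fst x) (cod x + cod y)"
    using enc_hom[OF p] by (simp add: fam_pair_def)
  show "pairing fcat ffin (enc x) (enc y) \<in> hom fcat (fst x) (cod x + cod y)"
    by (rule lawv.pairing(1)[OF fcat_lawv enc_hom[OF assms(1)] y])
  show "proj i (enc (fam_pair I D j x y)) = proj i (pairing fcat ffin (enc x) (enc y))" if "i \<in> I" for i
    using lawv_map.map_pairing[OF proj_map[OF that] enc_hom[OF assms(1)] y] p assms that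
    by simp (simp add: fam_pair_def)
qed

lemma reflect_prod_arr:
  assumes "u \<in> hom fcat k l" "v \<in> hom fcat m n" "w \<in> hom fcat (k + m) (l + n)"
    and "\<And>i. i \<in> I \<Longrightarrow> proj i w = prod_arr (D i) (j i) (proj i u) (proj i v)"
  shows "w = prod_arr fcat ffin u v"
  by (rule faithful[OF assms(3) lawv.prod_arr(1)[OF fcat_lawv assms(1,2)]])
    (simp add: assms(4) lawv_map.map_prod_arr[OF proj_map assms(1,2)])

text \<open>Composites and pairings are preserved by every functor under \<open>FF\<close>, so two such functors that agree
  on two cells agree on whatever is built from them.\<close>

lemma agree_cmp:
  assumes "lawv_map fcat ffin C k F" "lawv_map fcat ffin C k F'" "x \<in> X" "y \<in> X" "cod x = fst y"
    "F (enc x) = F' (enc x)" "F (enc y) = F' (enc y)"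
  shows "F (enc (fam_cmp I D y x)) = F' (enc (fam_cmp I D y x))"
proof -
  have "enc y \<in> hom fcat (cod x) (cod y)" using enc_hom[OF assms(4)] assms(5) by simp
  from lawv_map.cmp[OF assms(1) enc_hom[OF assms(3)] this] lawv_map.cmp[OF assms(2) enc_hom[OF assms(3)] this]
  show ?thesis using assms by (simp add: fcat_ops)
qed

lemma agree_pair:
  assumes "lawv_map fcat ffin C k F" "lawv_map fcat ffin C k F'" "x \<in> X" "y \<in> X" "fst x = fst y"
    "F (enc x) = F' (enc x)" "F (enc y) = F' (enc y)"
  shows "F (enc (fam_pair I D j x y)) = F' (enc (fam_pair I D j x y))"
proof -
  have "enc y \<in> hom fcat (fst x) (cod y)" using enc_hom[OF assms(4)] assms(5) by simp
  from lawv_map.map_pairing[OF assms(1) enc_hom[OF assms(3)] this] lawv_map.map_pairing[OF assms(2) enc_hom[OF assms(3)] this]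
  show ?thesis using assms by (simp add: enc_pair)
qed

end

section \<open>Free Lawvere 2-theories\<close>

text \<open>The generators are 1-cells \<open>g : d g \<rightarrow> c g\<close> and 2-cells \<open>x : s x \<rightarrow> t x\<close>, and \<open>(M i, a i, b i)\<close> for
  \<open>i \<in> I\<close> are 2-theories with an interpretation of the generators.  In the applications \<open>I\<close> consists of
  all 2-theories over \<open>'u\<close> with an interpretation that satisfies the desired relations.  The object constructed is
  the 2-theory generated by the generators inside the product of the \<open>M i\<close>.\<close>

locale free_family =
  fixes I :: "'i set" and M :: "'i \<Rightarrow> ('u, 'u cells) law2"
    and G1 :: "'g set" and d c :: "'g \<Rightarrow> nat" and a :: "'i \<Rightarrow> 'g \<Rightarrow> 'u"
    and G2 :: "'h set" and s t :: "'h \<Rightarrow> 'g" and b :: "'i \<Rightarrow> 'h \<Rightarrow> 'u cells"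
  assumes inf: "infinite (UNIV :: 'u set)"
    and M: "i \<in> I \<Longrightarrow> is_law2 (M i)"
    and a: "i \<in> I \<Longrightarrow> g \<in> G1 \<Longrightarrow> a i g \<in> hom (one (l2cat (M i))) (d g) (c g)"
    and b: "i \<in> I \<Longrightarrow> x \<in> G2 \<Longrightarrow> b i x \<in> hom (vert (l2cat (M i))) (a i (s x)) (a i (t x))"
    and st: "x \<in> G2 \<Longrightarrow> s x \<in> G1 \<and> t x \<in> G1 \<and> d (t x) = d (s x) \<and> c (t x) = c (s x)"
    and small: "G1 \<lesssim> (UNIV :: 'u set)" "G2 \<lesssim> (UNIV :: 'u set)"
begin

abbreviation "M1 i \<equiv> one (l2cat (M i))"
abbreviation "M2 i \<equiv> two (l2cat (M i))"
abbreviation "MV i \<equiv> vert (l2cat (M i))"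
abbreviation "m1 i \<equiv> l2fin (M i)"
abbreviation "m2 i f \<equiv> Idt (MV i) (l2fin (M i) f)"

definition "fam_idt x = (fst x, \<lambda>i\<in>I. Idt (MV i) (data x i), cod x)"
definition "fam_src x = (fst x, \<lambda>i\<in>I. Src (MV i) (data x i), cod x)"
definition "fam_tgt x = (fst x, \<lambda>i\<in>I. Tgt (MV i) (data x i), cod x)"
definition "fam_vcmp y x = (fst x, \<lambda>i\<in>I. Cmp (MV i) (data y i) (data x i), cod x)"
definition "fam_gen1 g = (d g, \<lambda>i\<in>I. a i g, c g)"
definition "fam_gen2 g = (d (s g), \<lambda>i\<in>I. b i g, c (s g))"

lemmas fam_defs = fam_fin_def fam_cmp_def fam_pair_def fam_idt_def fam_src_def fam_tgt_def fam_vcmp_def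
  fam_gen1_def fam_gen2_def

inductive_set cells1 :: "(nat \<times> ('i \<Rightarrow> 'u) \<times> nat) set" where
  fin: "x \<in> Arr FF \<Longrightarrow> fam_fin I m1 x \<in> cells1"
| gen: "g \<in> G1 \<Longrightarrow> fam_gen1 g \<in> cells1"
| cmp: "x \<in> cells1 \<Longrightarrow> y \<in> cells1 \<Longrightarrow> cod x = fst y \<Longrightarrow> fam_cmp I M1 y x \<in> cells1"
| pair: "x \<in> cells1 \<Longrightarrow> y \<in> cells1 \<Longrightarrow> fst x = fst y \<Longrightarrow> fam_pair I M1 m1 x y \<in> cells1"

inductive_set cells2 :: "(nat \<times> ('i \<Rightarrow> 'u cells) \<times> nat) set" where
  idt: "x \<in> cells1 \<Longrightarrow> fam_idt x \<in> cells2"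
| gen: "g \<in> G2 \<Longrightarrow> fam_gen2 g \<in> cells2"
| cmp: "x \<in> cells2 \<Longrightarrow> y \<in> cells2 \<Longrightarrow> cod x = fst y \<Longrightarrow> fam_cmp I M2 y x \<in> cells2"
| pair: "x \<in> cells2 \<Longrightarrow> y \<in> cells2 \<Longrightarrow> fst x = fst y \<Longrightarrow> fam_pair I M2 m2 x y \<in> cells2"
| vcmp: "x \<in> cells2 \<Longrightarrow> y \<in> cells2 \<Longrightarrow> fam_tgt x = fam_src y \<Longrightarrow> fam_vcmp y x \<in> cells2"

lemma cells1_hom: "x \<in> cells1 \<Longrightarrow> i \<in> I \<Longrightarrow> data x i \<in> hom (M1 i) (fst x) (cod x)"
proof (induction rule: cells1.induct)
  case (fin x)
  interpret law2 "M i" by unfold_locales (rule M[OF fin(2)])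
  show ?case using L1.fin_hom[OF arr_hom[OF fin(1)]] fin by (simp add: fam_defs)
next
  case (gen g) then show ?case using a by (simp add: fam_defs)
next
  case (cmp x y)
  interpret law2 "M i" by unfold_locales (rule M[OF cmp(6)])
  show ?case using cmp L1.cmp_hom by (simp add: fam_defs)
next
  case (pair x y)
  interpret law2 "M i" by unfold_locales (rule M[OF pair(6)])
  show ?case using pair L1.pairing(1) by (simp add: fam_defs)
qed

lemma cells1_ext: "x \<in> cells1 \<Longrightarrow> data x \<in> extensional I"
  by (induction rule: cells1.induct) (simp_all add: fam_defs extensional_def)

lemma cells2_hom: "x \<in> cells2 \<Longrightarrow> i \<in> I \<Longrightarrow> data x i \<in> hom (M2 i) (fst x) (cod x)"
proof (induction rule: cells2.induct)
  case (idt x)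
  interpret law2 "M i" by unfold_locales (rule M[OF idt(2)])
  show ?case using cells1_hom[OF idt] idt idt_hom by (simp add: fam_defs)
next
  case (gen g)
  interpret law2 "M i" by unfold_locales (rule M[OF gen(2)])
  show ?case using vhom_two(1)[OF b a] gen st[OF gen(1)] by (simp add: fam_defs)
next
  case (cmp x y)
  interpret law2 "M i" by unfold_locales (rule M[OF cmp(6)])
  show ?case using cmp L2.cmp_hom by (simp add: fam_defs)
next
  case (pair x y)
  interpret law2 "M i" by unfold_locales (rule M[OF pair(6)])
  show ?case using pair L2.pairing(1) by (simp add: fam_defs)
next
  case (vcmp x y)
  interpret law2 "M i" by unfold_locales (rule M[OF vcmp(6)])
  have i: "i \<in> I" by fact
  have "Tgt CV (data x i) = Src CV (data y i)" "fst y = fst x" "cod y = cod x"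
    using vcmp(3) i by (auto simp: fam_defs dest: fun_cong[of _ _ i])
  then have "Cmp CV (data y i) (data x i) \<in> hom CV (Src CV (data x i)) (Tgt CV (data y i))"
    using cat_cmp[OF vert_cat two_vhom(1)[OF vcmp(4)[OF i]]] two_vhom(1)[OF vcmp(5)[OF i]] by simp
  from vhom_two(1)[OF this two_vhom(2)[OF vcmp(4)[OF i]]] show ?case using i by (simp add: fam_defs)
qed

lemma cells2_ext: "x \<in> cells2 \<Longrightarrow> data x \<in> extensional I"
  by (induction rule: cells2.induct) (simp_all add: fam_defs extensional_def)

lemma vcell:
  assumes "x \<in> cells2" "i \<in> I"
  shows "data x i \<in> hom (MV i) (data (fam_src x) i) (data (fam_tgt x) i)"
proof -
  interpret law2 "M i" by unfold_locales (rule M[OF assms(2)])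
  show ?thesis using two_vhom(1)[OF cells2_hom[OF assms]] assms(2) by (simp add: fam_defs)
qed

lemma idt_simps:
  assumes "x \<in> cells1"
  shows "fam_src (fam_idt x) = x" "fam_tgt (fam_idt x) = x"
proof -
  have "Src (MV i) (Idt (MV i) (data x i)) = data x i"
    "Tgt (MV i) (Idt (MV i) (data x i)) = data x i" if "i \<in> I" for i
  proof -
    interpret law2 "M i" by unfold_locales (rule M[OF that])
    show "Src CV (Idt CV (data x i)) = data x i" "Tgt CV (Idt CV (data x i)) = data x i"
      using idt_vhom[of "data x i"] cells1_hom[OF assms that] by (auto simp: in_hom)
  qed
  then show "fam_src (fam_idt x) = x" "fam_tgt (fam_idt x) = x"
    using cells1_ext[OF assms] by (auto intro!: fam_eqI simp: fam_defs extensional_def)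
qed

lemma vcmp_simps:
  assumes "x \<in> cells2" "y \<in> cells2" "fam_tgt x = fam_src y"
  shows "fam_src (fam_vcmp y x) = fam_src x" "fam_tgt (fam_vcmp y x) = fam_tgt y"
proof -
  have dc: "fst y = fst x" "cod y = cod x" using assms(3) by (auto simp: fam_defs)
  have "Src (MV i) (data (fam_vcmp y x) i) = data (fam_src x) i"
    "Tgt (MV i) (data (fam_vcmp y x) i) = data (fam_tgt y) i" if i: "i \<in> I" for i
  proof -
    interpret law2 "M i" by unfold_locales (rule M[OF i])
    show "Src CV (data (fam_vcmp y x) i) = data (fam_src x) i" "Tgt CV (data (fam_vcmp y x) i) = data (fam_tgt y) i"
      using cat_cmp[OF vert_cat vcell[OF assms(1) i]] vcell[OF assms(2) i] i
      by (auto simp: in_hom assms(3) fam_vcmp_def)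
  qed
  then show "fam_src (fam_vcmp y x) = fam_src x" "fam_tgt (fam_vcmp y x) = fam_tgt y"
    using dc by (auto intro!: fam_eqI simp: fam_defs extensional_def)
qed

text \<open>Closing the 1-cells under sources and targets adds nothing: by induction, the source of a generated 2-cell is built from the
  sources of the generators.\<close>

lemma src_tgt_cells: "x \<in> cells2 \<Longrightarrow> fam_src x \<in> cells1 \<and> fam_tgt x \<in> cells1"
proof (induction rule: cells2.induct)
  case (idt x) then show ?case by (simp add: idt_simps)
next
  case (gen g)
  have "fam_src (fam_gen2 g) = fam_gen1 (s g)" "fam_tgt (fam_gen2 g) = fam_gen1 (t g)"
    using st[OF gen] b[OF _ gen] by (auto intro!: fam_eqI simp: fam_defs in_hom)
  then show ?case using st[OF gen] cells1.gen by simp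
next
  case (cmp x y)
  have "Src (MV i) (Cmp (M2 i) (data y i) (data x i)) =
      Cmp (M1 i) (data (fam_src y) i) (data (fam_src x) i)"
    "Tgt (MV i) (Cmp (M2 i) (data y i) (data x i)) =
      Cmp (M1 i) (data (fam_tgt y) i) (data (fam_tgt x) i)" if i: "i \<in> I" for i
  proof -
    interpret law2 "M i" by unfold_locales (rule M[OF i])
    have "data y i \<in> hom C2 (cod x) (cod y)" using cells2_hom[OF cmp(2) i] cmp(3) by simp
    then show "Src CV (Cmp C2 (data y i) (data x i)) = Cmp C1 (data (fam_src y) i) (data (fam_src x) i)"
      "Tgt CV (Cmp C2 (data y i) (data x i)) = Cmp C1 (data (fam_tgt y) i) (data (fam_tgt x) i)"
      using functor_cmp[OF src_functor cells2_hom[OF cmp(1) i]] functor_cmp[OF tgt_functor cells2_hom[OF cmp(1) i]] i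
      by (auto simp: fam_defs)
  qed
  then have "fam_src (fam_cmp I M2 y x) = fam_cmp I M1 (fam_src y) (fam_src x)"
    "fam_tgt (fam_cmp I M2 y x) = fam_cmp I M1 (fam_tgt y) (fam_tgt x)"
    by (auto intro!: fam_eqI simp: fam_defs)
  moreover have "cod (fam_src x) = fst (fam_src y)" "cod (fam_tgt x) = fst (fam_tgt y)"
    using cmp(3) by (simp_all add: fam_defs)
  ultimately show ?case
    using cmp cells1.cmp[of "fam_src x" "fam_src y"] cells1.cmp[of "fam_tgt x" "fam_tgt y"] by simp
next
  case (pair x y)
  have "Src (MV i) (data (fam_pair I M2 m2 x y) i) = data (fam_pair I M1 m1 (fam_src x) (fam_src y)) i"
    "Tgt (MV i) (data (fam_pair I M2 m2 x y) i) = data (fam_pair I M1 m1 (fam_tgt x) (fam_tgt y)) i" if i: "i \<in> I" for i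
  proof -
    interpret law2 "M i" by unfold_locales (rule M[OF i])
    have "data y i \<in> hom C2 (fst x) (cod y)" using cells2_hom[OF pair(2) i] pair(3) by simp
    then show "Src CV (data (fam_pair I M2 m2 x y) i) = data (fam_pair I M1 m1 (fam_src x) (fam_src y)) i"
      "Tgt CV (data (fam_pair I M2 m2 x y) i) = data (fam_pair I M1 m1 (fam_tgt x) (fam_tgt y)) i"
      using lawv_map.map_pairing[OF src_map cells2_hom[OF pair(1) i]]
        lawv_map.map_pairing[OF tgt_map cells2_hom[OF pair(1) i]] i
      by (auto simp: fam_defs)
  qed
  then have "fam_src (fam_pair I M2 m2 x y) = fam_pair I M1 m1 (fam_src x) (fam_src y)"
    "fam_tgt (fam_pair I M2 m2 x y) = fam_pair I M1 m1 (fam_tgt x) (fam_tgt y)"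
    by (auto intro!: fam_eqI simp: fam_defs)
  moreover have "fst (fam_src x) = fst (fam_src y)" "fst (fam_tgt x) = fst (fam_tgt y)"
    using pair(3) by (simp_all add: fam_defs)
  ultimately show ?case
    using pair cells1.pair[of "fam_src x" "fam_src y"] cells1.pair[of "fam_tgt x" "fam_tgt y"] by simp
next
  case (vcmp x y) then show ?case by (simp add: vcmp_simps)
qed

text \<open>The generated cells are values of trees whose leaves are the generators and the countably many arrows of
  \<open>FF\<close>.\<close>

lemma cells1_small: "cells1 \<lesssim> (UNIV :: 'u set)"
proof -
  let ?B = "fam_fin I m1 ` Arr FF \<union> fam_gen1 ` G1"
  let ?f = "\<lambda>n x y. if n = (0::nat) then fam_cmp I M1 y x else fam_pair I M1 m1 x y"
  have "?B \<lesssim> (UNIV :: 'u set)"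
    using lepoll_trans[OF image_lepoll countable_lepoll_infinite[OF FF_countable inf]]
      lepoll_trans[OF image_lepoll small(1)] by (intro Un_lepoll_infinite[OF inf])
  then have "op_closure ?f ?B \<lesssim> (UNIV :: 'u set)" by (rule op_closure_lepoll[OF inf])
  moreover have "x \<in> op_closure ?f ?B" if "x \<in> cells1" for x
    using that
  proof induction
    case (cmp x y) then show ?case using op_closure.step[of x ?f ?B y 0] by simp
  next
    case (pair x y) then show ?case using op_closure.step[of x ?f ?B y 1] by simp
  qed (auto intro: op_closure.base)
  ultimately show ?thesis using lepoll_trans[OF subset_imp_lepoll] by (meson subsetI)
qed

lemma cells2_small: "cells2 \<lesssim> (UNIV :: 'u set)"
proof -
  let ?B = "fam_idt ` cells1 \<union> fam_gen2 ` G2"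
  let ?f = "\<lambda>n x y. if n = (0::nat) then fam_cmp I M2 y x else if n = 1 then fam_pair I M2 m2 x y else fam_vcmp y x"
  have "?B \<lesssim> (UNIV :: 'u set)"
    using lepoll_trans[OF image_lepoll cells1_small] lepoll_trans[OF image_lepoll small(2)]
    by (intro Un_lepoll_infinite[OF inf])
  then have "op_closure ?f ?B \<lesssim> (UNIV :: 'u set)" by (rule op_closure_lepoll[OF inf])
  moreover have "x \<in> op_closure ?f ?B" if "x \<in> cells2" for x
    using that
  proof induction
    case (cmp x y) then show ?case using op_closure.step[of x ?f ?B y 0] by simp
  next
    case (pair x y) then show ?case using op_closure.step[of x ?f ?B y 1] by simp
  next
    case (vcmp x y) then show ?case using op_closure.step[of x ?f ?B y 2] by simp
  qed (auto intro: op_closure.base)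
  ultimately show ?thesis using lepoll_trans[OF subset_imp_lepoll] by (meson subsetI)
qed

definition enc1 :: "nat \<times> ('i \<Rightarrow> 'u) \<times> nat \<Rightarrow> 'u" where
  "enc1 = (SOME e. inj_on e cells1)"

definition enc2 :: "nat \<times> ('i \<Rightarrow> 'u cells) \<times> nat \<Rightarrow> 'u cells" where
  "enc2 = (SOME e. inj_on e cells2)"

lemma enc1_inj: "inj_on enc1 cells1"
proof -
  have "\<exists>e :: _ \<Rightarrow> 'u. inj_on e cells1" using cells1_small by (auto simp: lepoll_def)
  then show ?thesis unfolding enc1_def by (rule someI_ex)
qed

lemma enc2_inj: "inj_on enc2 cells2"
proof -
  obtain e :: "_ \<Rightarrow> 'u" where "inj_on e cells2" using cells2_small by (auto simp: lepoll_def)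
  then have "inj_on (\<lambda>x. (e x, e x)) cells2" by (auto simp: inj_on_def)
  then have "\<exists>e :: _ \<Rightarrow> 'u cells. inj_on e cells2" by blast
  then show ?thesis unfolding enc2_def by (rule someI_ex)
qed

end

sublocale free_family \<subseteq> A: fam_law I M1 m1 cells1 enc1
proof (rule fam_law.intro)
  show "lawv (M1 i) (m1 i)" if "i \<in> I" for i using M[OF that] by (simp add: law2_iff)
qed (use cells1_hom cells1_ext enc1_inj in \<open>auto intro: cells1.intros\<close>)

sublocale free_family \<subseteq> B: fam_law I M2 m2 cells2 enc2
proof (rule fam_law.intro)
  show "lawv (M2 i) (m2 i)" if "i \<in> I" for i using M[OF that] by (simp add: law2_iff)
  show "fam_fin I m2 f \<in> cells2" if "f \<in> Arr FF" for f
  proof -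
    have "fam_fin I m2 f = fam_idt (fam_fin I m1 f)" by (auto simp: fam_defs)
    then show ?thesis using cells2.idt[OF cells1.fin[OF that]] by simp
  qed
qed (use cells2_hom cells2_ext enc2_inj in \<open>auto intro: cells2.intros\<close>)

context free_family begin

abbreviation "free_one \<equiv> A.fcat"
abbreviation "free_two \<equiv> B.fcat"
abbreviation "proj1 \<equiv> A.proj"
abbreviation "proj2 \<equiv> B.proj"

definition free_vert :: "('u, 'u cells) cat" where
  "free_vert = \<lparr>Obj = enc1 ` cells1, Arr = enc2 ` cells2,
     Src = (\<lambda>u. enc1 (fam_src (B.dec u))), Tgt = (\<lambda>u. enc1 (fam_tgt (B.dec u))),
     Idt = (\<lambda>u. enc2 (fam_idt (A.dec u))), Cmp = (\<lambda>v u. enc2 (fam_vcmp (B.dec v) (B.dec u)))\<rparr>"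

definition free_law2 :: "('u, 'u cells) law2" where
  "free_law2 = \<lparr>l2cat = \<lparr>one = free_one, two = free_two, vert = free_vert\<rparr>, l2fin = A.ffin\<rparr>"

lemma vert_hom: "u \<in> hom free_vert f g \<longleftrightarrow> (\<exists>x \<in> cells2. u = enc2 x \<and> f = enc1 (fam_src x) \<and> g = enc1 (fam_tgt x))"
  by (auto simp: in_hom free_vert_def)

lemma vert_two: "u \<in> hom free_vert f g \<Longrightarrow> u \<in> hom free_two (fst (A.dec f)) (cod (A.dec f)) \<and>
    f \<in> hom free_one (fst (A.dec f)) (cod (A.dec f)) \<and> g \<in> hom free_one (fst (A.dec f)) (cod (A.dec f))"
  using src_tgt_cells unfolding vert_hom A.fcat_hom B.fcat_hom by (force simp: fam_src_def fam_tgt_def)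

lemma vert_ops:
  "x \<in> cells2 \<Longrightarrow> y \<in> cells2 \<Longrightarrow> Cmp free_vert (enc2 y) (enc2 x) = enc2 (fam_vcmp y x)"
  "z \<in> cells1 \<Longrightarrow> Idt free_vert (enc1 z) = enc2 (fam_idt z)"
  "x \<in> cells2 \<Longrightarrow> Src free_vert (enc2 x) = enc1 (fam_src x)"
  "x \<in> cells2 \<Longrightarrow> Tgt free_vert (enc2 x) = enc1 (fam_tgt x)"
  by (simp_all add: free_vert_def)

lemma vert_cmp:
  assumes "f \<in> hom free_vert u v" "g \<in> hom free_vert v w"
  obtains x y where "x \<in> cells2" "y \<in> cells2" "f = enc2 x" "g = enc2 y" "fam_tgt x = fam_src y"
    "u = enc1 (fam_src x)" "w = enc1 (fam_tgt y)"
  using assms src_tgt_cells A.enc_eq unfolding vert_hom by metis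

lemma vert_faithful:
  assumes "f \<in> hom free_vert u v" "g \<in> hom free_vert u v" "\<And>i. i \<in> I \<Longrightarrow> proj2 i f = proj2 i g"
  shows "f = g"
  using B.faithful[of f _ _ g] vert_two assms by blast

lemma free_vert_category: "is_category free_vert"
  and proj_vert_functor: "\<And>i. i \<in> I \<Longrightarrow> is_functor free_vert (MV i) (proj1 i) (proj2 i)"
proof -
  have objI: "proj1 i a \<in> Obj (MV i)" if "i \<in> I" "a \<in> Obj free_vert" for i a
    using M[OF that(1)] cells1_hom[of _ i] that by (auto simp: law2_iff is_cat2_def free_vert_def in_hom)
  have A: "Src free_vert f \<in> Obj free_vert \<and> Tgt free_vert f \<in> Obj free_vert" if "f \<in> Arr free_vert" for f
    using that src_tgt_cells by (auto simp: free_vert_def)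
  have B: "Idt free_vert a \<in> hom free_vert a a" if ob: "a \<in> Obj free_vert" for a
  proof -
    obtain x where x: "x \<in> cells1" "a = enc1 x" using ob by (auto simp: free_vert_def)
    show ?thesis unfolding vert_hom using x cells2.idt[OF x(1)] by (auto simp: vert_ops idt_simps)
  qed
  have D: "Cmp free_vert g f \<in> hom free_vert a c" if h: "f \<in> hom free_vert a b" "g \<in> hom free_vert b c" for f g a b c
  proof -
    obtain x y where xy: "x \<in> cells2" "y \<in> cells2" "f = enc2 x" "g = enc2 y" "fam_tgt x = fam_src y"
      "a = enc1 (fam_src x)" "c = enc1 (fam_tgt y)" by (rule vert_cmp[OF h])
    show ?thesis unfolding vert_hom using xy cells2.vcmp[OF xy(1,2,5)] vcmp_simps[OF xy(1,2,5)]
      by (auto simp: vert_ops)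
  qed
  have E: "is_category (MV i)" if "i \<in> I" for i
    using M[OF that] by (simp add: law2_iff is_cat2_def)
  have F: "proj2 i (Idt free_vert a) = Idt (MV i) (proj1 i a)" if ob: "i \<in> I" "a \<in> Obj free_vert" for i a
  proof -
    obtain x where x: "x \<in> cells1" "a = enc1 x" using ob(2) by (auto simp: free_vert_def)
    show ?thesis using x cells2.idt[OF x(1)] ob(1) by (simp add: vert_ops) (simp add: fam_idt_def)
  qed
  have G: "proj2 i f \<in> hom (MV i) (proj1 i a) (proj1 i b)" if "i \<in> I" "f \<in> hom free_vert a b" for i f a b
    using that vcell src_tgt_cells unfolding vert_hom by auto
  have H: "proj2 i (Cmp free_vert g f) = Cmp (MV i) (proj2 i g) (proj2 i f)"
    if i: "i \<in> I" and h: "f \<in> hom free_vert a b" "g \<in> hom free_vert b c" for i f g a b c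
  proof -
    obtain x y where xy: "x \<in> cells2" "y \<in> cells2" "f = enc2 x" "g = enc2 y" "fam_tgt x = fam_src y"
      "a = enc1 (fam_src x)" "c = enc1 (fam_tgt y)" by (rule vert_cmp[OF h])
    show ?thesis using xy cells2.vcmp[OF xy(1,2,5)] i by (simp add: vert_ops) (simp add: fam_vcmp_def)
  qed
  show "is_category free_vert"
    by (rule reflect_category(1)[where I = I and D = "\<lambda>i. vert (l2cat (M i))" and Po = proj1 and Pa = proj2])
      ((rule A B E objI F; assumption) | rule A B | (rule D; assumption) | (rule G H; assumption) | (erule (1) vert_faithful, simp))+
  show "is_functor free_vert (MV i) (proj1 i) (proj2 i)" if "i \<in> I" for i
    by (rule reflect_category(2)[where I = I and D = "\<lambda>i. vert (l2cat (M i))" and Po = proj1 and Pa = proj2])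
      ((rule A B E objI F; assumption) | rule A B that | (rule D; assumption) | (rule G H; assumption) | (erule (1) vert_faithful, simp))+
qed

abbreviation "free_cat2 \<equiv> \<lparr>one = free_one, two = free_two, vert = free_vert\<rparr>"

text \<open>All axioms are equations between cells and therefore follow from those of the \<open>M i\<close>.\<close>

lemma free_cat2: "is_cat2 free_cat2"
proof (rule is_cat2I; simp only: cat2.simps)
  show "is_category free_one" "is_category free_two" "is_category free_vert"
    by (rule A.fcat_category B.fcat_category free_vert_category)+
  show "Obj free_one = UNIV" "Obj free_two = UNIV" "Obj free_vert = Arr free_one" "Arr free_vert = Arr free_two"
    by (simp_all add: free_vert_def)
  have two: "\<exists>x \<in> cells2. f = enc2 x \<and> fst x = n \<and> cod x = k" if "f \<in> hom free_two n k" for f n k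
    using that by (simp add: B.fcat_hom)
  have P: "proj1 i (Src free_vert f) = Src (MV i) (proj2 i f)"
    "proj1 i (Tgt free_vert f) = Tgt (MV i) (proj2 i f)" if "i \<in> I" "f \<in> Arr free_two" for i f
    using that src_tgt_cells by (auto simp: vert_ops) (simp_all add: fam_src_def fam_tgt_def)
  show "is_functor free_two free_one (\<lambda>n. n) (Src free_vert)"
  proof (rule reflect_functor[OF B.fcat_category A.fcat_category A.proj_functor A.faithful])
    show "Src free_vert f \<in> hom free_one n k" if "f \<in> hom free_two n k" for f n k
      using that src_tgt_cells unfolding B.fcat_hom A.fcat_hom by (auto simp: vert_ops intro!: bexI) (simp_all add: fam_src_def)
    fix i assume i: "i \<in> I"
    interpret law2 "M i" by unfold_locales (rule M[OF i])
    show "is_functor free_two C1 (\<lambda>n. n) (\<lambda>f. proj1 i (Src free_vert f))"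
      by (rule functor_cong[OF functor_compose[OF B.proj_functor[OF i] src_functor]]) (simp_all add: P[OF i])
  qed simp_all
  show "is_functor free_two free_one (\<lambda>n. n) (Tgt free_vert)"
  proof (rule reflect_functor[OF B.fcat_category A.fcat_category A.proj_functor A.faithful])
    show "Tgt free_vert f \<in> hom free_one n k" if "f \<in> hom free_two n k" for f n k
      using that src_tgt_cells unfolding B.fcat_hom A.fcat_hom by (auto simp: vert_ops intro!: bexI) (simp_all add: fam_tgt_def)
    fix i assume i: "i \<in> I"
    interpret law2 "M i" by unfold_locales (rule M[OF i])
    show "is_functor free_two C1 (\<lambda>n. n) (\<lambda>f. proj1 i (Tgt free_vert f))"
      by (rule functor_cong[OF functor_compose[OF B.proj_functor[OF i] tgt_functor]]) (simp_all add: P[OF i])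
  qed simp_all
  have Q: "proj2 i (Idt free_vert f) = Idt (MV i) (proj1 i f)" if "i \<in> I" "f \<in> Arr free_one" for i f
    using functor_id[OF proj_vert_functor[OF that(1)], of f] that(2) by (simp add: free_vert_def)
  show "is_functor free_one free_two (\<lambda>n. n) (Idt free_vert)"
  proof (rule reflect_functor[OF A.fcat_category B.fcat_category B.proj_functor B.faithful])
    show "Idt free_vert f \<in> hom free_two n k" if "f \<in> hom free_one n k" for f n k
      using that cells2.idt unfolding B.fcat_hom A.fcat_hom by (auto simp: vert_ops intro!: bexI) (simp_all add: fam_idt_def)
    fix i assume i: "i \<in> I"
    interpret law2 "M i" by unfold_locales (rule M[OF i])
    show "is_functor free_one C2 (\<lambda>n. n) (\<lambda>f. proj2 i (Idt free_vert f))"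
      by (rule functor_cong[OF functor_compose[OF A.proj_functor[OF i] idt_functor]]) (simp_all add: Q[OF i])
  qed simp_all
  fix \<alpha> \<beta> \<gamma> \<delta> f g h f' g' h' n k l
  assume v: "\<alpha> \<in> hom free_vert f g" "\<beta> \<in> hom free_vert g h" "\<gamma> \<in> hom free_vert f' g'" "\<delta> \<in> hom free_vert g' h'"
    and t: "\<alpha> \<in> hom free_two n k" "\<beta> \<in> hom free_two n k" "\<gamma> \<in> hom free_two k l" "\<delta> \<in> hom free_two k l"
  have ty: "Cmp free_vert y x \<in> hom free_two n k"
    if h: "x \<in> hom free_vert f g" "y \<in> hom free_vert g h" "x \<in> hom free_two n k" for x y f g h n k
  proof -
    obtain p q where pq: "p \<in> cells2" "q \<in> cells2" "x = enc2 p" "y = enc2 q" "fam_tgt p = fam_src q"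
      by (rule vert_cmp[OF h(1,2)])
    have "fst p = n" "cod p = k" using h(3) pq(1,3) B.enc_eq[OF pq(1)] unfolding B.fcat_hom by auto
    then show ?thesis unfolding B.fcat_hom using cells2.vcmp[OF pq(1,2,5)] pq
      by (auto simp: vert_ops intro!: bexI[of _ "fam_vcmp q p"]) (simp_all add: fam_vcmp_def)
  qed
  note ba = ty[OF v(1,2) t(1)] and dg = ty[OF v(3,4) t(3)]
  obtain a b where ab: "a \<in> cells2" "b \<in> cells2" "\<alpha> = enc2 a" "\<beta> = enc2 b" "fam_tgt a = fam_src b"
    by (rule vert_cmp[OF v(1,2)])
  obtain p q where pq: "p \<in> cells2" "q \<in> cells2" "\<gamma> = enc2 p" "\<delta> = enc2 q" "fam_tgt p = fam_src q"
    by (rule vert_cmp[OF v(3,4)])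
  have dc: "cod a = fst p" "fst b = fst a" "cod b = cod a" "fst q = fst p" "cod q = cod p"
    using t ab pq B.enc_eq unfolding B.fcat_hom by auto
  have c1: "fam_cmp I M2 p a \<in> cells2" and c2: "fam_cmp I M2 q b \<in> cells2"
    using cells2.cmp[OF ab(1) pq(1)] cells2.cmp[OF ab(2) pq(2)] dc by auto
  have eq: "fam_tgt (fam_cmp I M2 p a) = fam_src (fam_cmp I M2 q b)"
  proof (rule fam_eqI)
    fix i assume i: "i \<in> I"
    interpret law2 "M i" by unfold_locales (rule M[OF i])
    have 1: "data a i \<in> hom C2 (fst a) (fst p)" "data b i \<in> hom C2 (fst a) (fst p)"
      "data p i \<in> hom C2 (fst p) (cod p)" "data q i \<in> hom C2 (fst p) (cod p)"
      using cells2_hom[OF ab(1) i] cells2_hom[OF ab(2) i] cells2_hom[OF pq(1) i] cells2_hom[OF pq(2) i] dc by simp_all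
    have "Tgt CV (data a i) = Src CV (data b i)" "Tgt CV (data p i) = Src CV (data q i)"
      using ab(5) pq(5) i by (auto simp: fam_src_def fam_tgt_def dest: fun_cong[of _ _ i])
    then show "data (fam_tgt (fam_cmp I M2 p a)) i = data (fam_src (fam_cmp I M2 q b)) i"
      using functor_cmp[OF tgt_functor 1(1,3)] functor_cmp[OF src_functor 1(2,4)] i by (simp add: fam_defs)
  qed (simp_all add: fam_defs dc)
  have R: "Cmp free_vert (Cmp free_two \<delta> \<beta>) (Cmp free_two \<gamma> \<alpha>) = enc2 (fam_vcmp (fam_cmp I M2 q b) (fam_cmp I M2 p a))"
    using ab pq c1 c2 by (simp add: B.fcat_ops vert_ops)
  have L: "Cmp free_two (Cmp free_vert \<delta> \<gamma>) (Cmp free_vert \<beta> \<alpha>) = enc2 (fam_cmp I M2 (fam_vcmp q p) (fam_vcmp b a))"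
    using ab pq cells2.vcmp by (simp add: B.fcat_ops vert_ops)
  have "fam_cmp I M2 (fam_vcmp q p) (fam_vcmp b a) = fam_vcmp (fam_cmp I M2 q b) (fam_cmp I M2 p a)"
  proof (rule fam_eqI)
    fix i assume i: "i \<in> I"
    interpret law2 "M i" by unfold_locales (rule M[OF i])
    have "data (fam_src a) i \<in> hom C1 (fst a) (cod a)" "data (fam_src p) i \<in> hom C1 (cod a) (cod p)"
      using cells1_hom[OF conjunct1[OF src_tgt_cells[OF ab(1)]] i]
        cells1_hom[OF conjunct1[OF src_tgt_cells[OF pq(1)]] i] i dc
      by (auto simp: fam_src_def)
    from interchange[OF vcell[OF ab(1) i] _ vcell[OF pq(1) i] _ this] vcell[OF ab(2) i] vcell[OF pq(2) i]
    show "data (fam_cmp I M2 (fam_vcmp q p) (fam_vcmp b a)) i = data (fam_vcmp (fam_cmp I M2 q b) (fam_cmp I M2 p a)) i"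
      using i ab(5) pq(5) by (simp add: fam_cmp_def fam_vcmp_def)
  qed (simp_all add: fam_defs dc)
  then show "Cmp free_two (Cmp free_vert \<delta> \<gamma>) (Cmp free_vert \<beta> \<alpha>) =
    Cmp free_vert (Cmp free_two \<delta> \<beta>) (Cmp free_two \<gamma> \<alpha>)" using L R by simp
qed


lemma free_simps [simp]:
  "one (l2cat free_law2) = free_one" "two (l2cat free_law2) = free_two" "vert (l2cat free_law2) = free_vert"
  "l2fin free_law2 = A.ffin"
  by (simp_all add: free_law2_def)

lemma idt_ffin: "f \<in> Arr FF \<Longrightarrow> Idt free_vert (A.ffin f) = B.ffin f"
  using vert_ops(2)[OF cells1.fin] by (simp add: A.ffin_def B.ffin_def) (simp add: fam_fin_def fam_idt_def restrict_def cong: if_cong)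

lemma law2_free: "is_law2 free_law2"
  unfolding law2_iff free_simps
  using free_cat2 A.fcat_lawv lawv_cong[OF B.fcat_lawv idt_ffin] by (simp add: free_law2_def)

sublocale F: law2 free_law2
  by unfold_locales (rule law2_free)

lemma proj_map: "i \<in> I \<Longrightarrow> law2_map free_law2 (M i) (proj1 i, proj2 i)"
proof -
  assume i: "i \<in> I"
  interpret law2 "M i" by unfold_locales (rule M[OF i])
  show ?thesis
    by unfold_locales
      (use A.proj_functor[OF i] B.proj_functor[OF i] proj_vert_functor[OF i] A.proj_fin[OF i] in
        \<open>simp_all add: twofunctor_iff\<close>)
qed

definition "gen1 g = enc1 (fam_gen1 g)"
definition "gen2 x = enc2 (fam_gen2 x)"

lemma gen1_hom: "g \<in> G1 \<Longrightarrow> gen1 g \<in> hom free_one (d g) (c g)"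
  unfolding A.fcat_hom gen1_def by (rule bexI[OF _ cells1.gen]) (simp_all add: fam_gen1_def)

lemma gen2_hom: "x \<in> G2 \<Longrightarrow> gen2 x \<in> hom free_vert (gen1 (s x)) (gen1 (t x))"
proof -
  assume x: "x \<in> G2"
  have "fam_src (fam_gen2 x) = fam_gen1 (s x)" "fam_tgt (fam_gen2 x) = fam_gen1 (t x)"
    using st[OF x] b[OF _ x] by (auto intro!: fam_eqI simp: fam_defs in_hom extensional_def)
  then show ?thesis unfolding vert_hom gen1_def gen2_def using cells2.gen[OF x] by auto
qed

lemma proj_gen:
  "i \<in> I \<Longrightarrow> g \<in> G1 \<Longrightarrow> proj1 i (gen1 g) = a i g"
  "i \<in> I \<Longrightarrow> x \<in> G2 \<Longrightarrow> proj2 i (gen2 x) = b i x"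
  using cells1.gen[of g] cells2.gen[of x] unfolding gen1_def gen2_def
  by (simp_all) (simp_all add: fam_gen1_def fam_gen2_def)

text \<open>Induction on the generation of cells: 2-functors under \<open>FF\<close> preserve identities, both compositions and
  pairings.\<close>

lemma free_unique:
  assumes "law2_map free_law2 N F" "law2_map free_law2 N F'"
    and g1: "\<And>g. g \<in> G1 \<Longrightarrow> fst F (gen1 g) = fst F' (gen1 g)"
    and g2: "\<And>x. x \<in> G2 \<Longrightarrow> snd F (gen2 x) = snd F' (gen2 x)"
  shows "u \<in> Arr free_one \<Longrightarrow> fst F u = fst F' u" "v \<in> Arr free_two \<Longrightarrow> snd F v = snd F' v"
proof -
  interpret F: law2_map free_law2 N F by (rule assms(1))
  interpret F': law2_map free_law2 N F' by (rule assms(2))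
  note f1 = F.M1.lawv_map_axioms[unfolded free_simps] F'.M1.lawv_map_axioms[unfolded free_simps]
  note f2 = lawv_map_cong[OF F.M2.lawv_map_axioms[unfolded free_simps] idt_ffin[symmetric]]
    lawv_map_cong[OF F'.M2.lawv_map_axioms[unfolded free_simps] idt_ffin[symmetric]]
  have e1: "fst F (enc1 x) = fst F' (enc1 x)" if "x \<in> cells1" for x
    using that
  proof induction
    case (fin x) then show ?case using F.fin1[OF fin] F'.fin1[OF fin] by (simp add: A.ffin_def)
  next
    case (gen g) then show ?case using g1 by (simp add: gen1_def)
  next
    case (cmp x y) then show ?case by (intro A.agree_cmp[OF f1])
  next
    case (pair x y) then show ?case by (intro A.agree_pair[OF f1])
  qed
  have e2: "snd F (enc2 x) = snd F' (enc2 x)" if "x \<in> cells2" for x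
    using that
  proof induction
    case (idt x)
    have "enc1 x \<in> Obj free_vert" using idt by (simp add: free_vert_def)
    then show ?case
      using functor_id[OF F.vert_functor, of "enc1 x"] functor_id[OF F'.vert_functor, of "enc1 x"] e1[OF idt] idt
      by (simp add: vert_ops)
  next
    case (gen g) then show ?case using g2 by (simp add: gen2_def)
  next
    case (cmp x y) then show ?case by (intro B.agree_cmp[OF f2])
  next
    case (pair x y) then show ?case by (intro B.agree_pair[OF f2])
  next
    case (vcmp x y)
    have "enc2 x \<in> hom free_vert (enc1 (fam_src x)) (enc1 (fam_tgt x))"
      "enc2 y \<in> hom free_vert (enc1 (fam_tgt x)) (enc1 (fam_tgt y))"
      using vcmp unfolding vert_hom by auto
    then have "snd F (Cmp free_vert (enc2 y) (enc2 x)) = snd F' (Cmp free_vert (enc2 y) (enc2 x))"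
      using functor_cmp[OF F.vert_functor, of "enc2 x" _ _ "enc2 y"] functor_cmp[OF F'.vert_functor, of "enc2 x" _ _ "enc2 y"] vcmp
      by simp
    then show ?case using vcmp by (simp add: vert_ops)
  qed
  show "u \<in> Arr free_one \<Longrightarrow> fst F u = fst F' u" using e1 by auto
  show "v \<in> Arr free_two \<Longrightarrow> snd F v = snd F' v" using e2 by auto
qed

text \<open>Since the projections are jointly faithful, being a 2-functor into the free theory is tested in the
  given models.\<close>

lemma reflect_2functor:
  assumes A: "is_cat2 A"
    and h1: "\<And>f n k. f \<in> hom (one A) n k \<Longrightarrow> F1 f \<in> hom free_one n k"
    and hv: "\<And>\<alpha> f g. \<alpha> \<in> hom (vert A) f g \<Longrightarrow> F2 \<alpha> \<in> hom free_vert (F1 f) (F1 g)"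
    and P: "\<And>i. i \<in> I \<Longrightarrow> is_2functor A (l2cat (M i)) (\<lambda>f. proj1 i (F1 f), \<lambda>\<alpha>. proj2 i (F2 \<alpha>))"
  shows "is_2functor A (l2cat free_law2) (F1, F2)"
proof -
  interpret A: cat2 A by unfold_locales (rule A)
  have h2: "F2 \<alpha> \<in> hom free_two n k" if "\<alpha> \<in> hom (two A) n k" for \<alpha> n k
    using F.vhom_two(1)[OF hv[OF A.two_vhom(1)[OF that], folded free_simps(3)] h1[OF A.two_vhom(2)[OF that], folded free_simps(1)]]
    by simp
  have "is_functor (one A) free_one (\<lambda>n. n) F1"
    by (rule reflect_functor[OF A.one_cat A.fcat_category A.proj_functor A.faithful])
      (use P in \<open>auto simp: twofunctor_iff intro: h1\<close>)
  moreover have "is_functor (two A) free_two (\<lambda>n. n) F2"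
    by (rule reflect_functor[OF A.two_cat B.fcat_category B.proj_functor B.faithful])
      (use P in \<open>auto simp: twofunctor_iff intro: h2\<close>)
  moreover have "is_functor (vert A) free_vert F1 F2"
  proof (rule reflect_functor[OF A.vert_cat free_vert_category proj_vert_functor vert_faithful])
    show "F1 f \<in> Obj free_vert" if "f \<in> Obj (vert A)" for f
      using h1[OF arr_hom[of f]] that by (simp add: in_hom free_vert_def)
  qed (use P hv in \<open>auto simp: twofunctor_iff\<close>)
  ultimately show ?thesis by (simp add: twofunctor_iff)
qed

definition "proj_pair i = (restrict (proj1 i) (Arr free_one), restrict (proj2 i) (Arr free_two))"

lemma proj_law2_maps: "i \<in> I \<Longrightarrow> proj_pair i \<in> law2_maps free_law2 (M i)"
proof -
  assume i: "i \<in> I"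
  interpret P: law2_map free_law2 "M i" "(proj1 i, proj2 i)" by (rule proj_map[OF i])
  have "law2_map free_law2 (M i) (proj_pair i)"
  proof unfold_locales
    show "is_2functor (l2cat free_law2) (l2cat (M i)) (proj_pair i)"
      by (rule twofunctor_cong[OF P.f2 F.c2]) (auto simp: proj_pair_def)
    show "fst (proj_pair i) (l2fin free_law2 x) = l2fin (M i) x" if "x \<in> Arr FF" for x
      using P.fin1[OF that] F.fin_arr[OF that] by (simp add: proj_pair_def)
  qed
  then show ?thesis using law2_maps_iff[OF law2_free M[OF i]] by (simp add: proj_pair_def)
qed

lemma free_unique_maps:
  assumes "is_law2 N" "F \<in> law2_maps free_law2 N" "F' \<in> law2_maps free_law2 N"
    and "\<And>g. g \<in> G1 \<Longrightarrow> fst F (gen1 g) = fst F' (gen1 g)"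
    and "\<And>x. x \<in> G2 \<Longrightarrow> snd F (gen2 x) = snd F' (gen2 x)"
  shows "F = F'"
proof -
  note F = assms(2)[unfolded law2_maps_iff[OF law2_free assms(1)]]
  note F' = assms(3)[unfolded law2_maps_iff[OF law2_free assms(1)]]
  have "fst F = fst F'"
    by (rule extensionalityI[of _ "Arr free_one"]) (use F F' free_unique(1)[of N F F'] assms(4,5) in auto)
  moreover have "snd F = snd F'"
    by (rule extensionalityI[of _ "Arr free_two"]) (use F F' free_unique(2)[of N F F'] assms(4,5) in auto)
  ultimately show ?thesis by (simp add: prod_eq_iff)
qed

lemma gen1_arr: "g \<in> G1 \<Longrightarrow> gen1 g \<in> Arr free_one" and gen2_arr: "x \<in> G2 \<Longrightarrow> gen2 x \<in> Arr free_two"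
  using gen1_hom[of g] gen2_hom[of x] F.vert_arr by (auto simp: in_hom)

text \<open>In the applications the generators are the cells of one or two 2-categories \<open>A\<close>, labelled by
  \<open>\<sigma>\<close> and \<open>\<tau>\<close>, and every model extends the labelling to a 2-functor on \<open>A\<close>.\<close>

definition "val_pair i A \<sigma> \<tau> = (\<lambda>f\<in>Arr (one A). a i (\<sigma> f), \<lambda>\<alpha>\<in>Arr (two A). b i (\<tau> \<alpha>))"

definition "gen_pair A \<sigma> \<tau> = (\<lambda>f\<in>Arr (one A). gen1 (\<sigma> f), \<lambda>\<alpha>\<in>Arr (two A). gen2 (\<tau> \<alpha>))"

definition "labelling A \<sigma> \<tau> \<longleftrightarrow> is_cat2 A \<and>
  (\<forall>f\<in>Arr (one A). \<sigma> f \<in> G1 \<and> d (\<sigma> f) = Src (one A) f \<and> c (\<sigma> f) = Tgt (one A) f) \<and>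
  (\<forall>\<alpha>\<in>Arr (two A). \<tau> \<alpha> \<in> G2 \<and> s (\<tau> \<alpha>) = \<sigma> (Src (vert A) \<alpha>) \<and> t (\<tau> \<alpha>) = \<sigma> (Tgt (vert A) \<alpha>)) \<and>
  (\<forall>i\<in>I. is_2functor A (l2cat (M i)) (val_pair i A \<sigma> \<tau>))"

lemma proj_gen_pair:
  assumes "labelling A \<sigma> \<tau>" "i \<in> I"
  shows "comp_pair A (proj_pair i) (gen_pair A \<sigma> \<tau>) = val_pair i A \<sigma> \<tau>"
  using assms proj_gen[OF assms(2)] gen1_arr gen2_arr
  by (auto simp: labelling_def comp_pair_def case_prod_unfold proj_pair_def val_pair_def gen_pair_def
      prod_eq_iff compose_def restrict_def fun_eq_iff)

lemma gen_pair_2functor: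
  assumes L: "labelling A \<sigma> \<tau>"
  shows "is_2functor A (l2cat free_law2) (gen_pair A \<sigma> \<tau>)"
proof -
  interpret A: cat2 A using L by unfold_locales (simp add: labelling_def)
  have L1: "\<sigma> f \<in> G1" "d (\<sigma> f) = Src (one A) f" "c (\<sigma> f) = Tgt (one A) f" if "f \<in> Arr (one A)" for f
    using L that by (auto simp: labelling_def)
  have L2: "\<tau> \<alpha> \<in> G2" "s (\<tau> \<alpha>) = \<sigma> (Src (vert A) \<alpha>)" "t (\<tau> \<alpha>) = \<sigma> (Tgt (vert A) \<alpha>)"
    if "\<alpha> \<in> Arr (two A)" for \<alpha> using L that by (auto simp: labelling_def)
  show ?thesis unfolding gen_pair_def
  proof (rule reflect_2functor[OF A.c2])
    show "(\<lambda>f\<in>Arr (one A). gen1 (\<sigma> f)) f \<in> hom free_one n k" if "f \<in> hom (one A) n k" for f n k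
      using gen1_hom[OF L1(1)] L1(2,3)[of f] that by (auto simp: in_hom[of f])
    show "(\<lambda>\<alpha>\<in>Arr (two A). gen2 (\<tau> \<alpha>)) \<alpha> \<in> hom free_vert ((\<lambda>f\<in>Arr (one A). gen1 (\<sigma> f)) f) ((\<lambda>f\<in>Arr (one A). gen1 (\<sigma> f)) g)"
      if "\<alpha> \<in> hom (vert A) f g" for \<alpha> f g
      using gen2_hom[OF L2(1), of \<alpha>] L2(2,3)[of \<alpha>] that A.vhom_one[OF that] by (auto simp: in_hom[of \<alpha>])
    show "is_2functor A (l2cat (M i)) (\<lambda>f. proj1 i ((\<lambda>f\<in>Arr (one A). gen1 (\<sigma> f)) f),
      \<lambda>\<alpha>. proj2 i ((\<lambda>\<alpha>\<in>Arr (two A). gen2 (\<tau> \<alpha>)) \<alpha>))" if i: "i \<in> I" for i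
    proof (rule twofunctor_cong[OF _ A.c2])
      show "is_2functor A (l2cat (M i)) (val_pair i A \<sigma> \<tau>)" using L i by (simp add: labelling_def)
    qed (simp_all add: val_pair_def proj_gen[OF i] L1 L2)
  qed
qed

lemma free_joint:
  assumes A: "is_cat2 A" and F: "is_2functor A (l2cat free_law2) F" "is_2functor A (l2cat free_law2) F'"
    and ext: "fst F \<in> extensional (Arr (one A))" "snd F \<in> extensional (Arr (two A))"
      "fst F' \<in> extensional (Arr (one A))" "snd F' \<in> extensional (Arr (two A))"
    and eq: "\<And>i. i \<in> I \<Longrightarrow> comp_pair A (proj_pair i) F = comp_pair A (proj_pair i) F'"
  shows "F = F'"
proof -
  have F1: "fst F x \<in> hom free_one (Src (one A) x) (Tgt (one A) x)" "fst F' x \<in> hom free_one (Src (one A) x) (Tgt (one A) x)"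
    if "x \<in> Arr (one A)" for x using F functor_hom[OF _ arr_hom[OF that]] by (auto simp: twofunctor_iff)
  have F2: "snd F x \<in> hom free_two (Src (two A) x) (Tgt (two A) x)" "snd F' x \<in> hom free_two (Src (two A) x) (Tgt (two A) x)"
    if "x \<in> Arr (two A)" for x using F functor_hom[OF _ arr_hom[OF that]] by (auto simp: twofunctor_iff)
  have "fst F = fst F'"
  proof (rule extensionalityI[OF ext(1,3)])
    fix x assume x: "x \<in> Arr (one A)"
    show "fst F x = fst F' x"
    proof (rule A.faithful[OF F1[OF x]])
      fix i assume i: "i \<in> I"
      have "fst (proj_pair i) (fst F x) = fst (proj_pair i) (fst F' x)"
        using eq[OF i] x unfolding comp_pair_eq_iff by blast
      then show "A.proj i (fst F x) = A.proj i (fst F' x)"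
        using F1[OF x] by (simp add: proj_pair_def in_hom)
    qed
  qed
  moreover have "snd F = snd F'"
  proof (rule extensionalityI[OF ext(2,4)])
    fix x assume x: "x \<in> Arr (two A)"
    show "snd F x = snd F' x"
    proof (rule B.faithful[OF F2[OF x]])
      fix i assume i: "i \<in> I"
      have "snd (proj_pair i) (snd F x) = snd (proj_pair i) (snd F' x)"
        using eq[OF i] x unfolding comp_pair_eq_iff by blast
      then show "B.proj i (snd F x) = B.proj i (snd F' x)"
        using F2[OF x] by (simp add: proj_pair_def in_hom)
    qed
  qed
  ultimately show ?thesis by (simp add: prod_eq_iff)
qed

lemma gen_pair_law2:
  assumes L: "labelling (l2cat A) \<sigma> \<tau>" and A: "is_law2 A"
    and V: "\<And>i. i \<in> I \<Longrightarrow> val_pair i (l2cat A) \<sigma> \<tau> \<in> law2_maps A (M i)"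
  shows "gen_pair (l2cat A) \<sigma> \<tau> \<in> law2_maps A free_law2"
proof -
  interpret A: law2 A by unfold_locales (rule A)
  note G = gen_pair_2functor[OF L]
  have "fst (gen_pair (l2cat A) \<sigma> \<tau>) (l2fin A x) = A.ffin x" if x: "x \<in> Arr FF" for x
  proof (rule A.faithful)
    show "fst (gen_pair (l2cat A) \<sigma> \<tau>) (l2fin A x) \<in> hom free_one (Src FF x) (Tgt FF x)"
      using functor_hom[OF _ A.L1.fin_hom[OF arr_hom[OF x]]] G by (auto simp: twofunctor_iff)
    show "A.ffin x \<in> hom free_one (Src FF x) (Tgt FF x)" by (rule A.ffin_hom[OF arr_hom[OF x]])
    fix i assume i: "i \<in> I"
    have "law2_map A (M i) (val_pair i (l2cat A) \<sigma> \<tau>)" using V[OF i] law2_maps_iff[OF A M[OF i]] by blast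
    from law2_map.fin1[OF this x] show "proj1 i (fst (gen_pair (l2cat A) \<sigma> \<tau>) (l2fin A x)) = proj1 i (A.ffin x)"
      using proj_gen(1)[OF i] A.fin_arr[OF x] L A.proj_fin[OF i x] by (simp add: val_pair_def gen_pair_def labelling_def)
  qed
  then have "law2_map A free_law2 (gen_pair (l2cat A) \<sigma> \<tau>)" using G by unfold_locales simp_all
  then show ?thesis using law2_maps_iff[OF A law2_free] by (simp add: gen_pair_def)
qed

end

section \<open>The left adjoint of the forgetful functor to Cat-pros\<close>

lemma law2_catpro_simps [simp]:
  "cpcat (law2_catpro N) = l2cat N" "tens1 (law2_catpro N) = prod_arr (one (l2cat N)) (l2fin N)"
  "tens2 (law2_catpro N) = prod_arr (two (l2cat N)) (\<lambda>a. Idt (vert (l2cat N)) (l2fin N a))"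
  by (simp_all add: law2_catpro_def)

text \<open>The models are the 2-theories with a map of Cat-pros from \<open>Q\<close>.  That the generators form a map of
  Cat-pros is tested in the models, and every map of Cat-pros \<open>Q \<rightarrow> N\<close> is itself one of the models.\<close>

lemma LCat_exists:
  fixes Q :: "('u, 'u cells) catpro"
  assumes inf: "infinite (UNIV :: 'u set)" and Q: "is_catpro Q"
  shows "\<exists>u. universal_arrow TwoLaw CatPro law2_catpro law2_catpro_arr Q u"
proof -
  let ?C = "cpcat Q"
  define I where "I = {(N :: ('u, 'u cells) law2, k). is_law2 N \<and> k \<in> catpro_maps Q (law2_catpro N)}"
  have ID: "is_law2 (fst i)" "snd i \<in> catpro_maps Q (law2_catpro (fst i))" if "i \<in> I" for i
    using that by (auto simp: I_def)
  interpret Q: cat2 ?C by unfold_locales (rule catpro_tens(3)[OF Q])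
  have kf: "is_2functor ?C (l2cat (fst i)) (snd i)" if "i \<in> I" for i
    using catpro_mapsD(3)[OF ID(2)[OF that]] by simp
  interpret free_family I fst "Arr (one ?C)" "Src (one ?C)" "Tgt (one ?C)" "\<lambda>i. fst (snd i)"
    "Arr (two ?C)" "Src (vert ?C)" "Tgt (vert ?C)" "\<lambda>i. snd (snd i)"
  proof
    show "fst (snd i) g \<in> hom (one (l2cat (fst i))) (Src (one ?C) g) (Tgt (one ?C) g)"
      if "i \<in> I" "g \<in> Arr (one ?C)" for i g
      using functor_hom[OF _ arr_hom[OF that(2)]] kf[OF that(1)] by (auto simp: twofunctor_iff)
    show "snd (snd i) x \<in> hom (vert (l2cat (fst i))) (fst (snd i) (Src (vert ?C) x)) (fst (snd i) (Tgt (vert ?C) x))"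
      if "i \<in> I" "x \<in> Arr (two ?C)" for i x
      using functor_hom[OF _ arr_hom[of x "vert ?C"]] kf[OF that(1)] that(2) by (auto simp: twofunctor_iff)
    show "Src (vert ?C) x \<in> Arr (one ?C) \<and> Tgt (vert ?C) x \<in> Arr (one ?C) \<and>
      Src (one ?C) (Tgt (vert ?C) x) = Src (one ?C) (Src (vert ?C) x) \<and>
      Tgt (one ?C) (Tgt (vert ?C) x) = Tgt (one ?C) (Src (vert ?C) x)" if "x \<in> Arr (two ?C)" for x
      using Q.two_vhom[OF arr_hom[OF that]] by (simp add: in_hom)
  qed (use inf lepoll_univ cells_lepoll ID in auto)
  let ?N = "free_law2"
  let ?e = "gen_pair ?C (\<lambda>f. f) (\<lambda>\<alpha>. \<alpha>)"
  have v: "val_pair i ?C (\<lambda>f. f) (\<lambda>\<alpha>. \<alpha>) = snd i" if "i \<in> I" for i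
    using catpro_mapsD(1,2)[OF ID(2)[OF that]]
    by (auto simp: val_pair_def prod_eq_iff restrict_def fun_eq_iff extensional_def)
  have L: "labelling ?C (\<lambda>f. f) (\<lambda>\<alpha>. \<alpha>)"
    unfolding labelling_def using Q.c2 v kf by simp
  have ef: "is_2functor ?C (l2cat ?N) ?e" by (rule gen_pair_2functor[OF L])
  have e1: "gen1 f \<in> hom free_one n k" if "f \<in> hom (one ?C) n k" for f n k
    using gen1_hom[of f] that by (simp add: in_hom[of f])
  have e2: "gen2 f \<in> hom free_two n k" if "f \<in> hom (two ?C) n k" for f n k
    using functor_hom[of "two ?C" free_two "\<lambda>n. n" "snd ?e", OF _ that] ef that
    by (simp add: twofunctor_iff gen_pair_def in_hom[of f])
  have e: "?e \<in> catpro_maps Q (law2_catpro ?N)"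
  proof (rule catpro_mapsI)
    fix f g assume fg: "f \<in> Arr (one ?C)" "g \<in> Arr (one ?C)"
    have t: "tens1 Q f g \<in> hom (one ?C) (Src (one ?C) f + Src (one ?C) g) (Tgt (one ?C) f + Tgt (one ?C) g)"
      using Q fg by (simp add: is_catpro_def is_pro_def Let_def)
    have tA: "tens1 Q f g \<in> Arr (one ?C)" by (rule catpro_tens(1)[OF Q fg])
    have "gen1 (tens1 Q f g) = prod_arr free_one A.ffin (gen1 f) (gen1 g)"
      by (rule A.reflect_prod_arr[OF e1[OF arr_hom[OF fg(1)]] e1[OF arr_hom[OF fg(2)]] e1[OF t]])
        (use proj_gen(1) tA fg catpro_mapsD(4)[OF ID(2) fg] in simp)
    then show "fst ?e (tens1 Q f g) = tens1 (law2_catpro ?N) (fst ?e f) (fst ?e g)"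
      using fg tA by (simp add: gen_pair_def)
  next
    fix f g assume fg: "f \<in> Arr (two ?C)" "g \<in> Arr (two ?C)"
    have t: "tens2 Q f g \<in> hom (two ?C) (Src (two ?C) f + Src (two ?C) g) (Tgt (two ?C) f + Tgt (two ?C) g)"
      using Q fg by (simp add: is_catpro_def is_pro_def Let_def)
    have tA: "tens2 Q f g \<in> Arr (two ?C)" by (rule catpro_tens(2)[OF Q fg])
    have "gen2 (tens2 Q f g) = prod_arr free_two B.ffin (gen2 f) (gen2 g)"
      by (rule B.reflect_prod_arr[OF e2[OF arr_hom[OF fg(1)]] e2[OF arr_hom[OF fg(2)]] e2[OF t]])
        (use proj_gen(2) tA fg catpro_mapsD(5)[OF ID(2) fg] in simp)
    then show "snd ?e (tens2 Q f g) = tens2 (law2_catpro ?N) (snd ?e f) (snd ?e g)"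
      using fg tA prod_arr_cong[of "\<lambda>a. Idt free_vert (A.ffin a)" B.ffin, OF idt_ffin] by (simp add: gen_pair_def)
  qed (use ef in \<open>auto simp: gen_pair_def\<close>)
  have "universal_arrow TwoLaw CatPro law2_catpro law2_catpro_arr Q (?N, (Q, ?e, law2_catpro ?N))"
    unfolding universal_arrow_def
  proof (clarsimp, intro conjI allI impI ballI)
    show "is_law2 ?N" by (rule law2_free)
    show "(Q, ?e, law2_catpro ?N) \<in> hom CatPro Q (law2_catpro ?N)"
      using Q e law2.catpro[OF F.law2_axioms] by (simp add: catpro_hom)
    fix N :: "('u, 'u cells) law2" and f assume N: "is_law2 N" and f: "f \<in> hom CatPro Q (law2_catpro N)"
    obtain k where k: "f = (Q, k, law2_catpro N)" "k \<in> catpro_maps Q (law2_catpro N)"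
      using f by (auto simp: catpro_hom)
    have i: "(N, k) \<in> I" using N k by (simp add: I_def)
    note pm = proj_law2_maps[OF i, simplified]
    show "\<exists>!g. g \<in> hom TwoLaw ?N N \<and> Cmp CatPro (law2_catpro_arr g) (Q, ?e, law2_catpro ?N) = f"
    proof (rule ex1I[of _ "(?N, proj_pair (N, k), N)"], intro conjI)
      show "(?N, proj_pair (N, k), N) \<in> hom TwoLaw ?N N" using law2_free N pm by (simp add: law2_hom)
      have "comp_pair ?C (proj_pair (N, k)) ?e = k" using proj_gen_pair[OF L i] v[OF i] by simp
      then show "Cmp CatPro (law2_catpro_arr (?N, proj_pair (N, k), N)) (Q, ?e, law2_catpro ?N) = f"
        by (simp add: law2_catpro_arr_def k(1))
    next
      fix g assume g: "g \<in> hom TwoLaw ?N N \<and> Cmp CatPro (law2_catpro_arr g) (Q, ?e, law2_catpro ?N) = f"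
      then obtain m where m: "g = (?N, m, N)" "m \<in> law2_maps ?N N" by (auto simp: law2_hom)
      have mk: "comp_pair ?C m ?e = comp_pair ?C (proj_pair (N, k)) ?e"
        using g proj_gen_pair[OF L i] v[OF i] by (simp add: m law2_catpro_arr_def k(1))
      have "m = proj_pair (N, k)"
        by (rule free_unique_maps[OF N m(2) pm]) (use mk in \<open>simp_all add: comp_pair_eq_iff gen_pair_def\<close>)
      then show "g = (?N, proj_pair (N, k), N)" by (simp add: m)
    qed
  qed
  then show ?thesis by blast
qed

section \<open>Pushouts of Lawvere 2-theories\<close>

lemma law2_maps_vhom:
  assumes "is_law2 A" "is_law2 N" "p \<in> law2_maps A N"
  shows "f \<in> hom (one (l2cat A)) n k \<Longrightarrow> fst p f \<in> hom (one (l2cat N)) n k"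
    "\<alpha> \<in> hom (vert (l2cat A)) f g \<Longrightarrow> snd p \<alpha> \<in> hom (vert (l2cat N)) (fst p f) (fst p g)"
proof -
  interpret law2_map A N p using law2_maps_iff[OF assms(1,2)] assms(3) by simp
  show "f \<in> hom (one (l2cat A)) n k \<Longrightarrow> fst p f \<in> hom (one (l2cat N)) n k"
    "\<alpha> \<in> hom (vert (l2cat A)) f g \<Longrightarrow> snd p \<alpha> \<in> hom (vert (l2cat N)) (fst p f) (fst p g)"
    using functor_hom[OF one_functor] functor_hom[OF vert_functor] by auto
qed

text \<open>The models are the commutative squares on the given span, and the generators are the cells of both \<open>A\<close> and
  \<open>B\<close>.\<close>

lemma pushout_exists:
  fixes A B C :: "('u, 'u cells) law2"
  assumes inf: "infinite (UNIV :: 'u set)"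
    and f: "f \<in> hom TwoLaw C A" and g: "g \<in> hom TwoLaw C B"
  shows "\<exists>x. is_pushout TwoLaw f g x"
proof -
  obtain u v where u: "f = (C, u, A)" "u \<in> law2_maps C A" and v: "g = (C, v, B)" "v \<in> law2_maps C B"
    and ABC: "is_law2 A" "is_law2 B" "is_law2 C" using f g by (auto simp: law2_hom)
  interpret A: law2 A by unfold_locales (rule ABC)
  interpret B: law2 B by unfold_locales (rule ABC)
  interpret C: law2 C by unfold_locales (rule ABC)
  define I where "I = {(N :: ('u, 'u cells) law2, p, q). is_law2 N \<and> p \<in> law2_maps A N \<and> q \<in> law2_maps B N \<and>
    comp_pair (l2cat C) p u = comp_pair (l2cat C) q v}"
  have ID: "is_law2 (fst i)" "fst (snd i) \<in> law2_maps A (fst i)" "snd (snd i) \<in> law2_maps B (fst i)"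
    "comp_pair (l2cat C) (fst (snd i)) u = comp_pair (l2cat C) (snd (snd i)) v" if "i \<in> I" for i
    using that by (auto simp: I_def)
  have pm: "law2_map A (fst i) (fst (snd i))" and qm: "law2_map B (fst i) (snd (snd i))" if "i \<in> I" for i
    using ID[OF that] law2_maps_iff[OF ABC(1) ID(1)[OF that]] law2_maps_iff[OF ABC(2) ID(1)[OF that]] by simp_all
  let ?d = "case_sum (Src A.C1) (Src B.C1)" and ?c = "case_sum (Tgt A.C1) (Tgt B.C1)"
    and ?s = "map_sum (Src A.CV) (Src B.CV)" and ?t = "map_sum (Tgt A.CV) (Tgt B.CV)"
  note ph = law2_maps_vhom[OF ABC(1) ID(1,2)] and qh = law2_maps_vhom[OF ABC(2) ID(1,3)]
  interpret free_family I fst "Arr A.C1 <+> Arr B.C1" ?d ?c "\<lambda>i. case_sum (fst (fst (snd i))) (fst (snd (snd i)))"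
    "Arr A.C2 <+> Arr B.C2" ?s ?t "\<lambda>i. case_sum (snd (fst (snd i))) (snd (snd (snd i)))"
  proof
    show "case_sum (fst (fst (snd i))) (fst (snd (snd i))) x \<in> hom (one (l2cat (fst i))) (?d x) (?c x)"
      if "i \<in> I" "x \<in> Arr A.C1 <+> Arr B.C1" for i x
      using that ph(1)[OF that(1) that(1) arr_hom] qh(1)[OF that(1) that(1) arr_hom] by auto
    show "case_sum (snd (fst (snd i))) (snd (snd (snd i))) x \<in> hom (vert (l2cat (fst i)))
      (case_sum (fst (fst (snd i))) (fst (snd (snd i))) (?s x)) (case_sum (fst (fst (snd i))) (fst (snd (snd i))) (?t x))"
      if "i \<in> I" "x \<in> Arr A.C2 <+> Arr B.C2" for i x
      using that ph(2)[OF that(1) that(1) arr_hom] qh(2)[OF that(1) that(1) arr_hom] by auto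
    show "?s x \<in> Arr A.C1 <+> Arr B.C1 \<and> ?t x \<in> Arr A.C1 <+> Arr B.C1 \<and> ?d (?t x) = ?d (?s x) \<and> ?c (?t x) = ?c (?s x)"
      if "x \<in> Arr A.C2 <+> Arr B.C2" for x
      using that A.two_vhom[OF arr_hom] B.two_vhom[OF arr_hom] by (auto simp: in_hom)
    show "Arr A.C1 <+> Arr B.C1 \<lesssim> (UNIV :: 'u set)" by (rule sum_lepoll[OF inf lepoll_univ lepoll_univ])
    show "Arr A.C2 <+> Arr B.C2 \<lesssim> (UNIV :: 'u set)"
      by (rule sum_lepoll[OF inf cells_lepoll[OF inf] cells_lepoll[OF inf]])
  qed (use inf ID in auto)
  let ?N = "free_law2"
  have vp: "val_pair i (l2cat A) Inl Inl = fst (snd i)" and vq: "val_pair i (l2cat B) Inr Inr = snd (snd i)"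
    if "i \<in> I" for i
    using ID(2,3)[OF that] law2_maps_iff[OF ABC(1) ID(1)[OF that]] law2_maps_iff[OF ABC(2) ID(1)[OF that]]
    by (auto simp: val_pair_def prod_eq_iff restrict_def fun_eq_iff extensional_def)
  have Lp: "labelling (l2cat A) Inl Inl"
    unfolding labelling_def using A.c2 vp law2_map.f2[OF pm] by auto
  have Lq: "labelling (l2cat B) Inr Inr"
    unfolding labelling_def using B.c2 vq law2_map.f2[OF qm] by auto
  define p where "p = gen_pair (l2cat A) Inl Inl"
  define q where "q = gen_pair (l2cat B) Inr Inr"
  have p: "p \<in> law2_maps A ?N" unfolding p_def by (rule gen_pair_law2[OF Lp ABC(1)]) (simp add: vp ID(2))
  have q: "q \<in> law2_maps B ?N" unfolding q_def by (rule gen_pair_law2[OF Lq ABC(2)]) (simp add: vq ID(3))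
  have pp: "comp_pair (l2cat A) (proj_pair i) p = fst (snd i)" and qq: "comp_pair (l2cat B) (proj_pair i) q = snd (snd i)"
    if "i \<in> I" for i
    unfolding p_def q_def using proj_gen_pair[OF Lp that] proj_gen_pair[OF Lq that] vp[OF that] vq[OF that] by simp_all
  note u' = u(2)[unfolded law2_maps_iff[OF ABC(3,1)]] and v' = v(2)[unfolded law2_maps_iff[OF ABC(3,2)]]
  note p' = p[unfolded law2_maps_iff[OF ABC(1) law2_free]] and q' = q[unfolded law2_maps_iff[OF ABC(2) law2_free]]
  have comm: "comp_pair (l2cat C) p u = comp_pair (l2cat C) q v"
  proof (rule free_joint[OF C.c2])
    show "is_2functor (l2cat C) (l2cat ?N) (comp_pair (l2cat C) p u)"
      using comp_pair_2functor[OF law2_map.f2 law2_map.f2 C.c2] u' p' by blast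
    show "is_2functor (l2cat C) (l2cat ?N) (comp_pair (l2cat C) q v)"
      using comp_pair_2functor[OF law2_map.f2 law2_map.f2 C.c2] v' q' by blast
    fix i assume i: "i \<in> I"
    have "comp_pair (l2cat C) (proj_pair i) (comp_pair (l2cat C) p u) = comp_pair (l2cat C) (fst (snd i)) u"
      using comp_pair_laws(3)[OF law2_map.f2, of C A u "proj_pair i" p] u' pp[OF i] by simp
    moreover have "comp_pair (l2cat C) (proj_pair i) (comp_pair (l2cat C) q v) = comp_pair (l2cat C) (snd (snd i)) v"
      using comp_pair_laws(3)[OF law2_map.f2, of C B v "proj_pair i" q] v' qq[OF i] by simp
    ultimately show "comp_pair (l2cat C) (proj_pair i) (comp_pair (l2cat C) p u) =
      comp_pair (l2cat C) (proj_pair i) (comp_pair (l2cat C) q v)" using ID(4)[OF i] by simp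
  qed (simp_all add: comp_pair_def case_prod_unfold)
  have "is_pushout TwoLaw f g (?N, (A, p, ?N), (B, q, ?N))"
    unfolding is_pushout_def
  proof (clarsimp, intro conjI ballI impI allI)
    show "f \<in> Arr TwoLaw" "g \<in> Arr TwoLaw" "Src TwoLaw f = Src TwoLaw g" "is_law2 ?N"
      using f g law2_free by (simp_all add: in_hom)
    show "(A, p, ?N) \<in> hom TwoLaw (Tgt TwoLaw f) ?N" "(B, q, ?N) \<in> hom TwoLaw (Tgt TwoLaw g) ?N"
      using p q ABC law2_free by (simp_all add: law2_hom u v)
    show "Cmp TwoLaw (A, p, ?N) f = Cmp TwoLaw (B, q, ?N) g" by (simp add: u v comm)
    fix N :: "('u, 'u cells) law2" and p' q' assume N: "is_law2 N"
      and p': "p' \<in> hom TwoLaw (Tgt TwoLaw f) N" and q': "q' \<in> hom TwoLaw (Tgt TwoLaw g) N"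
      and eq: "Cmp TwoLaw p' f = Cmp TwoLaw q' g"
    obtain a b where a: "p' = (A, a, N)" "a \<in> law2_maps A N" and b: "q' = (B, b, N)" "b \<in> law2_maps B N"
      using p' q' by (auto simp: u v law2_hom)
    have i: "(N, a, b) \<in> I" using N a b eq by (simp add: I_def u v)
    note pm = proj_law2_maps[OF i, simplified]
    show "\<exists>!w. w \<in> hom TwoLaw ?N N \<and> Cmp TwoLaw w (A, p, ?N) = p' \<and> Cmp TwoLaw w (B, q, ?N) = q'"
    proof (rule ex1I[of _ "(?N, proj_pair (N, a, b), N)"], intro conjI)
      show "(?N, proj_pair (N, a, b), N) \<in> hom TwoLaw ?N N" using law2_free N pm by (simp add: law2_hom)
      show "Cmp TwoLaw (?N, proj_pair (N, a, b), N) (A, p, ?N) = p'"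
        "Cmp TwoLaw (?N, proj_pair (N, a, b), N) (B, q, ?N) = q'" using pp[OF i] qq[OF i] by (simp_all add: a b)
    next
      fix w assume w: "w \<in> hom TwoLaw ?N N \<and> Cmp TwoLaw w (A, p, ?N) = p' \<and> Cmp TwoLaw w (B, q, ?N) = q'"
      then obtain m where m: "w = (?N, m, N)" "m \<in> law2_maps ?N N" by (auto simp: law2_hom)
      have mk: "comp_pair (l2cat A) m p = comp_pair (l2cat A) (proj_pair (N, a, b)) p"
        "comp_pair (l2cat B) m q = comp_pair (l2cat B) (proj_pair (N, a, b)) q"
        using w pp[OF i] qq[OF i] by (simp_all add: m a b)
      have "m = proj_pair (N, a, b)"
        by (rule free_unique_maps[OF N m(2) pm])
          (use mk in \<open>auto simp: comp_pair_eq_iff p_def q_def gen_pair_def\<close>)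
      then show "w = (?N, proj_pair (N, a, b), N)" by (simp add: m)
    qed
  qed
  then show ?thesis by blast
qed


section \<open>Free Lawvere theories\<close>

text \<open>A Lawvere theory is treated as a codiscrete 2-theory: maps of 2-theories into a codiscrete one
  are the same as maps of the underlying Lawvere theories.\<close>

locale free_law_family =
  fixes I :: "'i set" and N :: "'i \<Rightarrow> 'u law" and G1 :: "'g set" and d c :: "'g \<Rightarrow> nat" and a :: "'i \<Rightarrow> 'g \<Rightarrow> 'u"
  assumes inf: "infinite (UNIV :: 'u set)"
    and N: "i \<in> I \<Longrightarrow> is_law (N i)"
    and a: "i \<in> I \<Longrightarrow> g \<in> G1 \<Longrightarrow> a i g \<in> hom (lcat (N i)) (d g) (c g)"
    and small: "G1 \<lesssim> (UNIV :: 'u set)"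

lemma codiscrete_simps: "one (l2cat (codiscrete L)) = lcat L" "l2fin (codiscrete L) = lfin L"
  by (simp_all add: codiscrete_def)

sublocale free_law_family \<subseteq> free_family I "\<lambda>i. codiscrete (N i)" G1 d c a "{} :: unit set"
    "\<lambda>_. undefined" "\<lambda>_. undefined" "\<lambda>_ _. undefined"
  by unfold_locales (auto simp: inf N a small codiscrete_law2 codiscrete_simps)

context free_law_family begin

definition "free_law = \<lparr>lcat = free_one, lfin = A.ffin\<rparr>"

lemma free_law_simps [simp]: "lcat free_law = free_one" "lfin free_law = A.ffin"
  by (simp_all add: free_law_def)

lemma law_free: "is_law free_law"
  using A.fcat_lawv by (simp add: law_lawv)

lemma proj_lawv_map: "i \<in> I \<Longrightarrow> lawv_map free_one A.ffin (lcat (N i)) (lfin (N i)) (proj1 i)"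
  using A.proj_map unfolding codiscrete_simps .

lemma proj_law_maps: "i \<in> I \<Longrightarrow> restrict (proj1 i) (Arr free_one) \<in> law_maps free_law (N i)"
proof -
  assume i: "i \<in> I"
  interpret lawv_map free_one A.ffin "lcat (N i)" "lfin (N i)" "proj1 i" by (rule proj_lawv_map[OF i])
  have "is_functor free_one (lcat (N i)) (\<lambda>n. n) (restrict (proj1 i) (Arr free_one))"
    by (rule functor_cong[OF funct]) simp_all
  then have "lawv_map free_one A.ffin (lcat (N i)) (lfin (N i)) (restrict (proj1 i) (Arr free_one))"
    using F.fin_arr fin by unfold_locales simp_all
  then show ?thesis using law_maps_iff[OF law_free N[OF i]] by simp
qed

text \<open>Both maps extend to maps of 2-theories into the codiscrete 2-theory on \<open>L\<close>, where uniqueness on generators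
  is known.\<close>

lemma free_law_unique:
  assumes L: "is_law L" and F: "F \<in> law_maps free_law L" "F' \<in> law_maps free_law L"
    and eq: "\<And>g. g \<in> G1 \<Longrightarrow> F (gen1 g) = F' (gen1 g)"
  shows "F = F'"
proof -
  interpret L: lawv "lcat L" "lfin L" using L law_lawv[of L] by simp
  interpret K: thick "lcat L" "parallel_classes (lcat L)" by (rule codiscrete_thick[OF L.cat L.objs])
  have cod: "l2cat (codiscrete L) = K.T" by (simp add: codiscrete_def)
  have ext: "\<exists>H. law2_map free_law2 (codiscrete L) (G, H)" if G: "G \<in> law_maps free_law L" for G
  proof -
    interpret G: lawv_map free_one A.ffin "lcat L" "lfin L" G
      using G law_maps_iff[OF law_free L] by simp
    have "(G (Src free_vert \<alpha>), G (Tgt free_vert \<alpha>)) \<in> pairs (parallel_classes (lcat L))" if "\<alpha> \<in> Arr free_two" for \<alpha>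
      unfolding parallel_R
      using G.hom[OF F.two_vhom(2)[OF arr_hom, unfolded free_simps, OF that]] G.hom[OF F.two_vhom(3)[OF arr_hom, unfolded free_simps, OF that]]
      by (simp add: in_hom)
    then have "is_2functor (l2cat free_law2) (l2cat (codiscrete L))
      (G, \<lambda>\<alpha>\<in>Arr free_two. (G (Src free_vert \<alpha>), G (Tgt free_vert \<alpha>)))"
      using K.functor_into[OF F.c2, of G] G.funct unfolding cod by simp
    moreover have "G (l2fin free_law2 x) = lfin L x" if "x \<in> Arr FF" for x using G.fin[OF that] by simp
    moreover have "law2 (codiscrete L)" by unfold_locales (rule codiscrete_law2[OF L])
    ultimately show ?thesis
      by (intro exI[of _ "\<lambda>\<alpha>\<in>Arr free_two. (G (Src free_vert \<alpha>), G (Tgt free_vert \<alpha>))"])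
        (simp add: law2_map_def law2_map_axioms_def F.law2_axioms codiscrete_simps[of L])
  qed
  obtain H H' where "law2_map free_law2 (codiscrete L) (F, H)" "law2_map free_law2 (codiscrete L) (F', H')"
    using ext F by blast
  from free_unique(1)[OF this] eq have "F u = F' u" if "u \<in> Arr free_one" for u using that by simp
  then show ?thesis using F law_maps_iff[OF law_free L] by (intro extensionalityI[of _ "Arr free_one"]) auto
qed

end

lemma law_pro_simps [simp]: "pcat (law_pro L) = lcat L" "ptens (law_pro L) = prod_arr (lcat L) (lfin L)"
  by (simp_all add: law_pro_def)

lemma law_pro: "is_law L \<Longrightarrow> is_pro (law_pro L)"
  using lawv.prod_pro[of "lcat L" "lfin L"] law_lawv[of L] by (simp add: law_pro_def)

lemma pro_tens: "is_pro P \<Longrightarrow> f \<in> Arr (pcat P) \<Longrightarrow> g \<in> Arr (pcat P) \<Longrightarrow> ptens P f g \<in>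
    hom (pcat P) (Src (pcat P) f + Src (pcat P) g) (Tgt (pcat P) f + Tgt (pcat P) g)"
  by (simp add: is_pro_def Let_def)

lemma LP_exists:
  fixes P :: "'u pro"
  assumes inf: "infinite (UNIV :: 'u set)" and P: "is_pro P"
  shows "\<exists>u. universal_arrow Law Pro law_pro law_pro_arr P u"
proof -
  let ?C = "pcat P"
  define I where "I = {(N :: 'u law, k). is_law N \<and> k \<in> pro_maps P (law_pro N)}"
  have ID: "is_law (fst i)" "snd i \<in> pro_maps P (law_pro (fst i))" if "i \<in> I" for i
    using that by (auto simp: I_def)
  have kf: "is_functor ?C (lcat (fst i)) (\<lambda>n. n) (snd i)" if "i \<in> I" for i
    using ID(2)[OF that] by (simp add: pro_maps_def)
  interpret free_law_family I fst "Arr ?C" "Src ?C" "Tgt ?C" snd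
    by unfold_locales (use inf ID lepoll_univ functor_hom[OF kf arr_hom] in auto)
  let ?e = "restrict gen1 (Arr ?C)"
  have e: "?e \<in> pro_maps P (law_pro free_law)"
  proof -
    have "is_functor ?C free_one (\<lambda>n. n) ?e"
    proof (rule reflect_functor[OF pro_cat(1)[OF P] A.fcat_category proj_lawv_map[THEN lawv_map.funct] A.faithful])
      show "?e f \<in> hom free_one n k" if "f \<in> hom ?C n k" for f n k
        using gen1_hom[of f] that by (auto simp: in_hom[of f])
      show "is_functor ?C (lcat (fst i)) (\<lambda>n. n) (\<lambda>f. proj1 i (?e f))" if "i \<in> I" for i
        by (rule functor_cong[OF kf[OF that]]) (simp_all add: proj_gen[OF that])
    qed simp_all
    moreover have "gen1 (ptens P f g) = prod_arr free_one A.ffin (gen1 f) (gen1 g)"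
      if fg: "f \<in> Arr ?C" "g \<in> Arr ?C" for f g
    proof (rule A.reflect_prod_arr[OF gen1_hom[OF fg(1)] gen1_hom[OF fg(2)]])
      note t = pro_tens[OF P fg]
      show "gen1 (ptens P f g) \<in> hom free_one (Src ?C f + Src ?C g) (Tgt ?C f + Tgt ?C g)"
        using gen1_hom[of "ptens P f g"] t by (simp add: in_hom[of "ptens P f g"])
      show "proj1 i (gen1 (ptens P f g)) = prod_arr (one (l2cat (codiscrete (fst i)))) (l2fin (codiscrete (fst i)))
        (proj1 i (gen1 f)) (proj1 i (gen1 g))" if i: "i \<in> I" for i
        using proj_gen(1)[OF i] t fg ID(2)[OF i] by (simp add: pro_maps_def in_hom codiscrete_simps[of "fst i"])
    qed
    ultimately show ?thesis using pro_tens[OF P] by (simp add: pro_maps_def in_hom)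
  qed
  have "universal_arrow Law Pro law_pro law_pro_arr P (free_law, (P, ?e, law_pro free_law))"
    unfolding universal_arrow_def
  proof (clarsimp, intro conjI allI impI ballI)
    show "is_law free_law" by (rule law_free)
    show "(P, ?e, law_pro free_law) \<in> hom Pro P (law_pro free_law)"
      using P e law_pro[OF law_free] by (simp add: pro_hom)
    fix L :: "'u law" and f assume L: "is_law L" and f: "f \<in> hom Pro P (law_pro L)"
    obtain k where k: "f = (P, k, law_pro L)" "k \<in> pro_maps P (law_pro L)" using f by (auto simp: pro_hom)
    have i: "(L, k) \<in> I" using L k by (simp add: I_def)
    note pm = proj_law_maps[OF i, unfolded fst_conv]
    let ?m = "restrict (proj1 (L, k)) (Arr free_one)"
    show "\<exists>!g. g \<in> hom Law free_law L \<and> Cmp Pro (law_pro_arr g) (P, ?e, law_pro free_law) = f"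
    proof (rule ex1I[of _ "(free_law, ?m, L)"], intro conjI)
      show "(free_law, ?m, L) \<in> hom Law free_law L" using law_free L pm by (simp add: law_hom)
      have "compose (Arr ?C) ?m ?e = k"
        using k(2) proj_gen(1)[OF i] gen1_arr
        by (auto simp: pro_maps_def compose_def restrict_def fun_eq_iff extensional_def)
      then show "Cmp Pro (law_pro_arr (free_law, ?m, L)) (P, ?e, law_pro free_law) = f"
        by (simp add: law_pro_arr_def k(1))
    next
      fix g assume g: "g \<in> hom Law free_law L \<and> Cmp Pro (law_pro_arr g) (P, ?e, law_pro free_law) = f"
      then obtain m where m: "g = (free_law, m, L)" "m \<in> law_maps free_law L" by (auto simp: law_hom)
      have mk: "compose (Arr ?C) m ?e = k" using g by (simp add: m law_pro_arr_def k(1))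
      have "m = ?m"
      proof (rule free_law_unique[OF L m(2) pm])
        show "m (gen1 x) = ?m (gen1 x)" if "x \<in> Arr ?C" for x
          using fun_cong[OF mk, of x] that proj_gen(1)[OF i that] gen1_arr[OF that] by (simp add: compose_def)
      qed
      then show "g = (free_law, ?m, L)" by (simp add: m)
    qed
  qed
  then show ?thesis by blast
qed

lemma Fr_exists:
  fixes G :: "'u sig"
  assumes inf: "infinite (UNIV :: 'u set)"
  shows "\<exists>u. universal_arrow Law Sig law_sig law_sig_arr G u"
proof -
  define I where "I = {(N :: 'u law, k). is_law N \<and> (\<forall>n. k n \<in> G n \<rightarrow>\<^sub>E law_sig N n)}"
  have ID: "is_law (fst i)" "snd i n \<in> G n \<rightarrow>\<^sub>E law_sig (fst i) n" if "i \<in> I" for i n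
    using that by (cases i, simp_all add: I_def)+
  obtain t :: "nat \<Rightarrow> 'u" where t: "inj t" using infinite_countable_subset[OF inf] by blast
  obtain p :: "'u \<times> 'u \<Rightarrow> 'u" where p: "inj p" using infinite_square[OF inf] .
  have "inj_on (\<lambda>(n, x). p (t n, x)) (Sigma UNIV G)"
    by (auto simp: inj_on_def inj_eq[OF p] inj_eq[OF t])
  then have sm: "Sigma UNIV G \<lesssim> (UNIV :: 'u set)" by (auto simp: lepoll_def)
  define one' where "one' = (\<lambda>_ :: nat \<times> 'u. 1 :: nat)"
  define ev where "ev = (\<lambda>(i :: 'u law \<times> (nat \<Rightarrow> 'u \<Rightarrow> 'u)) (n, x). snd i n x)"
  have one': "one' y = 1" for y by (simp add: one'_def)
  have ev: "ev i (n, x) = snd i n x" for i n x by (simp add: ev_def)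
  interpret free_law_family I fst "Sigma UNIV G" fst one' ev
    by unfold_locales (use inf sm ID in \<open>auto simp: law_sig_def PiE_iff one' ev\<close>)
  let ?e = "\<lambda>n. \<lambda>x\<in>G n. gen1 (n, x)"
  have e: "?e n \<in> G n \<rightarrow>\<^sub>E law_sig free_law n" for n
    using gen1_hom by (auto simp: law_sig_def one')
  have "universal_arrow Law Sig law_sig law_sig_arr G (free_law, (G, ?e, law_sig free_law))"
    unfolding universal_arrow_def
  proof (clarsimp, intro conjI allI impI ballI)
    show "is_law free_law" by (rule law_free)
    show "(G, ?e, law_sig free_law) \<in> hom Sig G (law_sig free_law)" using e by (simp add: sig_hom)
    fix L :: "'u law" and f assume L: "is_law L" and f: "f \<in> hom Sig G (law_sig L)"
    obtain k where k: "f = (G, k, law_sig L)" "\<And>n. k n \<in> G n \<rightarrow>\<^sub>E law_sig L n" using f by (auto simp: sig_hom)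
    have i: "(L, k) \<in> I" using L k by (simp add: I_def)
    note pm = proj_law_maps[OF i, unfolded fst_conv]
    let ?m = "restrict (proj1 (L, k)) (Arr free_one)"
    have gl: "gen1 (n, x) \<in> law_sig free_law n" if "x \<in> G n" for n x
      using gen1_hom[of "(n, x)"] that by (simp add: law_sig_def one')
    show "\<exists>!g. g \<in> hom Law free_law L \<and> Cmp Sig (law_sig_arr g) (G, ?e, law_sig free_law) = f"
    proof (rule ex1I[of _ "(free_law, ?m, L)"], intro conjI)
      show "(free_law, ?m, L) \<in> hom Law free_law L" using law_free L pm by (simp add: law_hom)
      have "compose (G n) (restrict ?m (law_sig free_law n)) (?e n) = k n" for n
        using k(2)[of n] proj_gen(1)[OF i] gen1_arr gl
        by (auto simp: ev compose_def restrict_def fun_eq_iff PiE_iff extensional_def)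
      then show "Cmp Sig (law_sig_arr (free_law, ?m, L)) (G, ?e, law_sig free_law) = f"
        by (simp add: law_sig_arr_def k(1))
    next
      fix g assume g: "g \<in> hom Law free_law L \<and> Cmp Sig (law_sig_arr g) (G, ?e, law_sig free_law) = f"
      then obtain m where m: "g = (free_law, m, L)" "m \<in> law_maps free_law L" by (auto simp: law_hom)
      have mk: "(\<lambda>n. compose (G n) (restrict m (law_sig free_law n)) (?e n)) = k"
        using g by (simp add: m law_sig_arr_def k(1))
      have "m = ?m"
      proof (rule free_law_unique[OF L m(2) pm])
        show "m (gen1 y) = ?m (gen1 y)" if y: "y \<in> Sigma UNIV G" for y
        proof -
          obtain n x where nx: "y = (n, x)" "x \<in> G n" using y by auto
          show ?thesis using fun_cong[OF fun_cong[OF mk, of n], of x] nx proj_gen(1)[OF i y] gen1_arr[OF y] gl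
            by (simp add: compose_def ev)
        qed
      qed
      then show "g = (free_law, ?m, L)" by (simp add: m)
    qed
  qed
  then show ?thesis by blast
qed

section \<open>Universal arrows\<close>

lemma free_on_universal:
  "\<exists>u. universal_arrow C B U0 U1 x u \<Longrightarrow> universal_arrow C B U0 U1 x (free_on C B U0 U1 x)"
  unfolding free_on_def by (rule someI_ex)

lemma universal_arrowD:
  assumes "universal_arrow C B U0 U1 x u"
  shows "fst u \<in> Obj C" "snd u \<in> hom B x (U0 (fst u))"
    "c \<in> Obj C \<Longrightarrow> f \<in> hom B x (U0 c) \<Longrightarrow> \<exists>!g. g \<in> hom C (fst u) c \<and> Cmp B (U1 g) (snd u) = f"
  using assms by (auto simp: universal_arrow_def split: prod.splits)

lemma induced:
  assumes "universal_arrow C B U0 U1 x u" "c \<in> Obj C" "f \<in> hom B x (U0 c)"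
  shows "induced C B U1 u c f \<in> hom C (fst u) c" "Cmp B (U1 (induced C B U1 u c f)) (snd u) = f"
  using theI'[OF universal_arrowD(3)[OF assms]] by (auto simp: induced_def)

lemma universal_eqI:
  assumes "universal_arrow C B U0 U1 x u" "is_functor C B U0 U1"
    and "g \<in> hom C (fst u) c" "g' \<in> hom C (fst u) c" "Cmp B (U1 g) (snd u) = Cmp B (U1 g') (snd u)"
  shows "g = g'"
proof -
  have C: "is_category C" and B: "is_category B" using functor_cats[OF assms(2)] by auto
  have "c \<in> Obj C" using cat_obj[OF C assms(3)] by simp
  moreover have "Cmp B (U1 g) (snd u) \<in> hom B x (U0 c)"
    by (rule cat_cmp[OF B universal_arrowD(2)[OF assms(1)] functor_hom[OF assms(2,3)]])
  ultimately show ?thesis using universal_arrowD(3)[OF assms(1)] assms(3-5) by metis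
qed

text \<open>Induced arrows compose because an arrow out of the free object is determined by its composite with the
  unit; so the choice of a free object on every \<open>x\<close> is the object part of a functor.\<close>

lemma left_adjoint_arr:
  assumes "universal_arrow C B U0 U1 x u" "universal_arrow C B U0 U1 y v" "is_category B" "k \<in> hom B x y"
  shows "induced C B U1 u (fst v) (Cmp B (snd v) k) \<in> hom C (fst u) (fst v)"
    "Cmp B (U1 (induced C B U1 u (fst v) (Cmp B (snd v) k))) (snd u) = Cmp B (snd v) k"
  using induced[OF assms(1) universal_arrowD(1)[OF assms(2)] cat_cmp[OF assms(3,4) universal_arrowD(2)[OF assms(2)]]]
  by auto

lemma left_adjoint_id:
  assumes "universal_arrow C B U0 U1 x u" "is_functor C B U0 U1" "x \<in> Obj B"
  shows "induced C B U1 u (fst u) (Cmp B (snd u) (Idt B x)) = Idt C (fst u)"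
proof -
  have C: "is_category C" and B: "is_category B" using functor_cats[OF assms(2)] by auto
  note u = universal_arrowD(1,2)[OF assms(1)]
  note l = left_adjoint_arr[OF assms(1,1) B cat_id[OF B assms(3)]]
  show ?thesis
    by (rule universal_eqI[OF assms(1,2) l(1) cat_id[OF C u(1)]])
      (use l(2) functor_id[OF assms(2) u(1)] cat_idr[OF B u(2)] cat_idl[OF B u(2)] in simp)
qed

lemma left_adjoint_cmp:
  assumes u: "universal_arrow C B U0 U1 x u" and v: "universal_arrow C B U0 U1 y v"
    and w: "universal_arrow C B U0 U1 z w" and U: "is_functor C B U0 U1"
    and k: "k \<in> hom B x y" and l: "l \<in> hom B y z"
  shows "induced C B U1 u (fst w) (Cmp B (snd w) (Cmp B l k)) =
    Cmp C (induced C B U1 v (fst w) (Cmp B (snd w) l)) (induced C B U1 u (fst v) (Cmp B (snd v) k))"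
proof -
  have C: "is_category C" and B: "is_category B" using functor_cats[OF U] by auto
  note K = left_adjoint_arr[OF u v B k] and L = left_adjoint_arr[OF v w B l]
    and KL = left_adjoint_arr[OF u w B cat_cmp[OF B k l]]
  note uu = universal_arrowD(2)[OF u] and vv = universal_arrowD(2)[OF v] and ww = universal_arrowD(2)[OF w]
  note UK = functor_hom[OF U K(1)] and UL = functor_hom[OF U L(1)]
  show ?thesis
    by (rule universal_eqI[OF u U KL(1) cat_cmp[OF C K(1) L(1)]])
      (use KL(2) functor_cmp[OF U K(1) L(1)] K(2) L(2) cat_assoc[OF B uu UK UL] cat_assoc[OF B k vv UL]
        cat_assoc[OF B k l ww] in metis)
qed


section \<open>The forgetful functors and the functors D\<close>

lemma law_maps_pro_maps:
  assumes "is_law L" "is_law L'" "h \<in> law_maps L L'"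
  shows "h \<in> pro_maps (law_pro L) (law_pro L')"
proof -
  interpret lawv_map "lcat L" "lfin L" "lcat L'" "lfin L'" h using law_maps_iff[OF assms(1,2)] assms(3) by simp
  show ?thesis using assms(3) map_prod_arr[OF arr_hom arr_hom] funct by (simp add: pro_maps_def law_maps_def)
qed

lemma law_pro_functor: "is_functor Law Pro law_pro law_pro_arr"
proof (rule is_functorI[OF Law_category Pro_category])
  show "law_pro L \<in> Obj Pro" if "L \<in> Obj Law" for L :: "'u law" using that law_pro by simp
  show "law_pro_arr (Idt Law L) = Idt Pro (law_pro L)" for L :: "'u law" by (simp add: law_pro_arr_def)
  show "law_pro_arr f \<in> hom Pro (law_pro A) (law_pro B)" if "f \<in> hom Law A B" for f and A B :: "'u law"
    using that law_maps_pro_maps law_pro by (auto simp: law_hom pro_hom law_pro_arr_def)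
  show "law_pro_arr (Cmp Law g f) = Cmp Pro (law_pro_arr g) (law_pro_arr f)"
    if "f \<in> hom Law A B" "g \<in> hom Law B C" for f g and A B C :: "'u law"
    using that by (auto simp: law_hom law_pro_arr_def)
qed

lemma law_sig_functor: "is_functor Law Sig law_sig law_sig_arr"
proof (rule is_functorI[OF Law_category Sig_category])
  have h: "h \<in> law_sig A n \<rightarrow> law_sig B n" if "h \<in> law_maps A B" for h n and A B :: "'u law"
    using that functor_hom[of "lcat A" "lcat B" "\<lambda>n. n" h] by (auto simp: law_maps_def law_sig_def)
  show "law_sig L \<in> Obj Sig" for L :: "'u law" by simp
  show "law_sig_arr (Idt Law L) = Idt Sig (law_sig L)" for L :: "'u law"
    by (auto simp: law_sig_arr_def law_sig_def in_hom restrict_def fun_eq_iff)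
  show "law_sig_arr f \<in> hom Sig (law_sig A) (law_sig B)" if f: "f \<in> hom Law A B" for f and A B :: "'u law"
  proof -
    obtain m where m: "f = (A, m, B)" "m \<in> law_maps A B" using f by (auto simp: law_hom)
    have "m x \<in> law_sig B n" if "x \<in> law_sig A n" for x n using h[OF m(2)] that by blast
    then show ?thesis by (simp add: m(1) sig_hom law_sig_arr_def)
  qed
  show "law_sig_arr (Cmp Law g f) = Cmp Sig (law_sig_arr g) (law_sig_arr f)"
    if fg: "f \<in> hom Law A B" "g \<in> hom Law B C" for f g and A B C :: "'u law"
  proof -
    obtain a b where ab: "f = (A, a, B)" "a \<in> law_maps A B" "g = (B, b, C)" using fg by (auto simp: law_hom)
    have "a x \<in> law_sig B n" "x \<in> Arr (lcat A)" if "x \<in> law_sig A n" for x n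
      using h[OF ab(2), of n] that by (auto simp: law_sig_def in_hom)
    then show ?thesis by (auto simp: ab law_sig_arr_def compose_def restrict_def fun_eq_iff)
  qed
qed

lemma law2_catpro_functor: "is_functor TwoLaw CatPro law2_catpro law2_catpro_arr"
proof (rule is_functorI[OF TwoLaw_category CatPro_category])
  have c: "is_catpro (law2_catpro L)" if "is_law2 L" for L :: "('u, 'u cells) law2"
    using law2.catpro[of L] that by (simp add: law2_def)
  show "law2_catpro L \<in> Obj CatPro" if "L \<in> Obj TwoLaw" for L :: "('u, 'u cells) law2" using that c by simp
  show "law2_catpro_arr (Idt TwoLaw L) = Idt CatPro (law2_catpro L)" for L :: "('u, 'u cells) law2"
    by (simp add: law2_catpro_arr_def)
  show "law2_catpro_arr f \<in> hom CatPro (law2_catpro A) (law2_catpro B)" if "f \<in> hom TwoLaw A B"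
    for f and A B :: "('u, 'u cells) law2"
    using that law2_maps_catpro c by (auto simp: law2_hom catpro_hom law2_catpro_arr_def)
  show "law2_catpro_arr (Cmp TwoLaw g f) = Cmp CatPro (law2_catpro_arr g) (law2_catpro_arr f)"
    if "f \<in> hom TwoLaw A B" "g \<in> hom TwoLaw B C" for f g and A B C :: "('u, 'u cells) law2"
    using that by (auto simp: law2_hom law2_catpro_arr_def)
qed

lemma D_map_simps [simp]: "fst (D_map C h) = h" "snd (D_map C h) = restrict (map_prod h h) (Arr (two C))"
  by (simp_all add: D_map_def)

lemma thick_catpro_simps [simp]:
  "cpcat (thick_catpro P K) = thick_cat2 (pcat P) K" "tens1 (thick_catpro P K) = ptens P"
  "\<alpha> \<in> pairs K \<Longrightarrow> \<beta> \<in> pairs K \<Longrightarrow>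
    tens2 (thick_catpro P K) \<alpha> \<beta> = (ptens P (fst \<alpha>) (fst \<beta>), ptens P (snd \<alpha>) (snd \<beta>))"
  by (simp_all add: thick_catpro_def)

lemma thick_catpro_map:
  assumes "thick (pcat P) K" "thick (pcat P') K'" "is_catpro (thick_catpro P K)"
    and h: "h \<in> pro_maps P P'" and R: "\<And>f g. (f, g) \<in> pairs K \<Longrightarrow> (h f, h g) \<in> pairs K'"
  shows "D_map (thick_cat2 (pcat P) K) h \<in> catpro_maps (thick_catpro P K) (thick_catpro P' K')"
proof (rule catpro_mapsI)
  interpret thick "pcat P" K by (rule assms(1))
  let ?F = "D_map (thick_cat2 (pcat P) K) h"
  show "is_2functor (cpcat (thick_catpro P K)) (cpcat (thick_catpro P' K')) ?F"
    using D_map_2functor[OF assms(1,2) _ R] h by (simp add: pro_maps_def)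
  fix \<alpha> \<beta> assume "\<alpha> \<in> Arr (two (cpcat (thick_catpro P K)))" "\<beta> \<in> Arr (two (cpcat (thick_catpro P K)))"
  then have ab: "\<alpha> \<in> pairs K" "\<beta> \<in> pairs K" by simp_all
  have t: "tens2 (thick_catpro P K) \<alpha> \<beta> \<in> pairs K"
    using catpro_tens(2)[OF assms(3), of \<alpha> \<beta>] ab by simp
  have "(h (fst x), h (snd x)) \<in> pairs K'" if "x \<in> pairs K" for x using R[of "fst x" "snd x"] that by simp
  then show "snd ?F (tens2 (thick_catpro P K) \<alpha> \<beta>) = tens2 (thick_catpro P' K') (snd ?F \<alpha>) (snd ?F \<beta>)"
    using t ab R_arr[of "fst \<alpha>" "snd \<alpha>"] R_arr[of "fst \<beta>" "snd \<beta>"] h by (simp add: map_prod_def case_prod_unfold pro_maps_def)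
qed (use h in \<open>auto simp: pro_maps_def\<close>)

lemma D_map_comp:
  assumes "thick C K" "\<And>f g. (f, g) \<in> pairs K \<Longrightarrow> (h f, h g) \<in> pairs K'"
  shows "comp_pair (thick_cat2 C K) (D_map (thick_cat2 C' K') h') (D_map (thick_cat2 C K) h) =
    D_map (thick_cat2 C K) (compose (Arr C) h' h)"
proof -
  interpret thick C K by (rule assms(1))
  have "(h (fst x), h (snd x)) \<in> pairs K'" "fst x \<in> Arr C" "snd x \<in> Arr C" if "x \<in> pairs K" for x
    using assms(2)[of "fst x" "snd x"] R_arr[of "fst x" "snd x"] that by auto
  then show ?thesis
    by (auto simp: comp_pair_def case_prod_unfold prod_eq_iff compose_def restrict_def fun_eq_iff)
qed

lemma D_map_id:
  assumes "thick C K"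
  shows "D_map (thick_cat2 C K) (\<lambda>f\<in>Arr C. f) = id_pair (thick_cat2 C K)"
proof -
  interpret thick C K by (rule assms(1))
  show ?thesis using R_arr by (auto simp: id_pair_def prod_eq_iff restrict_def fun_eq_iff)
qed

lemma pro_thick: "is_pro P \<Longrightarrow> thick (pcat P) (singletons (Arr (pcat P)))"
  by (rule discrete_thick[OF pro_cat])

lemma singletons_map: "h \<in> pro_maps P P' \<Longrightarrow> (f, g) \<in> pairs (singletons (Arr (pcat P))) \<Longrightarrow>
    (h f, h g) \<in> pairs (singletons (Arr (pcat P')))"
  using functor_hom[of "pcat P" "pcat P'" "\<lambda>n. n" h, OF _ arr_hom]
  unfolding singletons_R by (auto simp: pro_maps_def in_hom Id_on_iff)

lemma D_pro_functor: "is_functor Pro CatPro D_pro D_pro_arr"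
proof (rule is_functorI[OF Pro_category CatPro_category])
  show "D_pro P \<in> Obj CatPro" if "P \<in> Obj Pro" for P :: "'u pro" using that D_pro by simp
  show "D_pro_arr (Idt Pro P) = Idt CatPro (D_pro P)" if "P \<in> Obj Pro" for P :: "'u pro"
    using that D_map_id[OF pro_thick] by (simp add: D_pro_arr_def D_pro_def)
  show "D_pro_arr f \<in> hom CatPro (D_pro A) (D_pro B)" if f: "f \<in> hom Pro A B" for f and A B :: "'u pro"
  proof -
    obtain h where h: "f = (A, h, B)" "is_pro A" "is_pro B" "h \<in> pro_maps A B" using f by (auto simp: pro_hom)
    have "D_map (cpcat (D_pro A)) h \<in> catpro_maps (D_pro A) (D_pro B)"
      unfolding D_pro_def thick_catpro_simps
      by (rule thick_catpro_map[OF pro_thick[OF h(2)] pro_thick[OF h(3)] D_pro[OF h(2), unfolded D_pro_def] h(4)])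
        (rule singletons_map[OF h(4)])
    then show ?thesis using D_pro[OF h(2)] D_pro[OF h(3)] by (simp add: h(1) catpro_hom D_pro_arr_def)
  qed
  show "D_pro_arr (Cmp Pro g f) = Cmp CatPro (D_pro_arr g) (D_pro_arr f)"
    if fg: "f \<in> hom Pro A B" "g \<in> hom Pro B C" for f g and A B C :: "'u pro"
  proof -
    obtain a b where ab: "f = (A, a, B)" "a \<in> pro_maps A B" "g = (B, b, C)" "is_pro A" using fg by (auto simp: pro_hom)
    show ?thesis
      using D_map_comp[where h' = b and C' = "pcat B" and K' = "singletons (Arr (pcat B))",
          OF pro_thick[OF ab(4)] singletons_map[OF ab(2)]]
      by (simp add: ab D_pro_arr_def) (simp add: D_pro_def)
  qed
qed

lemma D_law_simps [simp]: "l2cat (D_law L) = thick_cat2 (lcat L) (singletons (Arr (lcat L)))" "l2fin (D_law L) = lfin L"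
  by (simp_all add: D_law_def)

lemma law_thick: "is_law L \<Longrightarrow> thick (lcat L) (singletons (Arr (lcat L)))"
  using pro_thick[OF law_pro] by simp

lemma D_law_functor: "is_functor Law TwoLaw D_law D_law_arr"
proof (rule is_functorI[OF Law_category TwoLaw_category])
  show "D_law L \<in> Obj TwoLaw" if "L \<in> Obj Law" for L :: "'u law" using that D_law by simp
  show "D_law_arr (Idt Law L) = Idt TwoLaw (D_law L)" if "L \<in> Obj Law" for L :: "'u law"
    using that D_map_id[OF law_thick] by (simp add: D_law_arr_def)
  show "D_law_arr f \<in> hom TwoLaw (D_law A) (D_law B)" if f: "f \<in> hom Law A B" for f and A B :: "'u law"
  proof -
    obtain h where h: "f = (A, h, B)" "is_law A" "is_law B" "h \<in> law_maps A B" using f by (auto simp: law_hom)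
    note hp = law_maps_pro_maps[OF h(2-4)]
    have "is_2functor (l2cat (D_law A)) (l2cat (D_law B)) (D_map (l2cat (D_law A)) h)"
      using D_map_2functor[OF law_thick[OF h(2)] law_thick[OF h(3)] _ singletons_map[OF hp, simplified]] hp
      by (simp add: pro_maps_def)
    moreover have "h (lfin A x) = lfin B x" if "x \<in> Arr FF" for x using h(4) that by (simp add: law_maps_def)
    ultimately have "law2_map (D_law A) (D_law B) (D_map (l2cat (D_law A)) h)"
      using D_law[OF h(2)] D_law[OF h(3)] by unfold_locales simp_all
    moreover have "h \<in> extensional (Arr (lcat A))" using h(4) by (simp add: law_maps_def)
    ultimately have "D_map (l2cat (D_law A)) h \<in> law2_maps (D_law A) (D_law B)"
      using law2_maps_iff[OF D_law[OF h(2)] D_law[OF h(3)]] by simp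
    then show ?thesis using D_law[OF h(2)] D_law[OF h(3)] h by (simp add: D_law_arr_def law2_hom)
  qed
  show "D_law_arr (Cmp Law g f) = Cmp TwoLaw (D_law_arr g) (D_law_arr f)"
    if fg: "f \<in> hom Law A B" "g \<in> hom Law B C" for f g and A B C :: "'u law"
  proof -
    obtain a b where ab: "f = (A, a, B)" "a \<in> law_maps A B" "g = (B, b, C)" "is_law A" "is_law B"
      using fg by (auto simp: law_hom)
    show ?thesis
      using D_map_comp[where h' = b and C' = "lcat B" and K' = "singletons (Arr (lcat B))",
          OF law_thick[OF ab(4)] singletons_map[OF law_maps_pro_maps[OF ab(4,5,2)], simplified]]
      by (simp add: ab D_law_arr_def)
  qed
qed

text \<open>A true equality of structures: both tensor products are \<open>undefined\<close> away from the 2-cells, and on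
  2-cells, which are all identities, they are determined by the tensor product of 1-cells.\<close>

lemma law2_catpro_D_law:
  assumes L: "is_law L"
  shows "law2_catpro (D_law L) = D_pro (law_pro L)"
proof -
  interpret law2 "D_law L" by unfold_locales (rule D_law[OF L])
  interpret T: thick "lcat L" "singletons (Arr (lcat L))" by (rule law_thick[OF L])
  have "prod_arr C2 j2 \<alpha> \<beta> = tens2 (D_pro (law_pro L)) \<alpha> \<beta>" for \<alpha> \<beta>
  proof (cases "\<alpha> \<in> Arr C2 \<and> \<beta> \<in> Arr C2")
    case True
    then obtain f g where fg: "\<alpha> = (f, f)" "\<beta> = (g, g)" "f \<in> Arr (lcat L)" "g \<in> Arr (lcat L)"
      by (auto simp: singletons_R)
    note p = L1.prod_arr[of f _ _ g, simplified, OF arr_hom[OF fg(3)] arr_hom[OF fg(4)]]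
    have R: "(x, x) \<in> pairs (singletons (Arr (lcat L)))" if "x \<in> hom (lcat L) n k" for x n k
      using that by (simp add: singletons_R in_hom Id_on_iff)
    have "prod_arr C2 j2 \<alpha> \<beta> = (prod_arr (lcat L) (lfin L) f g, prod_arr (lcat L) (lfin L) f g)"
      by (rule L2.prod_arr_eqI[of _ "Src (lcat L) f" "Tgt (lcat L) f" _ "Src (lcat L) g" "Tgt (lcat L) g"])
        (use fg p R[OF p(1)] R[OF arr_hom[OF fg(3)]] R[OF arr_hom[OF fg(4)]] arr_hom in \<open>auto simp: T.two_hom\<close>)
    then show ?thesis using True fg by (simp add: D_pro_def)
  next
    case False
    then have "tens2 (D_pro (law_pro L)) \<alpha> \<beta> = undefined" by (auto simp: D_pro_def thick_catpro_def)
    then show ?thesis unfolding prod_arr_def using if_not_P[OF False] by metis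
  qed
  then have "prod_arr C2 j2 = tens2 (D_pro (law_pro L))" by (intro ext)
  then show ?thesis unfolding law2_catpro_def by (simp add: D_pro_def thick_catpro_def)
qed

lemma law2_catpro_arr_D:
  assumes "m \<in> hom Law L L'"
  shows "law2_catpro_arr (D_law_arr m) = D_pro_arr (law_pro_arr m)"
  using assms law2_catpro_D_law
  by (auto simp: law_hom law2_catpro_arr_def D_law_arr_def law_pro_arr_def D_pro_arr_def) (simp_all add: D_pro_def)

text \<open>The identities of the objects \<open>0, 1, 2, \<dots>\<close> are distinct.\<close>

lemma pro_infinite: "is_pro P \<Longrightarrow> infinite (UNIV :: 'u set)" for P :: "'u pro"
proof -
  assume P: "is_pro P"
  have "Idt (pcat P) n \<in> hom (pcat P) n n" for n using cat_id[OF pro_cat(1)[OF P]] pro_cat(2)[OF P] by simp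
  then have "inj (Idt (pcat P))" by (auto simp: inj_def in_hom) metis
  then show ?thesis using finite_imageD infinite_UNIV_nat finite_subset[OF subset_UNIV] by metis
qed

lemma LP_universal: "is_pro P \<Longrightarrow> universal_arrow Law Pro law_pro law_pro_arr P (LP_univ P)"
  unfolding LP_univ_def using free_on_universal[OF LP_exists[OF pro_infinite]] .

lemma LP_law: "is_pro P \<Longrightarrow> is_law (LP P)"
  using universal_arrowD(1)[OF LP_universal] by (simp add: LP_def)

text \<open>A 2-functor out of a discrete 2-category sends every 2-cell to an identity, so that maps of 2-theories
  \<open>D L \<rightarrow> M\<close> are maps of Lawvere theories from \<open>L\<close> to the 1-cells of \<open>M\<close>, and likewise for
  maps of Cat-pros out of \<open>D P\<close>.  The universal property of \<open>LP P\<close> therefore passes to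
  \<open>D (LP P)\<close>; this is what makes the map \<open>incl_ind\<close> exist and be unique.\<close>

lemma D_LP_universal:
  fixes P :: "'u pro"
  assumes P: "is_pro P"
  shows "universal_arrow TwoLaw CatPro law2_catpro law2_catpro_arr (D_pro P)
    (D_law (LP P), D_pro_arr (snd (LP_univ P)))"
proof -
  note LP = LP_law[OF P] and lu = LP_universal[OF P]
  have eta: "snd (LP_univ P) \<in> hom Pro P (law_pro (LP P))"
    using universal_arrowD(2)[OF lu] by (simp add: LP_def)
  then obtain e where e: "snd (LP_univ P) = (P, e, law_pro (LP P))" "e \<in> pro_maps P (law_pro (LP P))"
    by (auto simp: pro_hom)
  have eA: "e f \<in> Arr (lcat (LP P))" if "f \<in> Arr (pcat P)" for f
    using e(2) functor_hom[of "pcat P" "lcat (LP P)" "\<lambda>n. n" e, OF _ arr_hom[OF that]] by (simp add: pro_maps_def in_hom)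
  have eta2: "D_pro_arr (snd (LP_univ P)) \<in> hom CatPro (D_pro P) (law2_catpro (D_law (LP P)))"
    using functor_hom[OF D_pro_functor eta] law2_catpro_D_law[OF LP] by simp
  let ?L = "LP P"
  show ?thesis unfolding universal_arrow_def
  proof (clarsimp, intro conjI allI impI ballI)
    show "is_law2 (D_law ?L)" by (rule D_law[OF LP])
    show "D_pro_arr (snd (LP_univ P)) \<in> hom CatPro (D_pro P) (law2_catpro (D_law ?L))" by (rule eta2)
    fix M :: "('u, 'u cells) law2" and f assume M: "is_law2 M" and f: "f \<in> hom CatPro (D_pro P) (law2_catpro M)"
    interpret M: law2 M by unfold_locales (rule M)
    obtain k where k: "f = (D_pro P, k, law2_catpro M)" "k \<in> catpro_maps (D_pro P) (law2_catpro M)"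
      using f by (auto simp: catpro_hom)
    note kD = catpro_mapsD[OF k(2)]
    have kf: "is_2functor (thick_cat2 (pcat P) (singletons (Arr (pcat P)))) (l2cat M) k"
      using kD(3) by (simp add: D_pro_def)
    let ?N = "\<lparr>lcat = M.C1, lfin = M.j1\<rparr> :: 'u law"
    have N: "is_law ?N" using M.L1.law .
    have "fst k \<in> pro_maps P (law_pro ?N)"
      using kD(1,4) kf by (simp add: pro_maps_def D_pro_def twofunctor_iff)
    then have kN: "(P, fst k, law_pro ?N) \<in> hom Pro P (law_pro ?N)" using P law_pro[OF N] by (simp add: pro_hom)
    obtain g where g: "g \<in> hom Law ?L ?N" "Cmp Pro (law_pro_arr g) (snd (LP_univ P)) = (P, fst k, law_pro ?N)"
      using universal_arrowD(3)[OF lu _ kN] N by (auto simp: LP_def)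
    then obtain m where m: "g = (?L, m, ?N)" "m \<in> law_maps ?L ?N" by (auto simp: law_hom)
    have me: "m (e x) = fst k x" if "x \<in> Arr (pcat P)" for x
    proof -
      have "compose (Arr (pcat P)) m e = fst k" using g(2) by (simp add: m e law_pro_arr_def)
      from fun_cong[OF this, of x] that show ?thesis by (simp add: compose_def)
    qed
    interpret m: lawv_map "lcat ?L" "lfin ?L" M.C1 M.j1 m using m(2) law_maps_iff[OF LP N] by simp
    let ?m = "(m, \<lambda>\<alpha>\<in>Id_on (Arr (lcat ?L)). Idt M.CV (m (fst \<alpha>)))"
    have mm: "?m \<in> law2_maps (D_law ?L) M"
    proof -
      have "is_2functor (l2cat (D_law ?L)) (l2cat M) ?m"
        using functor_from_discrete[OF m.A.cat m.A.objs M.c2 m.funct] by simp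
      then have "law2_map (D_law ?L) M ?m"
        using D_law[OF LP] by unfold_locales (simp_all add: m.fin)
      moreover have "m \<in> extensional (Arr (lcat ?L))" using m(2) by (simp add: law_maps_def)
      ultimately show ?thesis using law2_maps_iff[OF D_law[OF LP] M] by (simp add: singletons_R)
    qed
    have D1: "Cmp CatPro (law2_catpro_arr (D_law ?L, w, M)) (D_pro_arr (snd (LP_univ P))) = f \<longleftrightarrow>
      (\<forall>x\<in>Arr (pcat P). fst w (e x) = fst k x \<and> snd w (e x, e x) = snd k (x, x))" for w
    proof -
      have "Cmp CatPro (law2_catpro_arr (D_law ?L, w, M)) (D_pro_arr (snd (LP_univ P))) = f \<longleftrightarrow>
        comp_pair (cpcat (D_pro P)) w (D_map (cpcat (D_pro P)) e) = k"
        by (simp add: k(1) e(1) law2_catpro_arr_def D_pro_arr_def)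
      also have "\<dots> \<longleftrightarrow> (\<forall>x\<in>Arr (pcat P). fst w (e x) = fst k x \<and> snd w (e x, e x) = snd k (x, x))"
        using kD(1,2)
        by (auto simp: D_pro_def singletons_R comp_pair_def case_prod_unfold prod_eq_iff compose_def
            restrict_def fun_eq_iff extensional_def Id_on_iff)
      finally show ?thesis .
    qed
    show "\<exists>!g. g \<in> hom TwoLaw (D_law ?L) M \<and> Cmp CatPro (law2_catpro_arr g) (D_pro_arr (snd (LP_univ P))) = f"
    proof (rule ex1I[of _ "(D_law ?L, ?m, M)"], intro conjI)
      show "(D_law ?L, ?m, M) \<in> hom TwoLaw (D_law ?L) M" using D_law[OF LP] M mm by (simp add: law2_hom)
      show "Cmp CatPro (law2_catpro_arr (D_law ?L, ?m, M)) (D_pro_arr (snd (LP_univ P))) = f"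
        unfolding D1 using functor_from_discrete_unique[OF kf] me eA by (simp add: Id_on_iff)
    next
      fix w assume w: "w \<in> hom TwoLaw (D_law ?L) M \<and> Cmp CatPro (law2_catpro_arr w) (D_pro_arr (snd (LP_univ P))) = f"
      then obtain v where v: "w = (D_law ?L, v, M)" "v \<in> law2_maps (D_law ?L) M" by (auto simp: law2_hom)
      interpret v: law2_map "D_law ?L" M v using v(2) law2_maps_iff[OF D_law[OF LP] M] by simp
      have vx: "fst v \<in> extensional (Arr (lcat ?L))" "snd v \<in> extensional (Id_on (Arr (lcat ?L)))"
        using v(2) law2_maps_iff[OF D_law[OF LP] M] by (simp_all add: singletons_R)
      have "fst v \<in> law_maps ?L ?N" using law_maps_iff[OF LP N] vx(1) v.M1.lawv_map_axioms by simp
      then have "(?L, fst v, ?N) \<in> hom Law ?L ?N" using LP N by (simp add: law_hom)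
      moreover have "Cmp Pro (law_pro_arr (?L, fst v, ?N)) (snd (LP_univ P)) = (P, fst k, law_pro ?N)"
        using w kD(1) unfolding v D1
        by (auto simp: e law_pro_arr_def D_pro_def compose_def restrict_def fun_eq_iff extensional_def)
      ultimately have "(?L, fst v, ?N) = g"
        using universal_eqI[OF lu law_pro_functor, of "(?L, fst v, ?N)" ?N g] g by (simp add: LP_def)
      then have vm: "fst v = m" by (simp add: m)
      have "snd v = snd ?m"
      proof (rule extensionalityI[OF vx(2)])
        fix \<alpha> assume "\<alpha> \<in> Id_on (Arr (lcat ?L))"
        then show "snd v \<alpha> = snd ?m \<alpha>"
          using functor_from_discrete_unique[OF v.f2[unfolded D_law_simps], of "fst \<alpha>"] vm by (auto simp: Id_on_iff)
      qed simp
      then show "w = (D_law ?L, ?m, M)" using vm by (simp add: v prod_eq_iff)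
    qed
  qed
qed

section \<open>Controlled theories\<close>

lemma Fr_universal: "infinite (UNIV :: 'u set) \<Longrightarrow> universal_arrow Law Sig law_sig law_sig_arr G (Fr_univ G)"
  for G :: "'u sig"
  unfolding Fr_univ_def by (rule free_on_universal[OF Fr_exists])

lemma LCat_universal: "infinite (UNIV :: 'u set) \<Longrightarrow> is_catpro Q \<Longrightarrow>
    universal_arrow TwoLaw CatPro law2_catpro law2_catpro_arr Q (LCat_univ Q)"
  for Q :: "('u, 'u cells) catpro"
  unfolding LCat_univ_def by (rule free_on_universal[OF LCat_exists])

lemma LCat_arr:
  fixes K :: "'u catpro_arrow"
  assumes inf: "infinite (UNIV :: 'u set)" and K: "K \<in> hom CatPro Q Q'"
  shows "LCat_arr K \<in> hom TwoLaw (LCat Q) (LCat Q')"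
    "Cmp CatPro (law2_catpro_arr (LCat_arr K)) (snd (LCat_univ Q)) = Cmp CatPro (snd (LCat_univ Q')) K"
proof -
  have Q: "is_catpro Q" "is_catpro Q'" using cat_obj[OF CatPro_category K] by auto
  show "LCat_arr K \<in> hom TwoLaw (LCat Q) (LCat Q')"
    "Cmp CatPro (law2_catpro_arr (LCat_arr K)) (snd (LCat_univ Q)) = Cmp CatPro (snd (LCat_univ Q')) K"
    using left_adjoint_arr[OF LCat_universal[OF inf Q(1)] LCat_universal[OF inf Q(2)] CatPro_category K] K
    by (simp_all add: LCat_arr_def LCat_def in_hom)
qed

lemma LCat_arr_id:
  assumes "infinite (UNIV :: 'u set)" "is_catpro (Q :: ('u, 'u cells) catpro)"
  shows "LCat_arr (Idt CatPro Q) = Idt TwoLaw (LCat Q)"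
  using left_adjoint_id[OF LCat_universal[OF assms] law2_catpro_functor] assms(2)
  by (simp add: LCat_arr_def LCat_def)

lemma LCat_arr_cmp:
  fixes K :: "'u catpro_arrow"
  assumes inf: "infinite (UNIV :: 'u set)" and K: "K \<in> hom CatPro Q Q'" and K': "K' \<in> hom CatPro Q' Q''"
  shows "LCat_arr (Cmp CatPro K' K) = Cmp TwoLaw (LCat_arr K') (LCat_arr K)"
proof -
  have Q: "is_catpro Q" "is_catpro Q'" "is_catpro Q''"
    using cat_obj[OF CatPro_category K] cat_obj[OF CatPro_category K'] by auto
  show ?thesis
    using left_adjoint_cmp[OF LCat_universal[OF inf Q(1)] LCat_universal[OF inf Q(2)] LCat_universal[OF inf Q(3)]
        law2_catpro_functor K K'] K K' cat_cmp[OF CatPro_category K K']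
    by (simp add: LCat_arr_def LCat_def in_hom)
qed

lemma Fr_law: "infinite (UNIV :: 'u set) \<Longrightarrow> is_law (Fr (G :: 'u sig))"
  using universal_arrowD(1)[OF Fr_universal] by (simp add: Fr_def)

lemma Fr_arr_hom:
  fixes J :: "'u sig_arrow"
  assumes inf: "infinite (UNIV :: 'u set)" and J: "J \<in> hom Sig G G'"
  shows "Fr_arr J \<in> hom Law (Fr G) (Fr G')"
  using left_adjoint_arr(1)[OF Fr_universal[OF inf] Fr_universal[OF inf] Sig_category J] J
  by (simp add: Fr_arr_def Fr_def in_hom)

lemma Fr_arr_id:
  assumes "infinite (UNIV :: 'u set)"
  shows "Fr_arr (Idt Sig (G :: 'u sig)) = Idt Law (Fr G)"
  using left_adjoint_id[OF Fr_universal[OF assms] law_sig_functor, of G]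
  by (simp add: Fr_arr_def Fr_def)

lemma Fr_arr_cmp:
  fixes J :: "'u sig_arrow"
  assumes inf: "infinite (UNIV :: 'u set)" and J: "J \<in> hom Sig G G'" and J': "J' \<in> hom Sig G' G''"
  shows "Fr_arr (Cmp Sig J' J) = Cmp Law (Fr_arr J') (Fr_arr J)"
  using left_adjoint_cmp[OF Fr_universal[OF inf] Fr_universal[OF inf] Fr_universal[OF inf] law_sig_functor J J']
    J J' cat_cmp[OF Sig_category J J']
  by (simp add: Fr_arr_def Fr_def in_hom)

text \<open>The kernel of a functor that is the identity on objects is a congruence, even if only parallel arrows are
  identified.\<close>

lemma kernel_thick:
  assumes P: "is_pro P" and s: "is_functor (pcat P) C (\<lambda>n. n) \<sigma>"
    and K: "\<Union>K = Arr (pcat P)"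
    and R: "\<And>f g. (f, g) \<in> pairs K \<longleftrightarrow> f \<in> Arr (pcat P) \<and> g \<in> Arr (pcat P) \<and>
      Src (pcat P) f = Src (pcat P) g \<and> Tgt (pcat P) f = Tgt (pcat P) g \<and> \<sigma> f = \<sigma> g"
  shows "thick (pcat P) K"
proof -
  have "\<sigma> (Cmp (pcat P) g f) = Cmp C (\<sigma> g) (\<sigma> f)"
    if "f \<in> Arr (pcat P)" "g \<in> Arr (pcat P)" "Tgt (pcat P) f = Src (pcat P) g" for f g
    using s that by (simp add: is_functor_def)
  then show ?thesis
    unfolding thick_def R using pro_cat[OF P] K by (auto simp: cmp_arr[OF pro_cat(1)[OF P]])
qed

locale ctheory =
  fixes \<Omega> :: "'u ctheory"
  assumes ct: "is_ctheory \<Omega>"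
begin

abbreviation "P \<equiv> cpro \<Omega>"
abbreviation "\<iota> \<equiv> data (cinc \<Omega>)"
abbreviation "st \<equiv> data (cst \<Omega>)"

lemma pro: "is_pro P" and law: "is_law (claw \<Omega>)"
  and cinc_hom: "cinc \<Omega> \<in> hom Pro P (law_pro (Fr (csig \<Omega>)))"
  and cst_hom: "cst \<Omega> \<in> hom Law (Fr (csig \<Omega>)) (claw \<Omega>)"
  using ct by (simp_all add: is_ctheory_def)

lemma inf: "infinite (UNIV :: 'u set)"
  by (rule pro_infinite[OF pro])

lemma st_functor: "is_functor (pcat P) (lcat (claw \<Omega>)) (\<lambda>n. n) (\<lambda>f. st (\<iota> f))"
  and st_tens: "f \<in> Arr (pcat P) \<Longrightarrow> g \<in> Arr (pcat P) \<Longrightarrow>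
    st (\<iota> (ptens P f g)) = prod_arr (lcat (claw \<Omega>)) (lfin (claw \<Omega>)) (st (\<iota> f)) (st (\<iota> g))"
proof -
  obtain i where i: "cinc \<Omega> = (P, i, law_pro (Fr (csig \<Omega>)))" "i \<in> pro_maps P (law_pro (Fr (csig \<Omega>)))"
    using cinc_hom by (auto simp: pro_hom)
  obtain s where s: "cst \<Omega> = (Fr (csig \<Omega>), s, claw \<Omega>)" "s \<in> law_maps (Fr (csig \<Omega>)) (claw \<Omega>)"
    using cst_hom by (auto simp: law_hom)
  interpret s: lawv_map "lcat (Fr (csig \<Omega>))" "lfin (Fr (csig \<Omega>))" "lcat (claw \<Omega>)" "lfin (claw \<Omega>)" s
    using s(2) law_maps_iff[OF Fr_law[OF inf] law] by simp
  have fi: "is_functor (pcat P) (lcat (Fr (csig \<Omega>))) (\<lambda>n. n) i" using i(2) by (simp add: pro_maps_def)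
  show "is_functor (pcat P) (lcat (claw \<Omega>)) (\<lambda>n. n) (\<lambda>f. st (\<iota> f))"
    using functor_compose[OF fi s.funct] by (simp add: i s)
  show "st (\<iota> (ptens P f g)) = prod_arr (lcat (claw \<Omega>)) (lfin (claw \<Omega>)) (st (\<iota> f)) (st (\<iota> g))"
    if fg: "f \<in> Arr (pcat P)" "g \<in> Arr (pcat P)"
    using s.map_prod_arr[OF functor_hom[OF fi arr_hom[OF fg(1)]] functor_hom[OF fi arr_hom[OF fg(2)]]] i(2) fg
    by (simp add: i(1) s(1) pro_maps_def)
qed

lemma classes_R: "(f, g) \<in> pairs (classes \<Omega>) \<longleftrightarrow> f \<in> Arr (pcat P) \<and> g \<in> Arr (pcat P) \<and>
    Src (pcat P) f = Src (pcat P) g \<and> Tgt (pcat P) f = Tgt (pcat P) g \<and> st (\<iota> f) = st (\<iota> g)"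
  unfolding pairs_def classes_def cls_def Let_def by (auto simp: in_hom)

lemma classes_Union: "\<Union>(classes \<Omega>) = Arr (pcat P)"
  unfolding classes_def cls_def Let_def by (auto simp: in_hom)

lemma classes_thick: "thick (pcat P) (classes \<Omega>)"
  by (rule kernel_thick[OF pro st_functor classes_Union classes_R])

lemma Qpro: "is_catpro (Qpro \<Omega>)"
  unfolding Qpro_def
proof (rule thick_catpro[OF pro classes_thick])
  fix f g f' g' assume "(f, g) \<in> pairs (classes \<Omega>)" "(f', g') \<in> pairs (classes \<Omega>)"
  then show "(ptens P f f', ptens P g g') \<in> pairs (classes \<Omega>)"
    using pro_tens[OF pro, of f f'] pro_tens[OF pro, of g g'] st_tens[of f f'] st_tens[of g g']
    unfolding classes_R in_hom by simp
qed

lemma incl_hom: "incl \<Omega> \<in> hom CatPro (D_pro P) (Qpro \<Omega>)"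
proof -
  have "(\<lambda>f\<in>Arr (pcat P). f) \<in> pro_maps P P"
    using cat_id[OF Pro_category, of P] pro by (simp add: pro_hom)
  from thick_catpro_map[OF pro_thick[OF pro] classes_thick D_pro[OF pro, unfolded D_pro_def] this]
  have "id_pair (cpcat (D_pro P)) \<in> catpro_maps (D_pro P) (Qpro \<Omega>)"
    unfolding singletons_R by (simp add: D_map_id[OF pro_thick[OF pro]] D_pro_def Qpro_def classes_R Id_on_iff)
  then show ?thesis using D_pro[OF pro] Qpro by (simp add: incl_def catpro_hom)
qed

lemma LCat_Q: "is_law2 (LCat (Qpro \<Omega>))"
  and unit_Q: "snd (LCat_univ (Qpro \<Omega>)) \<in> hom CatPro (Qpro \<Omega>) (law2_catpro (LCat (Qpro \<Omega>)))"
  using universal_arrowD(1,2)[OF LCat_universal[OF inf Qpro]] by (simp_all add: LCat_def)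

lemma incl_ind:
  "incl_ind \<Omega> \<in> hom TwoLaw (D_law (LP P)) (LCat (Qpro \<Omega>))"
  "Cmp CatPro (law2_catpro_arr (incl_ind \<Omega>)) (D_pro_arr (snd (LP_univ P))) =
    Cmp CatPro (snd (LCat_univ (Qpro \<Omega>))) (incl \<Omega>)"
proof -
  have "\<exists>!m. m \<in> hom TwoLaw (D_law (LP P)) (LCat (Qpro \<Omega>)) \<and>
    Cmp CatPro (law2_catpro_arr m) (D_pro_arr (snd (LP_univ P))) = Cmp CatPro (snd (LCat_univ (Qpro \<Omega>))) (incl \<Omega>)"
    using universal_arrowD(3)[OF D_LP_universal[OF pro] _ cat_cmp[OF CatPro_category incl_hom unit_Q]] LCat_Q by simp
  from theI'[OF this] show "incl_ind \<Omega> \<in> hom TwoLaw (D_law (LP P)) (LCat (Qpro \<Omega>))"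
    "Cmp CatPro (law2_catpro_arr (incl_ind \<Omega>)) (D_pro_arr (snd (LP_univ P))) =
    Cmp CatPro (snd (LCat_univ (Qpro \<Omega>))) (incl \<Omega>)"
    by (simp_all add: incl_ind_def)
qed

lemma inc_bar:
  "inc_bar \<Omega> \<in> hom Law (LP P) (Fr (csig \<Omega>))"
  "Cmp Pro (law_pro_arr (inc_bar \<Omega>)) (snd (LP_univ P)) = cinc \<Omega>"
  using induced[OF LP_universal[OF pro] _ cinc_hom] Fr_law[OF inf] by (simp_all add: inc_bar_def LP_def)

lemma D_inc_bar: "D_law_arr (inc_bar \<Omega>) \<in> hom TwoLaw (D_law (LP P)) (D_law (Fr (csig \<Omega>)))"
  by (rule functor_hom[OF D_law_functor inc_bar(1)])

lemma LO_is_pushout: "is_pushout TwoLaw (D_law_arr (inc_bar \<Omega>)) (incl_ind \<Omega>) (LO \<Omega>, LO_Fr \<Omega>, LO_Q \<Omega>)"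
  using someI_ex[OF pushout_exists[OF inf D_inc_bar incl_ind(1)]]
  by (simp add: LO_def LO_Fr_def LO_Q_def LO_pushout_def)

lemma LO:
  "is_law2 (LO \<Omega>)" "LO_Fr \<Omega> \<in> hom TwoLaw (D_law (Fr (csig \<Omega>))) (LO \<Omega>)"
  "LO_Q \<Omega> \<in> hom TwoLaw (LCat (Qpro \<Omega>)) (LO \<Omega>)"
  "Cmp TwoLaw (LO_Fr \<Omega>) (D_law_arr (inc_bar \<Omega>)) = Cmp TwoLaw (LO_Q \<Omega>) (incl_ind \<Omega>)"
  using LO_is_pushout D_inc_bar incl_ind(1) by (simp_all add: is_pushout_def in_hom)

lemma LO_universal:
  assumes "is_law2 M" "p \<in> hom TwoLaw (D_law (Fr (csig \<Omega>))) M" "q \<in> hom TwoLaw (LCat (Qpro \<Omega>)) M"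
    "Cmp TwoLaw p (D_law_arr (inc_bar \<Omega>)) = Cmp TwoLaw q (incl_ind \<Omega>)"
  shows "\<exists>!u. u \<in> hom TwoLaw (LO \<Omega>) M \<and> Cmp TwoLaw u (LO_Fr \<Omega>) = p \<and> Cmp TwoLaw u (LO_Q \<Omega>) = q"
  using LO_is_pushout D_inc_bar incl_ind(1) assms by (simp add: is_pushout_def in_hom[of "D_law_arr _"] in_hom[of "incl_ind _"])

end

locale ctheory_map = A: ctheory \<Omega> + B: ctheory \<Omega>' for \<Omega> \<Omega>' :: "'u ctheory" +
  fixes J h H
  assumes maps: "(J, h, H) \<in> ctheory_maps \<Omega> \<Omega>'"
begin

lemma J: "J \<in> hom Sig (csig \<Omega>) (csig \<Omega>')" and h: "h \<in> hom Pro (cpro \<Omega>) (cpro \<Omega>')"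
  and H: "H \<in> hom Law (claw \<Omega>) (claw \<Omega>')"
  and inc_eq: "Cmp Pro (cinc \<Omega>') h = Cmp Pro (law_pro_arr (Fr_arr J)) (cinc \<Omega>)"
  and st_eq: "Cmp Law (cst \<Omega>') (Fr_arr J) = Cmp Law H (cst \<Omega>)"
  using maps by (simp_all add: ctheory_maps_def)

lemma FrJ: "Fr_arr J \<in> hom Law (Fr (csig \<Omega>)) (Fr (csig \<Omega>'))"
  by (rule Fr_arr_hom[OF A.inf J])

abbreviation "\<kappa> \<equiv> kappa (\<Omega>, (J, h, H), \<Omega>')"

lemma h_data: obtains a where "h = (cpro \<Omega>, a, cpro \<Omega>')" "a \<in> pro_maps (cpro \<Omega>) (cpro \<Omega>')"
  using h by (auto simp: pro_hom)

text \<open>\<open>h\<close> maps \<open>[f]\<close> into \<open>[h f]\<close>, since \<open>st' i' h = H st i\<close>.\<close>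

lemma st_h: "f \<in> Arr (pcat (cpro \<Omega>)) \<Longrightarrow> B.st (B.\<iota> (data h f)) = data H (A.st (A.\<iota> f))"
proof -
  assume f: "f \<in> Arr (pcat (cpro \<Omega>))"
  obtain a where a: "h = (cpro \<Omega>, a, cpro \<Omega>')" by (rule h_data)
  obtain i i' s s' H' F where i: "cinc \<Omega> = (cpro \<Omega>, i, law_pro (Fr (csig \<Omega>)))" "i \<in> pro_maps (cpro \<Omega>) (law_pro (Fr (csig \<Omega>)))"
    and i': "cinc \<Omega>' = (cpro \<Omega>', i', law_pro (Fr (csig \<Omega>')))"
    and s: "cst \<Omega> = (Fr (csig \<Omega>), s, claw \<Omega>)" and s': "cst \<Omega>' = (Fr (csig \<Omega>'), s', claw \<Omega>')"
    and H': "H = (claw \<Omega>, H', claw \<Omega>')" and F: "Fr_arr J = (Fr (csig \<Omega>), F, Fr (csig \<Omega>'))"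
    using A.cinc_hom B.cinc_hom A.cst_hom B.cst_hom H FrJ by (auto simp: pro_hom law_hom)
  have if': "i f \<in> Arr (lcat (Fr (csig \<Omega>)))"
    using functor_hom[of "pcat (cpro \<Omega>)" "lcat (Fr (csig \<Omega>))" "\<lambda>n. n" i, OF _ arr_hom[OF f]] i(2)
    by (simp add: pro_maps_def in_hom)
  have 1: "i' (a f) = F (i f)"
    using inc_eq f by (simp add: a i i' F law_pro_arr_def) (drule fun_cong[of _ _ f], simp add: compose_def)
  have 2: "s' (F (i f)) = H' (s (i f))"
    using st_eq if' by (simp add: s s' H' F) (drule fun_cong[of _ _ "i f"], simp add: compose_def)
  show ?thesis using 1 2 by (simp add: a i i' s s' H')
qed

lemma h_classes: "(f, g) \<in> pairs (classes \<Omega>) \<Longrightarrow> (data h f, data h g) \<in> pairs (classes \<Omega>')"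
proof -
  assume fg: "(f, g) \<in> pairs (classes \<Omega>)"
  obtain a where a: "h = (cpro \<Omega>, a, cpro \<Omega>')" "a \<in> pro_maps (cpro \<Omega>) (cpro \<Omega>')" by (rule h_data)
  have F: "is_functor (pcat (cpro \<Omega>)) (pcat (cpro \<Omega>')) (\<lambda>n. n) a" using a(2) by (simp add: pro_maps_def)
  have fg': "f \<in> Arr (pcat (cpro \<Omega>))" "g \<in> Arr (pcat (cpro \<Omega>))" using fg by (simp_all add: A.classes_R)
  show ?thesis
    using fg functor_hom[OF F arr_hom[OF fg'(1)]] functor_hom[OF F arr_hom[OF fg'(2)]] st_h[OF fg'(1)] st_h[OF fg'(2)]
    unfolding A.classes_R B.classes_R by (simp add: a(1) in_hom)
qed

lemma kappa_hom: "\<kappa> \<in> hom CatPro (Qpro \<Omega>) (Qpro \<Omega>')"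
proof -
  obtain a where a: "h = (cpro \<Omega>, a, cpro \<Omega>')" "a \<in> pro_maps (cpro \<Omega>) (cpro \<Omega>')" by (rule h_data)
  have "D_map (cpcat (Qpro \<Omega>)) a \<in> catpro_maps (Qpro \<Omega>) (Qpro \<Omega>')"
    unfolding Qpro_def thick_catpro_simps
    by (rule thick_catpro_map[OF A.classes_thick B.classes_thick A.Qpro[unfolded Qpro_def] a(2)])
      (use h_classes a(1) in simp)
  then show ?thesis using A.Qpro B.Qpro by (simp add: kappa_def a(1) catpro_hom)
qed

lemma kappa_incl: "Cmp CatPro \<kappa> (incl \<Omega>) = Cmp CatPro (incl \<Omega>') (D_pro_arr h)"
proof -
  obtain a where a: "h = (cpro \<Omega>, a, cpro \<Omega>')" "a \<in> pro_maps (cpro \<Omega>) (cpro \<Omega>')" by (rule h_data)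
  have fa: "a f \<in> Arr (pcat (cpro \<Omega>'))" if "f \<in> Arr (pcat (cpro \<Omega>))" for f
    using functor_hom[of "pcat (cpro \<Omega>)" "pcat (cpro \<Omega>')" "\<lambda>n. n" a, OF _ arr_hom[OF that]] a(2)
    by (simp add: pro_maps_def in_hom)
  have R: "(f, f) \<in> pairs (classes \<Omega>)" if "f \<in> Arr (pcat (cpro \<Omega>))" for f
    using that by (simp add: A.classes_R)
  have "comp_pair (cpcat (D_pro (cpro \<Omega>))) (D_map (cpcat (Qpro \<Omega>)) a) (id_pair (cpcat (D_pro (cpro \<Omega>)))) =
    comp_pair (cpcat (D_pro (cpro \<Omega>))) (id_pair (cpcat (D_pro (cpro \<Omega>')))) (D_map (cpcat (D_pro (cpro \<Omega>))) a)"
    unfolding comp_pair_eq_iff using fa R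
    by (auto simp: D_pro_def Qpro_def singletons_R id_pair_def Id_on_iff)
  then show ?thesis by (simp add: kappa_def incl_def D_pro_arr_def a(1))
qed

text \<open>A morphism of controlled theories induces a map of spans.  On the apexes \<open>D (LP P)\<close> it is
  \<open>D l\<close>, with \<open>l\<close> the map of free Lawvere theories induced by \<open>h\<close>.  Each of the two squares commutes
  because both ways around agree after restriction along the unit of \<open>LP P\<close>: for the leg to
  \<open>Fr\<close> this is the condition \<open>i' h = Fr(I) i\<close>, for the leg to \<open>LCat\<close> it is naturality of the
  inclusion of objects \<open>D P \<rightarrow> Q\<close>.\<close>

lemma legs_natural:
  "Cmp TwoLaw (Cmp TwoLaw (LO_Fr \<Omega>') (D_law_arr (Fr_arr J))) (D_law_arr (inc_bar \<Omega>)) =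
    Cmp TwoLaw (Cmp TwoLaw (LO_Q \<Omega>') (LCat_arr \<kappa>)) (incl_ind \<Omega>)"
proof -
  let ?P = "cpro \<Omega>" and ?P' = "cpro \<Omega>'"
  define l where "l = induced Law Pro law_pro_arr (LP_univ ?P) (fst (LP_univ ?P')) (Cmp Pro (snd (LP_univ ?P')) h)"
  note u = LP_universal[OF A.pro] and u' = LP_universal[OF B.pro]
  note la = left_adjoint_arr[OF u u' Pro_category h, folded l_def]
  have l: "l \<in> hom Law (LP ?P) (LP ?P')" using la(1) by (simp add: LP_def)
  note eta = universal_arrowD(2)[OF u, folded LP_def] and eta' = universal_arrowD(2)[OF u', folded LP_def]
  note U = law_pro_functor and V = law2_catpro_functor
  note Ul = functor_hom[OF U l] and Ui = functor_hom[OF U A.inc_bar(1)] and Ui' = functor_hom[OF U B.inc_bar(1)]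
    and UF = functor_hom[OF U FrJ]
  have 1: "Cmp Law (inc_bar \<Omega>') l = Cmp Law (Fr_arr J) (inc_bar \<Omega>)"
  proof (rule universal_eqI[OF u U])
    show "Cmp Law (inc_bar \<Omega>') l \<in> hom Law (fst (LP_univ ?P)) (Fr (csig \<Omega>'))"
      "Cmp Law (Fr_arr J) (inc_bar \<Omega>) \<in> hom Law (fst (LP_univ ?P)) (Fr (csig \<Omega>'))"
      using cat_cmp[OF Law_category l B.inc_bar(1)] cat_cmp[OF Law_category A.inc_bar(1) FrJ] by (simp_all add: LP_def)
    have "Cmp Pro (law_pro_arr (Cmp Law (inc_bar \<Omega>') l)) (snd (LP_univ ?P)) = Cmp Pro (cinc \<Omega>') h"
      using functor_cmp[OF U l B.inc_bar(1)] cat_assoc[OF Pro_category eta Ul Ui'] la(2)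
        cat_assoc[OF Pro_category h eta' Ui'] B.inc_bar(2) by simp
    moreover have "Cmp Pro (law_pro_arr (Cmp Law (Fr_arr J) (inc_bar \<Omega>))) (snd (LP_univ ?P)) =
      Cmp Pro (law_pro_arr (Fr_arr J)) (cinc \<Omega>)"
      using functor_cmp[OF U A.inc_bar(1) FrJ] cat_assoc[OF Pro_category eta Ui UF] A.inc_bar(2) by simp
    ultimately show "Cmp Pro (law_pro_arr (Cmp Law (inc_bar \<Omega>') l)) (snd (LP_univ ?P)) =
      Cmp Pro (law_pro_arr (Cmp Law (Fr_arr J) (inc_bar \<Omega>))) (snd (LP_univ ?P))" using inc_eq by simp
  qed
  note Dl = functor_hom[OF D_law_functor l] and DF = functor_hom[OF D_law_functor FrJ]
  have 2: "Cmp TwoLaw (D_law_arr (inc_bar \<Omega>')) (D_law_arr l) = Cmp TwoLaw (D_law_arr (Fr_arr J)) (D_law_arr (inc_bar \<Omega>))"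
    using functor_cmp[OF D_law_functor l B.inc_bar(1)] functor_cmp[OF D_law_functor A.inc_bar(1) FrJ] 1 by simp
  note K = LCat_arr[OF A.inf kappa_hom]
  note DU = D_LP_universal[OF A.pro]
  note Dh = functor_hom[OF D_pro_functor h]
  note VDU = universal_arrowD(2)[OF DU, simplified]
  have VDU': "D_pro_arr (snd (LP_univ ?P')) \<in> hom CatPro (D_pro ?P') (law2_catpro (D_law (LP ?P')))"
    using universal_arrowD(2)[OF D_LP_universal[OF B.pro]] by simp
  note VK = functor_hom[OF V K(1)] and Vi = functor_hom[OF V A.incl_ind(1)] and Vi' = functor_hom[OF V B.incl_ind(1)]
    and VDl = functor_hom[OF V Dl]
  have 3: "Cmp TwoLaw (LCat_arr \<kappa>) (incl_ind \<Omega>) = Cmp TwoLaw (incl_ind \<Omega>') (D_law_arr l)"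
  proof (rule universal_eqI[OF DU V])
    show "Cmp TwoLaw (LCat_arr \<kappa>) (incl_ind \<Omega>) \<in> hom TwoLaw (fst (D_law (LP ?P), D_pro_arr (snd (LP_univ ?P)))) (LCat (Qpro \<Omega>'))"
      "Cmp TwoLaw (incl_ind \<Omega>') (D_law_arr l) \<in> hom TwoLaw (fst (D_law (LP ?P), D_pro_arr (snd (LP_univ ?P)))) (LCat (Qpro \<Omega>'))"
      using cat_cmp[OF TwoLaw_category A.incl_ind(1) K(1)] cat_cmp[OF TwoLaw_category Dl B.incl_ind(1)] by simp_all
    have L: "Cmp CatPro (law2_catpro_arr (Cmp TwoLaw (LCat_arr \<kappa>) (incl_ind \<Omega>))) (D_pro_arr (snd (LP_univ ?P))) =
      Cmp CatPro (snd (LCat_univ (Qpro \<Omega>'))) (Cmp CatPro \<kappa> (incl \<Omega>))"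
      using functor_cmp[OF V A.incl_ind(1) K(1)] cat_assoc[OF CatPro_category VDU Vi VK] A.incl_ind(2) K(2)
        cat_assoc[OF CatPro_category A.incl_hom A.unit_Q VK] cat_assoc[OF CatPro_category A.incl_hom kappa_hom B.unit_Q]
      by simp
    have D: "Cmp CatPro (law2_catpro_arr (D_law_arr l)) (D_pro_arr (snd (LP_univ ?P))) =
      Cmp CatPro (D_pro_arr (snd (LP_univ ?P'))) (D_pro_arr h)"
      using law2_catpro_arr_D[OF l] functor_cmp[OF D_pro_functor eta Ul] functor_cmp[OF D_pro_functor h eta'] la(2) by simp
    have R: "Cmp CatPro (law2_catpro_arr (Cmp TwoLaw (incl_ind \<Omega>') (D_law_arr l))) (D_pro_arr (snd (LP_univ ?P))) =
      Cmp CatPro (snd (LCat_univ (Qpro \<Omega>'))) (Cmp CatPro (incl \<Omega>') (D_pro_arr h))"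
      using functor_cmp[OF V Dl B.incl_ind(1)] cat_assoc[OF CatPro_category VDU VDl Vi'] D
        cat_assoc[OF CatPro_category Dh VDU' Vi'] B.incl_ind(2)
        cat_assoc[OF CatPro_category Dh B.incl_hom B.unit_Q] by simp
    show "Cmp CatPro (law2_catpro_arr (Cmp TwoLaw (LCat_arr \<kappa>) (incl_ind \<Omega>)))
        (snd (D_law (LP ?P), D_pro_arr (snd (LP_univ ?P)))) =
      Cmp CatPro (law2_catpro_arr (Cmp TwoLaw (incl_ind \<Omega>') (D_law_arr l)))
        (snd (D_law (LP ?P), D_pro_arr (snd (LP_univ ?P))))"
      using L R kappa_incl by simp
  qed
  note as = cat_assoc[OF TwoLaw_category A.D_inc_bar DF B.LO(2)]
    cat_assoc[OF TwoLaw_category A.incl_ind(1) K(1) B.LO(3)]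
    cat_assoc[OF TwoLaw_category Dl B.D_inc_bar B.LO(2)] cat_assoc[OF TwoLaw_category Dl B.incl_ind(1) B.LO(3)]
  show ?thesis using as 2 3 B.LO(4) by simp
qed

lemma AR_unique: "\<exists>!u. AR_compatible (\<Omega>, (J, h, H), \<Omega>') u"
  unfolding AR_compatible_def prod.case
  by (rule A.LO_universal[OF B.LO(1)
      cat_cmp[OF TwoLaw_category functor_hom[OF D_law_functor FrJ] B.LO(2)]
      cat_cmp[OF TwoLaw_category LCat_arr(1)[OF A.inf kappa_hom] B.LO(3)] legs_natural])

end

lemma cTh_simps [simp]:
  "Obj cTh = {\<Omega>. is_ctheory \<Omega>}"
  "Idt cTh \<Omega> = (\<Omega>, (Idt Sig (csig \<Omega>), Idt Pro (cpro \<Omega>), Idt Law (claw \<Omega>)), \<Omega>)"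
  "Cmp cTh (B', (J', g, G), \<Omega>'') (\<Omega>, (J, h, H), B) = (\<Omega>, (Cmp Sig J' J, Cmp Pro g h, Cmp Law G H), \<Omega>'')"
  by (simp_all add: cTh_def struct_cat_simps)

lemma cTh_hom: "\<Phi> \<in> hom cTh \<Omega> \<Omega>' \<longleftrightarrow> (\<exists>J h H. \<Phi> = (\<Omega>, (J, h, H), \<Omega>') \<and> ctheory_map \<Omega> \<Omega>' J h H)"
  by (auto simp: cTh_def struct_cat_hom ctheory_map_def ctheory_map_axioms_def ctheory_def)

lemma ctheory_maps_id:
  assumes "is_ctheory \<Omega>"
  shows "(Idt Sig (csig \<Omega>), Idt Pro (cpro \<Omega>), Idt Law (claw \<Omega>)) \<in> ctheory_maps \<Omega> \<Omega>"
proof -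
  interpret ctheory \<Omega> by unfold_locales (rule assms)
  have "Fr_arr (Idt Sig (csig \<Omega>)) = Idt Law (Fr (csig \<Omega>))" by (rule Fr_arr_id[OF inf])
  moreover have "law_pro_arr (Idt Law (Fr (csig \<Omega>))) = Idt Pro (law_pro (Fr (csig \<Omega>)))"
    by (rule functor_id[OF law_pro_functor]) (use Fr_law[OF inf] in simp)
  moreover have "Idt Sig (csig \<Omega>) \<in> hom Sig (csig \<Omega>) (csig \<Omega>)" by (rule cat_id[OF Sig_category]) simp
  moreover have "Idt Pro (cpro \<Omega>) \<in> hom Pro (cpro \<Omega>) (cpro \<Omega>)" by (rule cat_id[OF Pro_category]) (use pro in simp)
  moreover have "Idt Law (claw \<Omega>) \<in> hom Law (claw \<Omega>) (claw \<Omega>)" by (rule cat_id[OF Law_category]) (use law in simp)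
  ultimately show ?thesis unfolding ctheory_maps_def mem_Collect_eq prod.case
    by (simp only: cat_idr[OF Pro_category cinc_hom] cat_idl[OF Pro_category cinc_hom]
        cat_idr[OF Law_category cst_hom] cat_idl[OF Law_category cst_hom] simp_thms)
qed

lemma ctheory_maps_cmp:
  assumes "ctheory_map \<Omega> \<Omega>' J h H" "ctheory_map \<Omega>' \<Omega>'' J' h' H'"
  shows "ctheory_map \<Omega> \<Omega>'' (Cmp Sig J' J) (Cmp Pro h' h) (Cmp Law H' H)"
proof -
  interpret A: ctheory_map \<Omega> \<Omega>' J h H by (rule assms(1))
  interpret B: ctheory_map \<Omega>' \<Omega>'' J' h' H' by (rule assms(2))
  note U = law_pro_functor
  have F: "Fr_arr (Cmp Sig J' J) = Cmp Law (Fr_arr J') (Fr_arr J)" by (rule Fr_arr_cmp[OF A.A.inf A.J B.J])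
  have "Cmp Pro (cinc \<Omega>'') (Cmp Pro h' h) = Cmp Pro (law_pro_arr (Fr_arr (Cmp Sig J' J))) (cinc \<Omega>)"
    using cat_assoc[OF Pro_category A.h B.h B.B.cinc_hom] B.inc_eq A.inc_eq
      cat_assoc[OF Pro_category A.h A.B.cinc_hom functor_hom[OF U B.FrJ]]
      cat_assoc[OF Pro_category A.A.cinc_hom functor_hom[OF U A.FrJ] functor_hom[OF U B.FrJ]]
      functor_cmp[OF U A.FrJ B.FrJ] F by simp
  moreover have "Cmp Law (cst \<Omega>'') (Fr_arr (Cmp Sig J' J)) = Cmp Law (Cmp Law H' H) (cst \<Omega>)"
    using cat_assoc[OF Law_category A.FrJ B.FrJ B.B.cst_hom] B.st_eq A.st_eq
      cat_assoc[OF Law_category A.FrJ A.B.cst_hom B.H] cat_assoc[OF Law_category A.A.cst_hom A.H B.H] F by simp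
  ultimately have "(Cmp Sig J' J, Cmp Pro h' h, Cmp Law H' H) \<in> ctheory_maps \<Omega> \<Omega>''"
    using cat_cmp[OF Sig_category A.J B.J] cat_cmp[OF Pro_category A.h B.h] cat_cmp[OF Law_category A.H B.H]
    by (simp add: ctheory_maps_def)
  then show ?thesis by unfold_locales
qed

lemma cTh_category: "is_category cTh"
proof (rule is_categoryI)
  show "Src cTh f \<in> Obj cTh \<and> Tgt cTh f \<in> Obj cTh" if "f \<in> Arr cTh" for f :: "'u ctheory_arrow"
    using that by (cases f) (auto simp: cTh_def struct_cat_simps)
  show "Idt cTh \<Omega> \<in> hom cTh \<Omega> \<Omega>" if "\<Omega> \<in> Obj cTh" for \<Omega> :: "'u ctheory"
    using that ctheory_maps_id[of \<Omega>] by (simp add: cTh_hom ctheory_map_def ctheory_map_axioms_def ctheory_def)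
next
  fix f g and A B C :: "'u ctheory" assume "f \<in> hom cTh A B" "g \<in> hom cTh B C"
  then show "Cmp cTh g f \<in> hom cTh A C" using ctheory_maps_cmp by (fastforce simp: cTh_hom)
next
  fix f and A B :: "'u ctheory" assume "f \<in> hom cTh A B"
  then obtain J h H where f: "f = (A, (J, h, H), B)" and m: "ctheory_map A B J h H" by (auto simp: cTh_hom)
  interpret ctheory_map A B J h H by (rule m)
  show "Cmp cTh f (Idt cTh A) = f"
    unfolding f cTh_simps by (simp only: cat_idr[OF Sig_category J] cat_idr[OF Pro_category h] cat_idr[OF Law_category H])
  show "Cmp cTh (Idt cTh B) f = f"
    unfolding f cTh_simps by (simp only: cat_idl[OF Sig_category J] cat_idl[OF Pro_category h] cat_idl[OF Law_category H])
next
  fix f g k and A B C D :: "'u ctheory" assume "f \<in> hom cTh A B" "g \<in> hom cTh B C" "k \<in> hom cTh C D"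
  then obtain J h H J' h' H' J'' h'' H'' where f: "f = (A, (J, h, H), B)" and m: "ctheory_map A B J h H"
    and g: "g = (B, (J', h', H'), C)" and m': "ctheory_map B C J' h' H'"
    and k: "k = (C, (J'', h'', H''), D)" and m'': "ctheory_map C D J'' h'' H''" by (auto simp: cTh_hom)
  interpret f: ctheory_map A B J h H by (rule m)
  interpret g: ctheory_map B C J' h' H' by (rule m')
  interpret k: ctheory_map C D J'' h'' H'' by (rule m'')
  show "Cmp cTh k (Cmp cTh g f) = Cmp cTh (Cmp cTh k g) f"
    unfolding f g k cTh_simps
    by (simp only: cat_assoc[OF Sig_category f.J g.J k.J] cat_assoc[OF Pro_category f.h g.h k.h]
        cat_assoc[OF Law_category f.H g.H k.H])
qed

section \<open>The algebraic realization functor\<close>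

lemma AR_compatible_id:
  assumes "is_ctheory \<Omega>"
  shows "AR_compatible (Idt cTh \<Omega>) (Idt TwoLaw (LO \<Omega>))"
proof -
  interpret ctheory \<Omega> by unfold_locales (rule assms)
  have "kappa (Idt cTh \<Omega>) = Idt CatPro (Qpro \<Omega>)"
    using D_map_id[OF classes_thick] by (simp add: kappa_def Qpro_def)
  then have K: "LCat_arr (kappa (Idt cTh \<Omega>)) = Idt TwoLaw (LCat (Qpro \<Omega>))"
    using LCat_arr_id[OF inf Qpro] by simp
  have F: "D_law_arr (Fr_arr (Idt Sig (csig \<Omega>))) = Idt TwoLaw (D_law (Fr (csig \<Omega>)))"
    unfolding Fr_arr_id[OF inf] by (rule functor_id[OF D_law_functor]) (use Fr_law[OF inf] in simp)
  have i: "Idt TwoLaw (LO \<Omega>) \<in> hom TwoLaw (LO \<Omega>) (LO \<Omega>)" by (rule cat_id[OF TwoLaw_category]) (use LO(1) in simp)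
  show ?thesis
    using i K unfolding AR_compatible_def cTh_simps prod.case
    by (simp only: F cat_idl[OF TwoLaw_category LO(2)] cat_idr[OF TwoLaw_category LO(2)]
        cat_idl[OF TwoLaw_category LO(3)] cat_idr[OF TwoLaw_category LO(3)] simp_thms)
qed

text \<open>Pasting the two pairs of squares, using that \<open>D\<close>, \<open>Fr\<close>, \<open>LCat\<close> and \<open>\<kappa>\<close> preserve
  composition.\<close>

lemma AR_compatible_cmp:
  assumes \<Phi>: "\<Phi> \<in> hom cTh \<Omega> \<Omega>'" and \<Psi>: "\<Psi> \<in> hom cTh \<Omega>' \<Omega>''"
    and u: "AR_compatible \<Phi> u" and v: "AR_compatible \<Psi> v"
  shows "AR_compatible (Cmp cTh \<Psi> \<Phi>) (Cmp TwoLaw v u)"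
proof -
  obtain J h H J' h' H' where f: "\<Phi> = (\<Omega>, (J, h, H), \<Omega>')" and m: "ctheory_map \<Omega> \<Omega>' J h H"
    and g: "\<Psi> = (\<Omega>', (J', h', H'), \<Omega>'')" and m': "ctheory_map \<Omega>' \<Omega>'' J' h' H'"
    using \<Phi> \<Psi> by (auto simp: cTh_hom)
  interpret A: ctheory_map \<Omega> \<Omega>' J h H by (rule m)
  interpret B: ctheory_map \<Omega>' \<Omega>'' J' h' H' by (rule m')
  have uh: "u \<in> hom TwoLaw (LO \<Omega>) (LO \<Omega>')" and vh: "v \<in> hom TwoLaw (LO \<Omega>') (LO \<Omega>'')"
    and u1: "Cmp TwoLaw u (LO_Fr \<Omega>) = Cmp TwoLaw (LO_Fr \<Omega>') (D_law_arr (Fr_arr J))"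
    and u2: "Cmp TwoLaw u (LO_Q \<Omega>) = Cmp TwoLaw (LO_Q \<Omega>') (LCat_arr A.\<kappa>)"
    and v1: "Cmp TwoLaw v (LO_Fr \<Omega>') = Cmp TwoLaw (LO_Fr \<Omega>'') (D_law_arr (Fr_arr J'))"
    and v2: "Cmp TwoLaw v (LO_Q \<Omega>') = Cmp TwoLaw (LO_Q \<Omega>'') (LCat_arr B.\<kappa>)"
    using u v by (simp_all add: f g AR_compatible_def)
  obtain a where a: "h = (cpro \<Omega>, a, cpro \<Omega>')" by (rule A.h_data)
  obtain b where b: "h' = (cpro \<Omega>', b, cpro \<Omega>'')" by (rule B.h_data)
  have k: "kappa (Cmp cTh \<Psi> \<Phi>) = Cmp CatPro B.\<kappa> A.\<kappa>"
    using D_map_comp[where h' = b and C' = "pcat (cpro \<Omega>')" and K' = "classes \<Omega>'", OF A.A.classes_thick A.h_classes]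
    by (simp add: f g kappa_def a b Qpro_def)
  have K: "LCat_arr (kappa (Cmp cTh \<Psi> \<Phi>)) = Cmp TwoLaw (LCat_arr B.\<kappa>) (LCat_arr A.\<kappa>)"
    unfolding k by (rule LCat_arr_cmp[OF A.A.inf A.kappa_hom B.kappa_hom])
  note DA = functor_hom[OF D_law_functor A.FrJ] and DB = functor_hom[OF D_law_functor B.FrJ]
  note KA = LCat_arr(1)[OF A.A.inf A.kappa_hom] and KB = LCat_arr(1)[OF A.A.inf B.kappa_hom]
  have F: "D_law_arr (Fr_arr (Cmp Sig J' J)) = Cmp TwoLaw (D_law_arr (Fr_arr J')) (D_law_arr (Fr_arr J))"
    using Fr_arr_cmp[OF A.A.inf A.J B.J] functor_cmp[OF D_law_functor A.FrJ B.FrJ] by simp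
  have 1: "Cmp TwoLaw (Cmp TwoLaw v u) (LO_Fr \<Omega>) = Cmp TwoLaw (LO_Fr \<Omega>'') (D_law_arr (Fr_arr (Cmp Sig J' J)))"
    using cat_assoc[OF TwoLaw_category A.A.LO(2) uh vh] u1 cat_assoc[OF TwoLaw_category DA A.B.LO(2) vh] v1
      cat_assoc[OF TwoLaw_category DA DB B.B.LO(2)] F by simp
  have 2: "Cmp TwoLaw (Cmp TwoLaw v u) (LO_Q \<Omega>) = Cmp TwoLaw (LO_Q \<Omega>'') (LCat_arr (kappa (Cmp cTh \<Psi> \<Phi>)))"
    using cat_assoc[OF TwoLaw_category A.A.LO(3) uh vh] u2 cat_assoc[OF TwoLaw_category KA A.B.LO(3) vh] v2
      cat_assoc[OF TwoLaw_category KA KB B.B.LO(3)] K by simp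
  show ?thesis using cat_cmp[OF TwoLaw_category uh vh] 1 2 by (simp add: f g AR_compatible_def)
qed

theorem mainTheorem6:
  shows "\<exists>AR0 AR1. is_functor (cTh :: ('u ctheory, 'u ctheory_arrow) cat) TwoLaw AR0 AR1 \<and>
    (\<forall>\<Omega>\<in>Obj cTh. AR0 \<Omega> = LO \<Omega> \<and>
       is_pushout TwoLaw (D_law_arr (inc_bar \<Omega>)) (incl_ind \<Omega>) (LO \<Omega>, LO_Fr \<Omega>, LO_Q \<Omega>)) \<and>
    (\<forall>\<Phi>\<in>Arr cTh. AR_compatible \<Phi> (AR1 \<Phi>) \<and> (\<forall>u. AR_compatible \<Phi> u \<longrightarrow> u = AR1 \<Phi>))"
proof -
  define AR1 :: "'u ctheory_arrow \<Rightarrow> 'u law2_arrow" where "AR1 \<Phi> = (THE u. AR_compatible \<Phi> u)" for \<Phi>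
  have ex: "\<exists>!u. AR_compatible \<Phi> u" if "\<Phi> \<in> hom cTh \<Omega> \<Omega>'" for \<Phi> :: "'u ctheory_arrow" and \<Omega> \<Omega>'
    using that ctheory_map.AR_unique by (fastforce simp: cTh_hom)
  have AR1: "AR_compatible \<Phi> (AR1 \<Phi>)" if "\<Phi> \<in> hom cTh \<Omega> \<Omega>'" for \<Phi> and \<Omega> \<Omega>' :: "'u ctheory"
    unfolding AR1_def by (rule theI'[OF ex[OF that]])
  have AR1_eq: "AR1 \<Phi> = u" if "\<Phi> \<in> hom cTh \<Omega> \<Omega>'" "AR_compatible \<Phi> u" for \<Phi> u and \<Omega> \<Omega>' :: "'u ctheory"
    using ex[OF that(1)] AR1[OF that(1)] that(2) by blast
  have "is_functor (cTh :: ('u ctheory, 'u ctheory_arrow) cat) TwoLaw LO AR1"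
  proof (rule is_functorI[OF cTh_category TwoLaw_category])
    fix \<Omega> :: "'u ctheory" assume O: "\<Omega> \<in> Obj cTh"
    then interpret ctheory \<Omega> by unfold_locales simp
    show "LO \<Omega> \<in> Obj TwoLaw" using LO(1) by simp
    show "AR1 (Idt cTh \<Omega>) = Idt TwoLaw (LO \<Omega>)"
      by (rule AR1_eq[OF cat_id[OF cTh_category O] AR_compatible_id[OF ct]])
  next
    fix \<Phi> and \<Omega> \<Omega>' :: "'u ctheory" assume P: "\<Phi> \<in> hom cTh \<Omega> \<Omega>'"
    show "AR1 \<Phi> \<in> hom TwoLaw (LO \<Omega>) (LO \<Omega>')"
      using AR1[OF P] P by (auto simp: cTh_hom AR_compatible_def)
    fix \<Psi> and \<Omega>'' :: "'u ctheory" assume Q: "\<Psi> \<in> hom cTh \<Omega>' \<Omega>''"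
    show "AR1 (Cmp cTh \<Psi> \<Phi>) = Cmp TwoLaw (AR1 \<Psi>) (AR1 \<Phi>)"
      by (rule AR1_eq[OF cat_cmp[OF cTh_category P Q] AR_compatible_cmp[OF P Q AR1[OF P] AR1[OF Q]]])
  qed
  moreover have "is_pushout TwoLaw (D_law_arr (inc_bar \<Omega>)) (incl_ind \<Omega>) (LO \<Omega>, LO_Fr \<Omega>, LO_Q \<Omega>)"
    if "\<Omega> \<in> Obj cTh" for \<Omega> :: "'u ctheory"
    using that ctheory.LO_is_pushout[of \<Omega>] by (simp add: ctheory_def)
  moreover have "AR_compatible \<Phi> (AR1 \<Phi>) \<and> (\<forall>u. AR_compatible \<Phi> u \<longrightarrow> u = AR1 \<Phi>)"
    if "\<Phi> \<in> Arr cTh" for \<Phi> :: "'u ctheory_arrow"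
    using AR1[OF arr_hom[OF that]] AR1_eq[OF arr_hom[OF that]] by blast
  ultimately show ?thesis by blast
qed

end
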